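(* Let $f,g,\phi\in\mathcal{A}$ with $g(z)\neq 0$ and $\phi(z)\neq 0$ for all $z\in\mathcal{U}\setminus\{0\}$. Let $m\in\mathbb{R}_{+}$, $\alpha,\beta,\gamma\in\mathbb{C}$ and $k\in[0,1)$. If $$\left|\frac{1-|z|^{(m+1)\gamma}}{\gamma}\left[\alpha\frac{zf''(z)}{f'(z)}+\beta\left(\frac{zg'(z)}{g(z)}-\frac{z\phi'(z)}{\phi(z)}\right)\right]-\frac{m-1}{2}\right|\leq k\,\frac{m+1}{2}$$ is true for $z\in\mathcal{U}$, then the function $\mathcal{F}_{\alpha,\beta,\gamma}$ given by $$\mathcal{F}_{\alpha,\beta,\gamma}(z)=\left[\gamma\int_{0}^{z}u^{\gamma-1}\left(f'(u)\right)^{\alpha}\left(\frac{g(u)}{\phi(u)}\right)^{\beta}du\right]^{1/\gamma},\qquad z\in\mathcal{U},$$ where the principal branch is intended, has a quasiconformal extension to $\mathbb{C}$.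
   Context: $\mathcal{U}=\{z\in\mathbb{C}:|z|<1\}$ is the open unit disk; $\mathcal{A}$ is the class of analytic functions $f$ in $\mathcal{U}$ with $f(0)=0$ and $f'(0)=1$; $\mathbb{R}_{+}$ is the set of positive real numbers. Expressions such as $zg'(z)/g(z)$ and $g(z)/\phi(z)$ are given their limit value $1$ at $z=0$. Branch convention: near the origin, $h(u)=(f'(u))^{\alpha}(g(u)/\phi(u))^{\beta}$ is formed with principal branches, so $h(0)=1$; the expression in square brackets defining $\mathcal{F}_{\alpha,\beta,\gamma}$ is written as $z^{\gamma}h_2(z)$ with $h_2$ analytic near $0$ and $h_2(0)=1$, and $\mathcal{F}_{\alpha,\beta,\gamma}(z)=z\,[h_2(z)]^{1/\gamma}$ with the principal branch near $0$. For a constant $l\in[0,1)$, a homeomorphism $F$ of $G\subset\mathbb{C}$ is $l$-quasiconformal if its distributional derivatives $\partial_zF$ and $\partial_{\bar z}F$ are locally integrable on $G$ and satisfy $|\partial_{\bar z}F|\leq l\,|\partial_zF|$ almost everywhere in $G$. A function on $\mathcal{U}$ has a quasiconformal extension to $\mathbb{C}$ if it is the restriction to $\mathcal{U}$ of an $l$-quasiconformal homeomorphism of $\mathbb{C}$ for some $l\in[0,1)$. *)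

theory Defs
  imports "HOL-Complex_Analysis.Complex_Analysis"
begin

definition unit_disk :: "complex set" where
  "unit_disk = ball 0 1"

definition class_A :: "(complex \<Rightarrow> complex) set" where
  "class_A = {f. f holomorphic_on unit_disk \<and> f 0 = 0 \<and> deriv f 0 = 1}"

definition zlog_deriv :: "(complex \<Rightarrow> complex) \<Rightarrow> complex \<Rightarrow> complex" where
  "zlog_deriv g z = (if z = 0 then 1 else z * deriv g z / g z)"

definition quot_A :: "(complex \<Rightarrow> complex) \<Rightarrow> (complex \<Rightarrow> complex) \<Rightarrow> complex \<Rightarrow> complex" where
  "quot_A g \<phi> z = (if z = 0 then 1 else g z / \<phi> z)"

subsection \<open>The integral operator\<close>

text \<open>
  The principal powers below are holomorphic near the origin only; \<open>is_F_op\<close> takes the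
  analytic continuation to the disk of the germ they define.
\<close>

definition h_germ ::
  "complex \<Rightarrow> complex \<Rightarrow> (complex \<Rightarrow> complex) \<Rightarrow> (complex \<Rightarrow> complex) \<Rightarrow> (complex \<Rightarrow> complex)
    \<Rightarrow> complex \<Rightarrow> complex" where
  "h_germ \<alpha> \<beta> f g \<phi> u = deriv f u powr \<alpha> * quot_A g \<phi> u powr \<beta>"

text \<open>
  The integral from \<open>0\<close> to \<open>z\<close> of \<open>\<gamma> u\<^sup>\<gamma>\<^sup>-\<^sup>1 h(u)\<close>, along the segment.
  It converges when the real part of \<open>\<gamma>\<close> is positive. Otherwise the contribution
  of \<open>h(0) = 1\<close> diverges at \<open>0\<close>, and is read as the primitive \<open>z\<^sup>\<gamma>\<close> of \<open>\<gamma> u\<^sup>\<gamma>\<^sup>-\<^sup>1\<close>,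
  which makes the value \<open>z\<^sup>\<gamma>\<close> times an analytic function equal to \<open>1\<close> at \<open>0\<close> whenever the
  remaining integral converges. (For positive real part both formulas agree.) Both
  occurrences of a power of base \<open>u\<close> or \<open>z\<close> are principal; as \<open>u\<close> and \<open>z\<close> lie on a common ray,
  the choice of branch cancels in \<open>h2_germ\<close>.
\<close>

definition bracket ::
  "complex \<Rightarrow> complex \<Rightarrow> complex \<Rightarrow> (complex \<Rightarrow> complex) \<Rightarrow> (complex \<Rightarrow> complex)
    \<Rightarrow> (complex \<Rightarrow> complex) \<Rightarrow> complex \<Rightarrow> complex" where
  "bracket \<alpha> \<beta> \<gamma> f g \<phi> z =
     (if Re \<gamma> > 0
      then \<gamma> * contour_integral (linepath 0 z) (\<lambda>u. u powr (\<gamma> - 1) * h_germ \<alpha> \<beta> f g \<phi> u)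
      else z powr \<gamma> +
        \<gamma> * contour_integral (linepath 0 z) (\<lambda>u. u powr (\<gamma> - 1) * (h_germ \<alpha> \<beta> f g \<phi> u - 1)))"

definition h2_germ ::
  "complex \<Rightarrow> complex \<Rightarrow> complex \<Rightarrow> (complex \<Rightarrow> complex) \<Rightarrow> (complex \<Rightarrow> complex)
    \<Rightarrow> (complex \<Rightarrow> complex) \<Rightarrow> complex \<Rightarrow> complex" where
  "h2_germ \<alpha> \<beta> \<gamma> f g \<phi> z = (if z = 0 then 1 else bracket \<alpha> \<beta> \<gamma> f g \<phi> z / z powr \<gamma>)"

definition is_F_op ::
  "complex \<Rightarrow> complex \<Rightarrow> complex \<Rightarrow> (complex \<Rightarrow> complex) \<Rightarrow> (complex \<Rightarrow> complex)
    \<Rightarrow> (complex \<Rightarrow> complex) \<Rightarrow> (complex \<Rightarrow> complex) \<Rightarrow> bool" where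
  "is_F_op \<alpha> \<beta> \<gamma> f g \<phi> F \<longleftrightarrow>
     F holomorphic_on unit_disk \<and>
     (\<forall>\<^sub>F z in nhds 0. F z = z * h2_germ \<alpha> \<beta> \<gamma> f g \<phi> z powr (1 / \<gamma>))"

subsection \<open>Quasiconformal maps\<close>

primrec Ck :: "nat \<Rightarrow> (complex \<Rightarrow> complex) \<Rightarrow> bool" where
  "Ck 0 \<psi> \<longleftrightarrow> continuous_on UNIV \<psi>"
| "Ck (Suc n) \<psi> \<longleftrightarrow>
     (\<forall>z. \<psi> differentiable (at z)) \<and> (\<forall>v. Ck n (\<lambda>z. frechet_derivative \<psi> (at z) v))"

text \<open>Real differentiability is meant in \<open>Ck\<close>: the plane is a real normed space here.\<close>

definition test_function :: "complex set \<Rightarrow> (complex \<Rightarrow> complex) \<Rightarrow> bool" where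
  "test_function G \<psi> \<longleftrightarrow>
     (\<forall>n. Ck n \<psi>) \<and> compact (closure {z. \<psi> z \<noteq> 0}) \<and> closure {z. \<psi> z \<noteq> 0} \<subseteq> G"

definition d_z :: "(complex \<Rightarrow> complex) \<Rightarrow> complex \<Rightarrow> complex" where
  "d_z \<psi> z = (frechet_derivative \<psi> (at z) 1 - \<i> * frechet_derivative \<psi> (at z) \<i>) / 2"

definition d_zbar :: "(complex \<Rightarrow> complex) \<Rightarrow> complex \<Rightarrow> complex" where
  "d_zbar \<psi> z = (frechet_derivative \<psi> (at z) 1 + \<i> * frechet_derivative \<psi> (at z) \<i>) / 2"

definition locally_integrable_on :: "(complex \<Rightarrow> complex) \<Rightarrow> complex set \<Rightarrow> bool" where
  "locally_integrable_on w G \<longleftrightarrow> (\<forall>K. compact K \<and> K \<subseteq> G \<longrightarrow> w absolutely_integrable_on K)"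

definition weak_d_z ::
  "complex set \<Rightarrow> (complex \<Rightarrow> complex) \<Rightarrow> (complex \<Rightarrow> complex) \<Rightarrow> bool" where
  "weak_d_z G F w \<longleftrightarrow> locally_integrable_on w G \<and>
     (\<forall>\<psi>. test_function G \<psi> \<longrightarrow>
        (LINT z:G|lebesgue. F z * d_z \<psi> z) = - (LINT z:G|lebesgue. w z * \<psi> z))"

definition weak_d_zbar ::
  "complex set \<Rightarrow> (complex \<Rightarrow> complex) \<Rightarrow> (complex \<Rightarrow> complex) \<Rightarrow> bool" where
  "weak_d_zbar G F w \<longleftrightarrow> locally_integrable_on w G \<and>
     (\<forall>\<psi>. test_function G \<psi> \<longrightarrow>
        (LINT z:G|lebesgue. F z * d_zbar \<psi> z) = - (LINT z:G|lebesgue. w z * \<psi> z))"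

definition quasiconformal_on :: "real \<Rightarrow> complex set \<Rightarrow> (complex \<Rightarrow> complex) \<Rightarrow> bool" where
  "quasiconformal_on l G F \<longleftrightarrow>
     open G \<and> (\<exists>F'. homeomorphism G (F ` G) F F') \<and>
     (\<exists>p q. weak_d_z G F p \<and> weak_d_zbar G F q \<and>
        (AE z in lebesgue. z \<in> G \<longrightarrow> cmod (q z) \<le> l * cmod (p z)))"

definition has_quasiconformal_extension :: "(complex \<Rightarrow> complex) \<Rightarrow> bool" where
  "has_quasiconformal_extension F \<longleftrightarrow>
     (\<exists>l \<Phi>. 0 \<le> l \<and> l < 1 \<and> quasiconformal_on l UNIV \<Phi> \<and> surj \<Phi> \<and>
        (\<forall>z\<in>unit_disk. \<Phi> z = F z))"

end

theory Submission
  imports Defs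
begin

text \<open>
  Put \<open>h = (f')\<^sup>\<alpha> (g/\<phi>)\<^sup>\<beta>\<close> and \<open>G = z h'/h\<close>, so that the bracket in the hypothesis is \<open>G\<close>. Let
  \<open>h2\<close> be the solution of \<open>z h2' = \<gamma> (h - h2)\<close> with \<open>h2(0) = 1\<close>; then \<open>z\<^sup>\<gamma> h2(z)\<close> is
  \<open>\<gamma>\<close> times the integral (regularized, if \<open>Re \<gamma> \<le> 0\<close>) in the definition of the operator, and the operator is \<open>z h2(z)\<^sup>1\<^sup>/\<^sup>\<gamma>\<close>. With
  \<open>e(t) = exp(-(m+1)\<gamma>t)\<close>, consider for \<open>t \<ge> 0\<close> and \<open>|z| \<le> exp(-t)\<close>
    \<open>N(z,t) = h(z) + (h2(z) - h(z)) e(t)\<close>  and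
    \<open>P(z,t) = z exp((m+1)t) N(z,t)\<^sup>1\<^sup>/\<^sup>\<gamma>\<close>.
  After the substitution of \<open>exp(-t) z\<close> for \<open>z\<close> this is the Loewner chain that starts at the
  operator. A computation gives \<open>z P\<^sub>z = w P\<^sub>t\<close> with \<open>w = (1 + (1 - e(t)) G/\<gamma>)/(m+1)\<close>. On the
  circle \<open>|z| = exp(-t)\<close> the hypothesis says exactly \<open>|w - 1/2| \<le> k/2\<close>, and by the maximum
  principle this holds on the whole disk \<open>|z| \<le> exp(-t)\<close>.

  A point that moves with \<open>P(z,t)\<close> constant satisfies \<open>dz/dt = -z/w\<close>, where \<open>Re(1/w) \<ge> 2/(1+k) > 1\<close>
  and \<open>|1/w| \<le> 2/(1-k)\<close>. Hence it moves towards the origin faster than the circle \<open>|z| = exp(-t)\<close>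
  shrinks, and after a bounded time it lies in a disk \<open>|z| \<le> r0 exp(-t)\<close> on which \<open>N\<close> is uniformly
  close to \<open>1\<close>. Everything about the chain is read off there and transported back: \<open>N\<close> has no
  zeros (\<open>N_nonzero\<close>), so that the power is defined; \<open>P(\<cdot>,t)\<close> is injective (\<open>Y_injective\<close>); and
  \<open>log N\<close> is bounded (\<open>Y_bound\<close>). The motion is obtained without solving a differential equation:
  Brouwer's theorem moves a level point for a short time (\<open>level_point_moves\<close>), and compactness
  of the level set continues the motion (\<open>forward_tracking\<close>).

  The extension is \<open>P(z,0)\<close> in the disk and \<open>P(1/cnj z, ln|z|)\<close> outside. Its complex dilatation
  has modulus \<open>|1 - 2w| \<le> k\<close> outside and vanishes inside. Near the circle the hypothesis bounds
  \<open>|h|\<close>, and with it the derivatives of the extension, by a multiple of the power \<open>-\<kappa>\<close> of the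
  distance to the circle, where \<open>\<kappa> = 2k/(1+k) < 1\<close> (\<open>h_growth\<close>). As \<open>\<kappa> < 1\<close>, the approximating maps \<open>PT\<close>,
  which are homeomorphisms of the plane, converge locally uniformly (\<open>PT_cauchy\<close>), so the
  extension is continuous, and its derivatives are locally integrable, hence are weak derivatives,
  because a line meets the circle in at most two points (\<open>weak_derivatives_off_circle\<close>).

  Injectivity on the circle comes from topology. Fibres of a limit of homeomorphisms are
  connected. The extension is injective off the circle, so a fibre with two points lies in the
  circle and contains an arc, on which a nonconstant holomorphic function with continuous
  boundary values cannot be constant (\<open>Ext_injective\<close>).

  If \<open>Re \<gamma> \<le> 0\<close>, the integral near \<open>0\<close> and the behaviour of \<open>N\<close> for large \<open>t\<close> need care. If
  \<open>Re \<gamma> < 0\<close>, the hypothesis at small \<open>|z|\<close> forces the Taylor coefficients of \<open>h\<close> of order \<open>n\<close>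
  with \<open>1 \<le> n < -(m+1) Re \<gamma>\<close> to vanish (\<open>early_coefficients_vanish\<close>); this settles both. If \<open>Re \<gamma> = 0\<close>, \<open>h(0) = 1\<close> suffices.
\<close>

section \<open>Logarithms and moving level points\<close>

text \<open>
  Near \<open>x\<close> a continuous logarithm differs from a branch of \<open>Ln\<close> by a constant. The domain
  \<open>S\<close> is arbitrary, so that one-sided derivatives at boundary points are covered.
\<close>

lemma has_derivative_logarithm:
  fixes l :: "'a::real_normed_vector \<Rightarrow> complex"
  assumes cont: "continuous (at x within S) l" and x: "x \<in> S"
    and der: "((\<lambda>x. exp (l x)) has_derivative D) (at x within S)"
  shows "(l has_derivative (\<lambda>v. D v / exp (l x))) (at x within S)"
proof -
  have g: "((\<lambda>y. exp (l y) / exp (l x)) has_derivative (\<lambda>v. D v / exp (l x))) (at x within S)"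
    using has_derivative_mult_left[OF der, of "inverse (exp (l x))"] by (simp add: divide_inverse)
  have 1: "(Ln has_derivative (\<lambda>v. v)) (at (exp (l x) / exp (l x)))"
    using has_field_derivative_Ln[of 1] by (simp add: has_field_derivative_def lambda_one)
  have "((\<lambda>y. Ln (exp (l y) / exp (l x)) + l x) has_derivative (\<lambda>v. D v / exp (l x))) (at x within S)"
    using has_derivative_compose[OF g 1] by (auto intro: derivative_eq_intros)
  moreover have "\<forall>\<^sub>F y in at x within S. l y = Ln (exp (l y) / exp (l x)) + l x"
  proof -
    have "\<forall>\<^sub>F y in at x within S. dist (l y) (l x) < 1"
      using cont unfolding continuous_within tendsto_iff by auto
    then show ?thesis
    proof eventually_elim
      case (elim y)
      have "\<bar>Im (l y - l x)\<bar> < 1"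
        using elim abs_Im_le_cmod[of "l y - l x"] by (simp add: dist_norm)
      then have "Ln (exp (l y - l x)) = l y - l x"
        using pi_gt3 by (intro Ln_exp) auto
      then show ?case by (simp add: exp_diff)
    qed
  qed
  then have "\<forall>\<^sub>F y in at x within S. Ln (exp (l y) / exp (l x)) + l x = l y"
    by eventually_elim simp
  ultimately show ?thesis
    by (rule has_derivative_transform_eventually) (simp_all add: x)
qed

lemma continuous_logarithm_unique:
  fixes f g :: "'a::topological_space \<Rightarrow> complex"
  assumes S: "connected S" and f: "continuous_on S f" and g: "continuous_on S g"
    and eq: "\<And>x. x \<in> S \<Longrightarrow> exp (f x) = exp (g x)" and a: "a \<in> S" "f a = g a" and x: "x \<in> S"
  shows "f x = g x"
proof -
  have "(\<lambda>x. f x - g x) constant_on S"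
  proof (rule continuous_discrete_range_constant[OF S])
    show "continuous_on S (\<lambda>x. f x - g x)" by (intro continuous_intros f g)
    fix x assume x: "x \<in> S"
    have "2 * pi \<le> cmod (f y - g y - (f x - g x))"
      if y: "y \<in> S" "f y - g y \<noteq> f x - g x" for y
    proof -
      obtain m :: int where m: "f y = g y + (of_int (2 * m) * pi) * \<i>"
        using eq[OF y(1)] unfolding exp_eq by blast
      obtain n :: int where n: "f x = g x + (of_int (2 * n) * pi) * \<i>"
        using eq[OF x] unfolding exp_eq by blast
      have "f y - g y - (f x - g x) = of_int (2 * (m - n)) * pi * \<i>"
        using m n by (simp add: algebra_simps)
      then have "cmod (f y - g y - (f x - g x)) = cmod (of_real (of_int (2 * (m - n)) * pi) * \<i>)"
        by simp
      also have "\<dots> = \<bar>of_int (2 * (m - n)) * pi\<bar>"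
        unfolding norm_mult norm_of_real by simp
      finally have "cmod (f y - g y - (f x - g x)) = 2 * pi * \<bar>real_of_int (m - n)\<bar>"
        by (simp only: abs_mult of_int_mult) simp
      moreover have "m \<noteq> n" using m n y(2) by auto
      then have "1 \<le> \<bar>real_of_int (m - n)\<bar>" by linarith
      then have "2 * pi * 1 \<le> 2 * pi * \<bar>real_of_int (m - n)\<bar>"
        using pi_gt_zero by (intro mult_left_mono) auto
      ultimately show ?thesis by simp
    qed
    then show "\<exists>e>0. \<forall>y. y \<in> S \<and> f y - g y \<noteq> f x - g x \<longrightarrow> e \<le> cmod (f y - g y - (f x - g x))"
      using pi_gt_zero by (intro exI[of _ "2 * pi"]) auto
  qed
  then obtain c where "\<And>x. x \<in> S \<Longrightarrow> f x - g x = c" by (auto simp: constant_on_def)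
  then show ?thesis using a x by (metis diff_eq_eq eq_iff_diff_eq_0)
qed

lemma nearly_linear_on_convex:
  fixes f :: "complex \<Rightarrow> complex"
  assumes "convex S" "\<And>y. y \<in> S \<Longrightarrow> (f has_field_derivative f' y) (at y within S)"
    "\<And>y. y \<in> S \<Longrightarrow> cmod (f' y - a) \<le> B" "x \<in> S" "y \<in> S"
  shows "cmod (f x - f y - a * (x - y)) \<le> B * cmod (x - y)"
proof -
  have "norm ((f x - a * x) - (f y - a * y)) \<le> B * norm (x - y)"
    using assms by (intro field_differentiable_bound[of S "\<lambda>y. f y - a * y" "\<lambda>y. f' y - a"])
      (auto intro!: derivative_eq_intros)
  then show ?thesis by (simp add: algebra_simps)
qed

lemma starlike_scaled_disks:
  assumes "0 < r"
  shows "starlike {p::complex \<times> real. 0 \<le> snd p \<and> cmod (fst p) \<le> r * exp (- snd p) \<and> cmod (fst p) < 1}"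
  unfolding starlike_def
proof (intro bexI ballI subsetI)
  show "(0, 0) \<in> {p::complex \<times> real. 0 \<le> snd p \<and> cmod (fst p) \<le> r * exp (- snd p) \<and> cmod (fst p) < 1}"
    using assms by simp
  fix p q :: "complex \<times> real"
  assume p: "p \<in> {p. 0 \<le> snd p \<and> cmod (fst p) \<le> r * exp (- snd p) \<and> cmod (fst p) < 1}"
    and q: "q \<in> closed_segment (0, 0) p"
  from q obtain u where u: "0 \<le> u" "u \<le> 1" and qu: "q = (of_real u * fst p, u * snd p)"
    unfolding closed_segment_def by (cases p) (auto simp: scaleR_conv_of_real)
  have "u * cmod (fst p) \<le> 1 * cmod (fst p)" using u by (intro mult_right_mono) auto
  moreover have "exp (- snd p) \<le> exp (- (u * snd p))"
    using u p mult_right_mono[of u 1 "snd p"] by simp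
  then have "r * exp (- snd p) \<le> r * exp (- (u * snd p))" using assms by (intro mult_left_mono) auto
  ultimately show "q \<in> {p. 0 \<le> snd p \<and> cmod (fst p) \<le> r * exp (- snd p) \<and> cmod (fst p) < 1}"
    using p u by (auto simp: qu norm_mult)
qed

text \<open>
  A substitute for the flow \<open>dy/dt = -1/w\<close> along a level set of \<open>Q\<close>: a short time \<open>\<epsilon>\<close> after
  \<open>t0\<close> the zero persists, near the position that the linearisation predicts. One
  derivative at the point and continuity are enough, since the zero is found by Brouwer's
  theorem. The condition on \<open>S\<close> says that the predicted motion leads into \<open>S\<close>; the starting point
  itself may lie on its boundary.
\<close>

lemma level_point_moves:
  fixes Q :: "complex \<times> real \<Rightarrow> complex"
  assumes der: "(Q has_derivative (\<lambda>d. a * (w * fst d + of_real (snd d)))) (at (y0, t0) within S)"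
    and nz: "a \<noteq> 0" "w \<noteq> 0" and Q0: "Q (y0, t0) = 0" and \<delta>: "0 < \<delta>"
    and cont: "continuous_on S Q"
    and inS: "\<And>\<epsilon> y. 0 < \<epsilon> \<Longrightarrow> cmod (y - (y0 - of_real \<epsilon> / w)) \<le> \<delta> * \<epsilon> \<Longrightarrow> (y, t0 + \<epsilon>) \<in> S"
  shows "\<exists>e>0. \<forall>\<epsilon>. 0 < \<epsilon> \<and> \<epsilon> < e \<longrightarrow>
           (\<exists>y. cmod (y - (y0 - of_real \<epsilon> / w)) \<le> \<delta> * \<epsilon> \<and> Q (y, t0 + \<epsilon>) = 0)"
proof -
  define B where "B = 1 / cmod w + \<delta> + 1"
  have B: "B > 0" using \<delta> nz by (simp add: B_def add_pos_pos)
  define e where "e = \<delta> * cmod (a * w) / B"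
  have e: "e > 0" using \<delta> nz B by (simp add: e_def)
  obtain d where d: "d > 0" and dd: "\<And>p. p \<in> S \<Longrightarrow> norm (p - (y0, t0)) < d \<Longrightarrow>
      norm (Q p - Q (y0, t0) - a * (w * fst (p - (y0, t0)) + of_real (snd (p - (y0, t0)))))
        \<le> e * norm (p - (y0, t0))"
    using der e unfolding has_derivative_within_alt by blast
  have "\<exists>y. cmod (y - (y0 - of_real \<epsilon> / w)) \<le> \<delta> * \<epsilon> \<and> Q (y, t0 + \<epsilon>) = 0"
    if \<epsilon>: "0 < \<epsilon>" "\<epsilon> < d / B" for \<epsilon>
  proof -
    define c where "c = y0 - of_real \<epsilon> / w"
    \<comment> \<open>A simplified Newton map: its fixed points are the zeros of \<open>Q\<close>.\<close>
    define T where "T = (\<lambda>y. y - Q (y, t0 + \<epsilon>) / (a * w))"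
    have mem: "(y, t0 + \<epsilon>) \<in> S" if "y \<in> cball c (\<delta> * \<epsilon>)" for y
      using inS[of \<epsilon> y] that \<epsilon> by (simp add: c_def dist_norm norm_minus_commute)
    have contT: "continuous_on (cball c (\<delta> * \<epsilon>)) T"
      unfolding T_def using nz
      by (intro continuous_intros continuous_on_compose2[OF cont]) (auto intro: mem)
    have "T y \<in> cball c (\<delta> * \<epsilon>)" if y: "y \<in> cball c (\<delta> * \<epsilon>)" for y
    proof -
      have yc: "cmod (y - c) \<le> \<delta> * \<epsilon>" using y by (simp add: dist_norm norm_minus_commute)
      have "y - y0 = (y - c) - of_real \<epsilon> / w" by (simp add: c_def)
      then have y0: "cmod (y - y0) = cmod ((y - c) - of_real \<epsilon> / w)" by (rule arg_cong)
      have "cmod (y - y0) \<le> \<delta> * \<epsilon> + \<epsilon> / cmod w"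
        using yc norm_triangle_ineq4[of "y - c" "of_real \<epsilon> / w"] \<epsilon>
        unfolding y0 by (simp add: norm_divide)
      then have nB: "norm ((y, t0 + \<epsilon>) - (y0, t0)) \<le> B * \<epsilon>"
        using norm_Pair_le[of "y - y0" \<epsilon>] \<epsilon> by (simp add: B_def algebra_simps)
      also have "B * \<epsilon> < d" using \<epsilon> B by (simp add: field_simps)
      finally have "norm (Q (y, t0 + \<epsilon>) - a * (w * (y - y0) + of_real \<epsilon>))
          \<le> e * norm ((y, t0 + \<epsilon>) - (y0, t0))"
        using dd[OF mem[OF y]] Q0 by simp
      also have "\<dots> \<le> e * (B * \<epsilon>)" using nB e by (intro mult_left_mono) auto
      also have "\<dots> = \<delta> * \<epsilon> * cmod (a * w)" using B by (simp add: e_def)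
      finally have *: "norm (Q (y, t0 + \<epsilon>) - a * (w * (y - y0) + of_real \<epsilon>)) \<le> \<delta> * \<epsilon> * cmod (a * w)" .
      have "T y - c = - (Q (y, t0 + \<epsilon>) - a * (w * (y - y0) + of_real \<epsilon>)) / (a * w)"
        using nz by (simp add: T_def c_def field_simps)
      then have "cmod (T y - c) = norm (Q (y, t0 + \<epsilon>) - a * (w * (y - y0) + of_real \<epsilon>)) / cmod (a * w)"
        by (simp add: norm_divide norm_minus_commute)
      also have "\<dots> \<le> \<delta> * \<epsilon>" using * nz by (simp add: field_simps)
      finally show ?thesis by (simp add: dist_norm norm_minus_commute)
    qed
    then have "T \<in> cball c (\<delta> * \<epsilon>) \<rightarrow> cball c (\<delta> * \<epsilon>)" by blast
    moreover have "cball c (\<delta> * \<epsilon>) \<noteq> {}"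
      using mult_pos_pos[OF \<delta> \<epsilon>(1)] by simp
    ultimately obtain y where "y \<in> cball c (\<delta> * \<epsilon>)" "T y = y"
      using brouwer[OF compact_cball convex_cball _ contT] by metis
    then show ?thesis using nz
      by (intro exI[of _ y]) (auto simp: T_def c_def dist_norm norm_minus_commute)
  qed
  then show ?thesis using d B by (intro exI[of _ "d / B"]) auto
qed

text \<open>
  A closed set of space-time points, each of which can be continued for a short time with speed
  at most \<open>C\<close>, can be followed up to any later time: among the points reachable with speed \<open>C\<close>,
  compactness provides a latest one.
\<close>

lemma forward_tracking:
  fixes Z :: "('a::heine_borel \<times> real) set"
  assumes Z: "closed Z" and C: "0 \<le> C"
    and step: "\<And>y t. (y, t) \<in> Z \<Longrightarrow> s \<le> t \<Longrightarrow> t < T \<Longrightarrow>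
      \<exists>\<epsilon> y'. 0 < \<epsilon> \<and> t + \<epsilon> \<le> T \<and> (y', t + \<epsilon>) \<in> Z \<and> dist y' y \<le> C * \<epsilon>"
    and init: "(y0, s) \<in> Z" "s \<le> T"
  shows "\<exists>y. (y, T) \<in> Z \<and> dist y y0 \<le> C * (T - s)"
proof -
  \<comment> \<open>The part of \<open>Z\<close> inside the cone of speed \<open>C\<close> with vertex \<open>(y0, s)\<close>.\<close>
  define W where "W = Z \<inter> {p. s \<le> snd p \<and> snd p \<le> T \<and> dist (fst p) y0 \<le> C * (snd p - s)}"
  have "W \<subseteq> cball y0 (C * (T - s)) \<times> {s..T}"
  proof
    fix p assume p: "p \<in> W"
    then have "dist (fst p) y0 \<le> C * (snd p - s)" "C * (snd p - s) \<le> C * (T - s)"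
      using C by (auto simp: W_def intro: mult_left_mono)
    then show "p \<in> cball y0 (C * (T - s)) \<times> {s..T}"
      using p by (cases p) (auto simp: W_def dist_commute)
  qed
  moreover have "compact (cball y0 (C * (T - s)) \<times> {s..T})"
    by (intro compact_Times compact_cball compact_Icc)
  ultimately have "bounded W" using compact_imp_bounded bounded_subset by blast
  moreover have "closed W" unfolding W_def
    by (intro closed_Int Z closed_Collect_conj closed_Collect_le continuous_intros)
  ultimately have "compact W" by (simp add: compact_eq_bounded_closed)
  moreover have "(y0, s) \<in> W" using init by (simp add: W_def)
  ultimately obtain p where p: "p \<in> W" and mx: "\<And>q. q \<in> W \<Longrightarrow> snd q \<le> snd p"
    using continuous_attains_sup[of W snd] continuous_on_snd[OF continuous_on_id] by blast
  obtain y t where yt: "p = (y, t)" by (cases p)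
  have "t = T"
  proof (rule ccontr)
    assume "t \<noteq> T"
    then have "s \<le> t" "t < T" "(y, t) \<in> Z" "dist y y0 \<le> C * (t - s)" using p yt by (auto simp: W_def)
    with step obtain \<epsilon> y' where e: "0 < \<epsilon>" "t + \<epsilon> \<le> T" "(y', t + \<epsilon>) \<in> Z" "dist y' y \<le> C * \<epsilon>" by blast
    have "dist y' y0 \<le> C * \<epsilon> + C * (t - s)"
      using e(4) \<open>dist y y0 \<le> C * (t - s)\<close> dist_triangle[of y' y0 y] by linarith
    then have "(y', t + \<epsilon>) \<in> W" using e \<open>s \<le> t\<close> by (auto simp: W_def algebra_simps)
    from mx[OF this] show False using yt e(1) by simp
  qed
  then show ?thesis using p yt by (auto simp: W_def)
qed

section \<open>Limits of plane homeomorphisms\<close>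

text \<open>
  The range is open by invariance of domain and closed by properness.
\<close>

lemma homeomorphism_of_injective_proper:
  fixes f :: "complex \<Rightarrow> complex"
  assumes cont: "continuous_on UNIV f" and inj: "inj f"
    and proper: "\<And>B. \<exists>R. \<forall>z. R < cmod z \<longrightarrow> B < cmod (f z)"
  shows "\<exists>g. homeomorphism UNIV UNIV f g"
proof -
  have "open (range f)" by (rule invariance_of_domain[OF cont open_UNIV inj])
  moreover have "closed (range f)"
    unfolding closed_sequential_limits
  proof (intro allI impI, elim conjE)
    fix s l assume s: "\<forall>n. s n \<in> range f" and l: "s \<longlonglongrightarrow> l"
    have "\<forall>n. \<exists>y. s n = f y" using s by blast
    then obtain x where x: "\<And>n. s n = f (x n)" by metis
    obtain B where B: "\<And>n. cmod (s n) \<le> B"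
      using convergent_imp_bounded[OF l] by (auto simp: bounded_iff)
    obtain R where R: "\<And>z. R < cmod z \<Longrightarrow> B < cmod (f z)" using proper by blast
    have "x n \<in> cball 0 R" for n using R[of "x n"] B[of n] x[of n] by (simp, linarith)
    then obtain a r where ar: "strict_mono (r :: nat \<Rightarrow> nat)" "(x \<circ> r) \<longlonglongrightarrow> a"
      using compact_cball[of 0 R] unfolding compact_def by blast
    have "(\<lambda>n. f ((x \<circ> r) n)) \<longlonglongrightarrow> f a"
      by (rule continuous_on_tendsto_compose[OF cont ar(2)]) auto
    moreover have "(\<lambda>n. f ((x \<circ> r) n)) = s \<circ> r" using x by auto
    ultimately have "(s \<circ> r) \<longlonglongrightarrow> f a" by simp
    moreover have "(s \<circ> r) \<longlonglongrightarrow> l" by (rule LIMSEQ_subseq_LIMSEQ[OF l ar(1)])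
    ultimately have "l = f a" using LIMSEQ_unique by blast
    then show "l \<in> range f" by simp
  qed
  ultimately have "range f = UNIV" using clopen[of "range f"] by auto
  moreover obtain g where "homeomorphism UNIV (range f) f g"
    using invariance_of_domain_homeomorphism[OF open_UNIV cont _ inj] by auto
  ultimately show ?thesis by auto
qed

text \<open>
  If the fibre over \<open>w\<close> split into two closed parts, separate them by the frontier of an open set
  \<open>U\<close>. On that frontier the limit keeps a distance from \<open>w\<close>, hence so does a late \<open>\<Psi> n\<close>. But the
  preimage under \<open>\<Psi> n\<close> of a small disk about \<open>w\<close> is connected, and it contains points of both parts.
\<close>

lemma connected_fibre_of_limit_of_homeomorphisms:
  fixes \<Phi> :: "complex \<Rightarrow> complex"
  assumes hom: "\<And>n. homeomorphism UNIV UNIV (\<Psi> n) (\<Psi>' n)"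
    and lim: "\<And>R. uniform_limit (cball 0 R) \<Psi> \<Phi> sequentially"
    and cont: "continuous_on UNIV \<Phi>" and comp: "compact {z. \<Phi> z = w}"
  shows "connected {z. \<Phi> z = w}"
proof (rule ccontr)
  assume "\<not> connected {z. \<Phi> z = w}"
  then obtain A B where AB: "closed A" "closed B" "A \<noteq> {}" "B \<noteq> {}" "A \<union> B = {z. \<Phi> z = w}" "A \<inter> B = {}"
    using connected_closed_set[OF compact_imp_closed[OF comp]] by auto
  have "compact A" using AB comp
    by (metis closed_Int_compact inf_commute inf_sup_absorb)
  then obtain U V where UV: "open U" "compact (closure U)" "open V" "A \<subseteq> U" "B \<subseteq> V" "U \<inter> V = {}"
    using separation_normal_compact[of A B] AB by metis
  have fr: "compact (frontier U)"
    by (metis UV(2) closed_Int_compact closure_closed compact_closure frontier_closed frontier_closures inf.cobounded1 inf.orderE inf_commute)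
  have "w \<notin> \<Phi> ` frontier U"
  proof
    assume "w \<in> \<Phi> ` frontier U"
    then obtain x where x: "x \<in> frontier U" "x \<in> A \<union> B" using AB by auto
    have "x \<notin> U" using x UV(1) frontier_disjoint_eq by (auto simp: frontier_def interior_open)
    then have "x \<in> V" using x UV by auto
    moreover have "x \<in> closure U" using x by (simp add: frontier_def)
    ultimately show False using open_Int_closure_eq_empty[OF UV(3), of U] UV(6) by blast
  qed
  moreover have "closed (\<Phi> ` frontier U)"
    by (intro compact_imp_closed compact_continuous_image fr continuous_on_subset[OF cont]) auto
  ultimately obtain d where d: "d > 0" "\<And>x. x \<in> frontier U \<Longrightarrow> d \<le> dist w (\<Phi> x)"
    using separate_point_closed[of "\<Phi> ` frontier U" w] by auto
  obtain a b where ab: "a \<in> A" "b \<in> B" using AB by auto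
  have "bounded (insert a (insert b (closure U)))" using compact_imp_bounded[OF UV(2)] by simp
  then obtain R where R: "insert a (insert b (closure U)) \<subseteq> cball 0 R"
    by (meson bounded_subset_ballD ball_subset_cball order_trans)
  have "\<forall>\<^sub>F n in sequentially. \<forall>x\<in>cball 0 R. dist (\<Psi> n x) (\<Phi> x) < d / 4"
    by (rule uniform_limitD[OF lim]) (use d(1) in simp)
  then obtain n where n: "\<And>x. x \<in> cball 0 R \<Longrightarrow> dist (\<Psi> n x) (\<Phi> x) < d / 4"
    using eventually_happens'[OF sequentially_bot] by blast
  define C where "C = \<Psi>' n ` ball w (d/2)"
  have conn: "connected C"
    unfolding C_def using hom[of n]
    by (intro connected_continuous_image) (auto simp: homeomorphism_def intro: continuous_on_subset)
  have inC: "x \<in> C" if "x \<in> cball 0 R" "\<Phi> x = w" for x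
  proof -
    have "\<Psi> n x \<in> ball w (d/2)" using n[OF that(1)] that(2) d(1) by (simp add: dist_commute)
    then have "\<Psi>' n (\<Psi> n x) \<in> C" by (auto simp: C_def)
    then show ?thesis using hom[of n] by (simp add: homeomorphism_def)
  qed
  have "\<Phi> a = w" "\<Phi> b = w" using ab AB(5) by blast+
  then have "a \<in> C" "b \<in> C" using inC R by auto
  moreover have "a \<in> U" "b \<notin> U" using ab UV by auto
  ultimately obtain x where x: "x \<in> C" "x \<in> frontier U"
    using connected_Int_frontier[OF conn, of U] by blast
  then have "x \<in> closure U" by (simp add: frontier_def)
  then have "dist (\<Psi> n x) (\<Phi> x) < d / 4" using n R by auto
  moreover have "dist w (\<Psi> n x) < d / 2"
    using x(1) hom[of n] by (auto simp: C_def homeomorphism_def)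
  ultimately have "dist w (\<Phi> x) < d" using dist_triangle[of w "\<Phi> x" "\<Psi> n x"] d(1) by linarith
  then show False using d(2)[OF x(2)] by simp
qed
text \<open>
  A continuum in the circle with two points, together with its mirror image in the diameter
  through \<open>a\<close>, covers an arc around \<open>a\<close>. The product \<open>H\<close> of \<open>F - w\<close> with its reflection vanishes on that
  arc, so the product of finitely many rotations of \<open>H\<close> vanishes on the whole circle, and
  hence in the disk. This contradicts injectivity, by which each factor has at most two
  zeros there.
\<close>

lemma boundary_values_not_constant_on_continuum:
  fixes F :: "complex \<Rightarrow> complex"
  assumes cont: "continuous_on (cball 0 1) F" and hol: "F holomorphic_on ball 0 1"
    and inj: "inj_on F (ball 0 1)"
    and S: "connected S" "S \<subseteq> sphere 0 1" and F: "\<And>z. z \<in> S \<Longrightarrow> F z = w"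
    and ab: "a \<in> S" "b \<in> S"
  shows "a = b"
proof (rule ccontr)
  assume "a \<noteq> b"
  \<comment> \<open>On the unit circle \<open>\<sigma>\<close> is the reflection in the line through \<open>0\<close> and \<open>a\<close>.\<close>
  define \<sigma> where "\<sigma> = (\<lambda>z. a\<^sup>2 * cnj z)"
  define c where "c = Re (b * cnj a)"
  define H where "H = (\<lambda>z. (F z - w) * cnj (F (\<sigma> z) - w))"
  have a1: "cmod a = 1" and b1: "cmod b = 1" using ab S by auto
  have aa: "a * cnj a = 1" using a1 by (simp add: complex_norm_square[symmetric])
  have c1: "c < 1"
  proof (rule ccontr)
    assume "\<not> c < 1"
    moreover have "c \<le> cmod (b * cnj a)" unfolding c_def by (rule complex_Re_le_cmod)
    moreover have n1: "cmod (b * cnj a) = 1" using a1 b1 by (simp add: norm_mult)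
    ultimately have "Re (b * cnj a) = 1" by (simp add: c_def)
    moreover have "(Re (b * cnj a))\<^sup>2 + (Im (b * cnj a))\<^sup>2 = 1" using n1 cmod_power2[of "b * cnj a"] by simp
    ultimately have "b * cnj a = 1" by (simp add: complex_eq_iff)
    then have "b * (a * cnj a) = a" by (metis mult.assoc mult.commute mult.right_neutral)
    then show False using aa \<open>a \<noteq> b\<close> by simp
  qed
  have H0: "H z = 0" if z: "cmod z = 1" "c < Re (z * cnj a)" for z
  proof -
    have "connected ((\<lambda>x. Re (x * cnj a)) ` S)"
      by (intro connected_continuous_image continuous_intros S)
    moreover have "Re (z * cnj a) \<le> 1"
      using complex_Re_le_cmod[of "z * cnj a"] z a1 by (simp add: norm_mult)
    moreover have "c \<in> (\<lambda>x. Re (x * cnj a)) ` S"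
      using ab unfolding c_def by blast
    moreover have "1 \<in> (\<lambda>x. Re (x * cnj a)) ` S"
      by (rule image_eqI[of _ _ a, OF _ ab(1)]) (simp only: aa one_complex.sel)
    ultimately have "Re (z * cnj a) \<in> (\<lambda>x. Re (x * cnj a)) ` S"
      using connectedD_interval z(2) by (metis less_imp_le)
    then obtain x where x: "x \<in> S" "Re (x * cnj a) = Re (z * cnj a)" by auto
    have x1: "cmod x = 1" using x S by auto
    have "(Re (x * cnj a))\<^sup>2 + (Im (x * cnj a))\<^sup>2 = (Re (z * cnj a))\<^sup>2 + (Im (z * cnj a))\<^sup>2"
      unfolding cmod_power2[symmetric] using x1 z a1 by (simp add: norm_mult)
    then have "Im (x * cnj a) = Im (z * cnj a) \<or> Im (x * cnj a) = - Im (z * cnj a)"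
      using x(2) by (simp add: power2_eq_iff)
    then have "x * cnj a = z * cnj a \<or> x * cnj a = cnj (z * cnj a)"
      using x(2) by (simp add: complex_eq_iff)
    then have "x * (a * cnj a) = z * (a * cnj a) \<or> x * (a * cnj a) = a\<^sup>2 * cnj z"
      by (auto simp: power2_eq_square algebra_simps)
    then have "x = z \<or> x = \<sigma> z" unfolding aa \<sigma>_def by simp
    then show ?thesis using F[OF x(1)] by (auto simp: H_def)
  qed
  define arc where "arc = (\<lambda>\<omega>. {z. c < Re (\<omega> * z * cnj a)})"
  have "sphere 0 1 \<subseteq> (\<Union>\<omega>\<in>sphere 0 1. arc \<omega>)"
  proof
    fix z :: complex assume z: "z \<in> sphere 0 1"
    then have "z \<noteq> 0" by auto
    then have "a / z * z * cnj a = 1" using aa by simp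
    then have "z \<in> arc (a / z)" using c1 by (simp only: arc_def mem_Collect_eq one_complex.sel)
    moreover have "a / z \<in> sphere 0 1" using z a1 by (simp add: norm_divide)
    ultimately show "z \<in> (\<Union>\<omega>\<in>sphere 0 1. arc \<omega>)" by blast
  qed
  moreover have "open (arc \<omega>)" for \<omega>
    unfolding arc_def by (intro open_Collect_less continuous_intros)
  ultimately obtain \<Omega> where \<Omega>: "\<Omega> \<subseteq> sphere 0 1" "finite \<Omega>" "sphere 0 1 \<subseteq> (\<Union>\<omega>\<in>\<Omega>. arc \<omega>)"
    using compactE_image[of "sphere (0::complex) 1" "sphere 0 1" arc] by auto
  define P where "P = (\<lambda>z. \<Prod>\<omega>\<in>\<Omega>. H (\<omega> * z))"
  have rot: "cmod (\<omega> * z) = cmod z" "cmod (\<sigma> z) = cmod z" if "\<omega> \<in> \<Omega>" for \<omega> z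
    using that \<Omega>(1) a1 by (auto simp: norm_mult \<sigma>_def norm_power)
  have contH: "continuous_on (cball 0 1) H"
    unfolding H_def \<sigma>_def
    by (intro continuous_intros cont continuous_on_compose2[OF cont]) (auto simp: norm_mult norm_power a1)
  have holH: "H holomorphic_on ball 0 1"
  proof -
    have "(\<lambda>z. F (a\<^sup>2 * z)) holomorphic_on ball 0 1"
      by (rule holomorphic_on_compose_gen[OF _ hol, unfolded o_def])
        (auto intro!: holomorphic_intros simp: norm_mult norm_power a1)
    moreover have "x \<in> cnj ` ball 0 1" if "x \<in> ball 0 1" for x
      by (rule image_eqI[of _ _ "cnj x"]) (use that in auto)
    then have "cnj ` ball 0 1 = ball 0 1" by auto
    ultimately have "(cnj \<circ> (\<lambda>z. F (a\<^sup>2 * z)) \<circ> cnj) holomorphic_on ball 0 1"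
      by (intro holomorphic_on_compose_cnj_cnj) auto
    then show ?thesis unfolding H_def \<sigma>_def
      by (auto intro!: holomorphic_intros hol simp: o_def)
  qed
  have "P z = 0" if z: "z \<in> ball 0 1" for z
  proof -
    have "cmod (P z) \<le> 0"
    proof (rule maximum_modulus_frontier[of P "ball 0 1"])
      show "P holomorphic_on interior (ball 0 1)"
        unfolding P_def
        by (auto intro!: holomorphic_on_prod holomorphic_on_compose_gen[OF _ holH, unfolded o_def] holomorphic_intros simp: rot)
      show "continuous_on (closure (ball 0 1)) P"
        unfolding P_def
        by (auto intro!: continuous_on_prod continuous_on_compose2[OF contH] continuous_intros simp: rot)
      fix z :: complex assume "z \<in> frontier (ball 0 1)"
      then have z: "cmod z = 1" by simp
      then obtain \<omega> where "\<omega> \<in> \<Omega>" "c < Re (\<omega> * z * cnj a)" using \<Omega>(3) by (auto simp: arc_def)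
      then have "H (\<omega> * z) = 0" using rot z by (intro H0) auto
      then show "cmod (P z) \<le> 0" unfolding P_def using \<open>\<omega> \<in> \<Omega>\<close> \<Omega>(2) by (simp add: prod_zero_iff) blast
    qed (use z in auto)
    then show ?thesis by simp
  qed
  then have "ball 0 1 \<subseteq> (\<Union>\<omega>\<in>\<Omega>. ((\<lambda>z. F (\<omega> * z)) -` {w} \<inter> ball 0 1) \<union> ((\<lambda>z. F (\<sigma> (\<omega> * z))) -` {w} \<inter> ball 0 1))"
    unfolding P_def H_def using \<Omega>(2) by (auto simp: prod_zero_iff)
  moreover have "finite ((\<lambda>z. F (\<omega> * z)) -` {w} \<inter> ball 0 1)" "finite ((\<lambda>z. F (\<sigma> (\<omega> * z))) -` {w} \<inter> ball 0 1)"
    if "\<omega> \<in> \<Omega>" for \<omega>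
  proof -
    have \<omega>: "\<omega> \<noteq> 0" using that \<Omega>(1) by auto
    have a0: "a \<noteq> 0" using a1 by auto
    show "finite ((\<lambda>z. F (\<omega> * z)) -` {w} \<inter> ball 0 1)"
    proof (rule finite_vimage_IntI)
      show "inj_on (\<lambda>z. F (\<omega> * z)) (ball 0 1)"
      proof (rule inj_onI)
        fix x y assume xy: "x \<in> ball 0 1" "y \<in> ball 0 1" "F (\<omega> * x) = F (\<omega> * y)"
        then have "\<omega> * x = \<omega> * y" by (intro inj_onD[OF inj, OF xy(3)]) (auto simp only: mem_ball dist_0_norm rot[OF that])
        then show "x = y" using \<omega> by simp
      qed
    qed simp
    show "finite ((\<lambda>z. F (\<sigma> (\<omega> * z))) -` {w} \<inter> ball 0 1)"
    proof (rule finite_vimage_IntI)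
      show "inj_on (\<lambda>z. F (\<sigma> (\<omega> * z))) (ball 0 1)"
      proof (rule inj_onI)
        fix x y assume xy: "x \<in> ball 0 1" "y \<in> ball 0 1" "F (\<sigma> (\<omega> * x)) = F (\<sigma> (\<omega> * y))"
        then have "\<sigma> (\<omega> * x) = \<sigma> (\<omega> * y)" by (intro inj_onD[OF inj, OF xy(3)]) (auto simp only: mem_ball dist_0_norm rot[OF that])
        then show "x = y" using \<omega> a0 by (simp add: \<sigma>_def)
      qed
    qed simp
  qed
  then have "finite (\<Union>\<omega>\<in>\<Omega>. ((\<lambda>z. F (\<omega> * z)) -` {w} \<inter> ball 0 1) \<union> ((\<lambda>z. F (\<sigma> (\<omega> * z))) -` {w} \<inter> ball 0 1))"
    using \<Omega>(2) by (intro finite_UN_I finite_UnI)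
  ultimately have "finite (ball (0::complex) 1)" by (rule finite_subset)
  then have "countable (ball (0::complex) 1)" by (rule countable_finite)
  then show False using uncountable_ball[of 1 "0::complex"] by simp
qed

section \<open>Weak derivatives across the unit circle\<close>

lemma le_suminf_term:
  fixes f :: "nat \<Rightarrow> ennreal"
  shows "f n \<le> (\<Sum>n. f n)"
  using sum_le_suminf[of f "{n}"] by simp

text \<open>
  The annulus in which the distance to the circle is at most \<open>2\<^sup>-\<^sup>n\<close> has area \<open>4 \<pi> 2\<^sup>-\<^sup>n\<close>, while the
  integrand is at most \<open>2\<^sup>\<kappa>\<^sup>(\<^sup>n\<^sup>+\<^sup>1\<^sup>)\<close> outside the next annulus; the resulting geometric series
  converges because \<open>\<kappa> < 1\<close>.
\<close>

lemma integrable_dist_circle_powr: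
  fixes \<kappa> R :: real
  assumes \<kappa>: "0 \<le> \<kappa>" "\<kappa> < 1"
  shows "set_integrable lborel (cball (0::complex) R) (\<lambda>z. \<bar>1 - cmod z\<bar> powr (- \<kappa>))"
proof -
  define Ann where "Ann = (\<lambda>n. cball (0::complex) (1 + (1/2)^n) - ball 0 (1 - (1/2)^n))"
  define B where "B = (\<lambda>z::complex. indicator (cball 0 R) z + (\<Sum>n. ennreal (2 powr (\<kappa> * (n + 1))) * indicator (Ann n) z))"
  have meas: "Ann n \<in> sets lborel" for n by (simp add: Ann_def)
  have emAnn: "emeasure lborel (Ann n) = ennreal (4 * pi * (1/2)^n)" for n
  proof -
    have le: "(1/2::real)^n \<le> 1" "0 \<le> (1/2::real)^n" by (simp_all add: power_le_one)
    have "emeasure lborel (Ann n) = emeasure lborel (cball (0::complex) (1 + (1/2)^n)) - emeasure lborel (ball (0::complex) (1 - (1/2)^n))"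
      unfolding Ann_def
    proof (intro emeasure_Diff subsetI)
      fix x :: complex assume "x \<in> ball 0 (1 - (1/2)^n)"
      then show "x \<in> cball 0 (1 + (1/2)^n)" using le(2) unfolding mem_ball mem_cball by linarith
    qed (use le in \<open>auto simp: emeasure_ball\<close>)
    also have "\<dots> = ennreal (pi * (1 + (1/2)^n)\<^sup>2) - ennreal (pi * (1 - (1/2)^n)\<^sup>2)"
      using le by (simp add: emeasure_ball emeasure_cball unit_ball_vol_2)
    also have "\<dots> = ennreal (pi * (1 + (1/2)^n)\<^sup>2 - pi * (1 - (1/2)^n)\<^sup>2)"
      by (rule ennreal_minus) simp
    also have "pi * (1 + (1/2)^n)\<^sup>2 - pi * (1 - (1/2)^n)\<^sup>2 = 4 * pi * (1/2::real)^n"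
      by (simp add: power2_eq_square algebra_simps)
    finally show ?thesis .
  qed
  have bound: "ennreal (indicator (cball 0 R) z * \<bar>1 - cmod z\<bar> powr (- \<kappa>)) \<le> B z" for z :: complex
  proof (cases "z \<in> cball 0 R")
    case z: True
    define d where "d = \<bar>1 - cmod z\<bar>"
    consider "d = 0" | "d \<ge> 1" | "0 < d" "d < 1" unfolding d_def by linarith
    then show ?thesis
    proof cases
      case 1 then show ?thesis by (simp add: d_def)
    next
      case 2
      have "d powr (-\<kappa>) \<le> 1" using 2 \<kappa> by (simp add: powr_minus inverse_le_1_iff ge_one_powr_ge_zero)
      then have "ennreal (d powr (-\<kappa>)) \<le> indicator (cball 0 R) z" using z by (simp add: ennreal_le_1)
      also have "\<dots> \<le> B z" unfolding B_def by simp
      finally show ?thesis using z by (simp add: d_def)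
    next
      case 3
      have "\<exists>n. (1/2::real)^n < d" using 3 real_arch_pow_inv[of d "1/2"] by auto
      define N where "N = (LEAST n. (1/2::real)^n < d)"
      have N: "(1/2::real)^N < d" unfolding N_def using \<open>\<exists>n. _ n\<close> by (rule LeastI_ex)
      have "N \<noteq> 0" using N 3 by (metis power_0 less_asym)
      then obtain n where n: "N = Suc n" by (cases N) auto
      have "\<not> (1/2::real)^n < d" using not_less_Least[of n "\<lambda>n. (1/2::real)^n < d"] n N_def by simp
      then have zA: "z \<in> Ann n" unfolding Ann_def d_def by auto
      have "d powr (-\<kappa>) \<le> ((1/2)^N) powr (-\<kappa>)"
        using N \<kappa> by (intro powr_mono2') auto
      also have "(1/2::real)^N = 2 powr (- real N)"
        by (simp add: powr_minus powr_realpow power_one_over inverse_eq_divide)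
      also have "(2 powr (- real N)) powr (-\<kappa>) = 2 powr (\<kappa> * (n + 1))"
        unfolding powr_powr n by (simp add: algebra_simps)
      finally have "ennreal (d powr (-\<kappa>)) \<le> ennreal (2 powr (\<kappa> * (n + 1))) * indicator (Ann n) z"
        using zA by (simp add: ennreal_leI)
      also have "\<dots> \<le> (\<Sum>n. ennreal (2 powr (\<kappa> * (n + 1))) * indicator (Ann n) z)"
        by (rule le_suminf_term)
      also have "\<dots> \<le> B z" unfolding B_def by simp
      finally show ?thesis using z by (simp add: d_def)
    qed
  qed simp
  have "(\<integral>\<^sup>+z. B z \<partial>lborel) = emeasure lborel (cball (0::complex) R) + (\<Sum>n. ennreal (2 powr (\<kappa> * (n + 1))) * emeasure lborel (Ann n))"
    unfolding B_def using meas
    by (subst nn_integral_add) (auto simp: nn_integral_suminf nn_integral_cmult_indicator intro!: borel_measurable_indicator)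
  also have "\<dots> < \<infinity>"
  proof -
    have eq: "ennreal (2 powr (\<kappa> * (n + 1))) * emeasure lborel (Ann n) = ennreal ((4 * pi * 2 powr \<kappa>) * (2 powr (\<kappa> - 1))^n)" for n :: nat
    proof -
      have "2 powr (\<kappa> * (real n + 1)) * (1/2)^n = 2 powr \<kappa> * (2 powr (\<kappa> - 1))^n"
        by (simp add: powr_realpow[symmetric] powr_powr powr_add[symmetric] powr_divide field_simps)
      then show ?thesis
        unfolding emAnn by (subst ennreal_mult[symmetric]) (auto simp: algebra_simps)
    qed
    have "2 powr (\<kappa> - 1) < (1::real)" using \<kappa> by (simp add: powr_less_one)
    then have "summable (\<lambda>n. (4 * pi * 2 powr \<kappa>) * (2 powr (\<kappa> - 1))^n)"
      by (intro summable_mult summable_geometric) simp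
    then have "(\<Sum>n. ennreal ((4 * pi * 2 powr \<kappa>) * (2 powr (\<kappa> - 1))^n)) < \<infinity>"
      by (subst suminf_ennreal2) auto
    moreover have "emeasure lborel (cball (0::complex) R) < \<infinity>"
      using emeasure_lborel_cball_finite[of "0::complex" R] by simp
    ultimately show ?thesis unfolding eq by simp
  qed
  finally have fin: "(\<integral>\<^sup>+z. B z \<partial>lborel) < \<infinity>" .
  show ?thesis unfolding set_integrable_def
  proof (rule integrableI_bounded)
    show "(\<lambda>x. indicat_real (cball 0 R) x *\<^sub>R \<bar>1 - cmod x\<bar> powr - \<kappa>) \<in> borel_measurable lborel"
      by (intro borel_measurable_scaleR borel_measurable_indicator) (simp, measurable)
    have "(\<integral>\<^sup>+ x. ennreal (norm (indicat_real (cball 0 R) x *\<^sub>R \<bar>1 - cmod x\<bar> powr - \<kappa>)) \<partial>lborel) \<le> (\<integral>\<^sup>+z. B z \<partial>lborel)"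
      using bound by (intro nn_integral_mono) (simp add: abs_mult)
    also note fin
    finally show "(\<integral>\<^sup>+ x. ennreal (norm (indicat_real (cball 0 R) x *\<^sub>R \<bar>1 - cmod x\<bar> powr - \<kappa>)) \<partial>lborel) < \<infinity>" .
  qed
qed

lemma finite_line_meets_circle:
  assumes "v \<noteq> 0"
  shows "finite {s. cmod (z + of_real s * v) = 1}"
proof -
  define P where "P = [: (cmod z)\<^sup>2 - 1, 2 * Re (z * cnj v), (cmod v)\<^sup>2 :]"
  have "P \<noteq> 0" using assms by (simp add: P_def)
  then have "finite {s. poly P s = 0}" by (rule poly_roots_finite)
  moreover have "poly P s = 0" if "cmod (z + of_real s * v) = 1" for s
  proof -
    have "(cmod (z + of_real s * v))\<^sup>2 = 1" using that by simp
    then show ?thesis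
      unfolding P_def cmod_power2 by (simp add: power2_eq_square algebra_simps)
  qed
  ultimately show ?thesis by (auto intro: rev_finite_subset)
qed

lemma integrable_translate:
  fixes f :: "complex \<Rightarrow> complex"
  assumes "integrable lborel f"
  shows "integrable lborel (\<lambda>z. f (c + z))" "integral\<^sup>L lborel (\<lambda>z. f (c + z)) = integral\<^sup>L lborel f"
proof -
  have f: "f \<in> borel_measurable borel" using assms by auto
  have "integrable (distr lborel borel ((+) c)) f" using assms by (simp add: lborel_distr_plus)
  then show "integrable lborel (\<lambda>z. f (c + z))" using f by (subst (asm) integrable_distr_eq) auto
  have "integral\<^sup>L (distr lborel borel ((+) c)) f = integral\<^sup>L lborel (\<lambda>z. f (c + z))"
    using f by (subst integral_distr) auto
  then show "integral\<^sup>L lborel (\<lambda>z. f (c + z)) = integral\<^sup>L lborel f" by (simp add: lborel_distr_plus)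
qed

text \<open>
  On each line in the direction \<open>v\<close> the fundamental theorem of calculus applies, with at most two
  exceptional points. Integrating \<open>u(z+v) - u(z) = \<integral>\<^sub>0\<^sup>1 u'(z+sv) ds\<close> over \<open>z\<close>, the left-hand side gives \<open>0\<close>
  by translation invariance, and the right-hand side gives the integral of \<open>u'\<close> by Fubini.
\<close>

lemma integral_directional_derivative_eq_0:
  fixes u u' :: "complex \<Rightarrow> complex"
  assumes cont: "continuous_on UNIV u" and supp: "\<And>z. z \<notin> cball 0 R \<Longrightarrow> u z = 0" and v: "v \<noteq> 0"
    and der: "\<And>z. cmod z \<noteq> 1 \<Longrightarrow> ((\<lambda>s. u (z + of_real s * v)) has_vector_derivative u' z) (at 0)"
    and int: "integrable lborel u'"
  shows "integral\<^sup>L lborel u' = 0"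
proof -
  have u'm[measurable]: "u' \<in> borel_measurable borel" using int by auto
  define g where "g = (\<lambda>(s::real, z::complex). indicator {0..1} s *\<^sub>R u' (of_real s * v + z))"
  have gint: "integrable (lborel \<Otimes>\<^sub>M lborel) g"
  proof (rule lborel_pair.Fubini_integrable)
    have [measurable]: "(\<lambda>p::real \<times> complex. of_real (fst p) * v + snd p) \<in> borel \<Otimes>\<^sub>M borel \<rightarrow>\<^sub>M borel"
      unfolding borel_prod by (intro borel_measurable_continuous_onI continuous_intros)
    have "g = (\<lambda>p. indicator {0..1} (fst p) *\<^sub>R u' (of_real (fst p) * v + snd p))"
      by (auto simp: g_def)
    also have "\<dots> \<in> borel_measurable (borel \<Otimes>\<^sub>M borel)" by measurable
    finally show "g \<in> borel_measurable (lborel \<Otimes>\<^sub>M lborel)" by simp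
    have "(\<integral>y. norm (g (s, y)) \<partial>lborel) = indicator {0..1} s * (\<integral>z. norm (u' z) \<partial>lborel)" for s
    proof -
      have "(\<integral>y. complex_of_real (norm (u' (of_real s * v + y))) \<partial>lborel) = (\<integral>z. complex_of_real (norm (u' z)) \<partial>lborel)"
        using int by (intro integrable_translate(2)) (auto simp: complex_of_real_integrable_eq)
      then have "(\<integral>y. norm (u' (of_real s * v + y)) \<partial>lborel) = (\<integral>z. norm (u' z) \<partial>lborel)"
        by simp
      then show ?thesis by (simp add: g_def)
    qed
    then show "integrable lborel (\<lambda>s. \<integral>y. norm (g (s, y)) \<partial>lborel)"
      by simp
    show "AE s in lborel. integrable lborel (\<lambda>z. g (s, z))"
      using integrable_translate(1)[OF int] by (intro AE_I2) (simp add: g_def)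
  qed
  have "(\<integral>z. (\<integral>s. g (s, z) \<partial>lborel) \<partial>lborel) = (\<integral>s. (\<integral>z. g (s, z) \<partial>lborel) \<partial>lborel)"
    using lborel_pair.Fubini_integral[of "\<lambda>s z. g (s, z)"] gint by simp
  also have "\<dots> = (\<integral>s. indicator {0..1} (s::real) *\<^sub>R integral\<^sup>L lborel u' \<partial>lborel)"
    by (simp only: integrable_translate(2)[OF int] g_def prod.case integral_scaleR_right)
  also have "\<dots> = integral\<^sup>L lborel u'" by (subst integral_scaleR_left) auto
  finally have 1: "(\<integral>z. (\<integral>s. g (s, z) \<partial>lborel) \<partial>lborel) = integral\<^sup>L lborel u'" .
  have hasint: "((\<lambda>s. u' (of_real s * v + z)) has_integral (u (v + z) - u z)) {0..1}" for z
  proof -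
    have "((\<lambda>s. u' (of_real s * v + z)) has_integral (u (of_real 1 * v + z) - u (of_real 0 * v + z))) {0..1}"
    proof (rule fundamental_theorem_of_calculus_interior_strong[OF finite_line_meets_circle[OF v, of z]])
      fix s :: real assume "s \<in> {0<..<1} - {s. cmod (z + complex_of_real s * v) = 1}"
      then have "((\<lambda>x. u ((z + of_real s * v) + of_real x * v)) has_vector_derivative u' (z + of_real s * v)) (at (s - s))"
        using der[of "z + of_real s * v"] by simp
      moreover have "((\<lambda>x. x - s) has_real_derivative 1) (at s)" by (auto intro!: derivative_eq_intros)
      ultimately have "((\<lambda>x. u ((z + of_real s * v) + of_real x * v)) \<circ> (\<lambda>x. x - s) has_vector_derivative 1 *\<^sub>R u' (z + of_real s * v)) (at s)"
        by (intro vector_diff_chain_at) (auto simp: has_real_derivative_iff_has_vector_derivative)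
      then show "((\<lambda>x. u (of_real x * v + z)) has_vector_derivative u' (of_real s * v + z)) (at s)"
        by (simp add: o_def algebra_simps)
    next
      show "continuous_on {0..1} (\<lambda>x. u (complex_of_real x * v + z))"
        by (intro continuous_on_compose2[OF cont] continuous_intros) auto
    qed simp
    then show ?thesis by simp
  qed
  have "AE z in lborel. integrable lborel (\<lambda>s. g (s, z))"
    using lborel_pair.AE_integrable_snd[of "\<lambda>s z. g (s, z)"] gint by simp
  then have "AE z in lborel. (\<integral>s. g (s, z) \<partial>lborel) = u (v + z) - u z"
  proof eventually_elim
    case (elim z)
    then have "set_integrable lborel {0..1} (\<lambda>s. u' (of_real s * v + z))"
      by (simp add: set_integrable_def g_def)
    then show ?case
      using set_borel_integral_eq_integral(2)[OF \<open>set_integrable lborel {0..1} (\<lambda>s. u' (of_real s * v + z))\<close>]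
        integral_unique[OF hasint[of z]]
      by (simp add: set_lebesgue_integral_def g_def)
  qed
  then have 2: "(\<integral>z. (\<integral>s. g (s, z) \<partial>lborel) \<partial>lborel) = (\<integral>z. u (v + z) - u z \<partial>lborel)"
    using lborel_pair.integrable_snd[of "\<lambda>s z. g (s, z)"] gint cont
    by (intro integral_cong_AE)
      (auto intro!: borel_measurable_continuous_onI continuous_intros continuous_on_compose2[OF cont])
  have "integrable lborel u"
  proof -
    have "set_integrable lborel (cball 0 R) u"
      unfolding set_integrable_def
      by (intro borel_integrable_compact continuous_on_subset[OF cont]) auto
    moreover have "(\<lambda>z. indicator (cball 0 R) z *\<^sub>R u z) = u" using supp by (auto simp: indicator_def)
    ultimately show ?thesis by (simp add: set_integrable_def)
  qed
  from integrable_translate[OF this, of v] this have "(\<integral>z. u (v + z) - u z \<partial>lborel) = 0" by simp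
  with 1 2 show ?thesis by simp
qed

lemma integrable_mult_bounded_support:
  fixes w \<psi> :: "complex \<Rightarrow> complex"
  assumes w: "set_integrable lborel (cball 0 R) w"
    and \<psi>: "continuous_on UNIV \<psi>" "\<And>z. z \<notin> cball 0 R \<Longrightarrow> \<psi> z = 0"
  shows "integrable lborel (\<lambda>z. w z * \<psi> z)"
proof -
  obtain M where "\<forall>z\<in>cball 0 R. cmod (\<psi> z) \<le> M"
    using compact_imp_bounded[OF compact_continuous_image[OF continuous_on_subset[OF \<psi>(1)], of "cball 0 R"]]
    by (auto simp: bounded_iff)
  then have M: "\<And>z. z \<in> cball 0 R \<Longrightarrow> cmod (\<psi> z) \<le> M" by blast
  have M': "cmod (\<psi> z) \<le> max M 0" for z using M[of z] \<psi>(2)[of z] by (cases "z \<in> cball 0 R") auto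
  have [measurable]: "\<psi> \<in> borel_measurable borel" by (intro borel_measurable_continuous_onI \<psi>)
  have eq: "(\<lambda>z. w z * \<psi> z) = (\<lambda>z. (indicator (cball 0 R) z *\<^sub>R w z) * \<psi> z)"
    using \<psi>(2) by (force simp: indicator_def)
  have w': "integrable lborel (\<lambda>z. indicator (cball 0 R) z *\<^sub>R w z)"
    using w by (simp add: set_integrable_def)
  then have [measurable]: "(\<lambda>z. indicator (cball 0 R) z *\<^sub>R w z) \<in> borel_measurable borel" by auto
  show ?thesis unfolding eq
  proof (rule Bochner_Integration.integrable_bound)
    show "integrable lborel (\<lambda>z. max M 0 * norm (indicator (cball 0 R) z *\<^sub>R w z))"
      using w' by (intro integrable_mult_right integrable_norm)
    show "(\<lambda>z. (indicator (cball 0 R) z *\<^sub>R w z) * \<psi> z) \<in> borel_measurable lborel" by measurable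
    show "AE z in lborel. norm ((indicator (cball 0 R) z *\<^sub>R w z) * \<psi> z)
      \<le> norm (max M 0 * norm (indicator (cball 0 R) z *\<^sub>R w z))"
      using M' by (intro AE_I2) (auto simp: norm_mult mult.commute indicator_def intro!: mult_right_mono)
  qed
qed

lemma set_integrable_off_circle:
  fixes w :: "complex \<Rightarrow> complex"
  assumes cont: "continuous_on (- sphere 0 1) w" and zero: "\<And>z. cmod z = 1 \<Longrightarrow> w z = 0"
    and \<kappa>: "0 \<le> \<kappa>" "\<kappa> < 1"
    and bound: "\<And>z. cmod z \<le> R \<Longrightarrow> cmod z \<noteq> 1 \<Longrightarrow> cmod (w z) \<le> C * \<bar>1 - cmod z\<bar> powr (- \<kappa>)"
  shows "set_integrable lborel (cball 0 R) w"
proof -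
  have "(\<lambda>z. indicator (- sphere 0 1) z *\<^sub>R w z) \<in> borel_measurable borel"
    by (intro borel_measurable_continuous_on_indicator cont) auto
  moreover have "(\<lambda>z. indicator (- sphere 0 1) z *\<^sub>R w z) = w"
    using zero by (auto simp: indicator_def)
  ultimately have [measurable]: "w \<in> borel_measurable borel" by simp
  have i: "integrable lborel (\<lambda>z. indicator (cball (0::complex) R) z *\<^sub>R \<bar>1 - cmod z\<bar> powr (- \<kappa>))"
    using integrable_dist_circle_powr[OF \<kappa>] by (simp add: set_integrable_def)
  show ?thesis unfolding set_integrable_def
  proof (rule Bochner_Integration.integrable_bound)
    show "integrable lborel (\<lambda>z. C * (indicator (cball (0::complex) R) z *\<^sub>R \<bar>1 - cmod z\<bar> powr (- \<kappa>)))"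
      using i by (rule integrable_mult_right)
    show "(\<lambda>z. indicator (cball 0 R) z *\<^sub>R w z) \<in> borel_measurable lborel"
      by (intro borel_measurable_scaleR borel_measurable_indicator) auto
    show "AE z in lborel. norm (indicator (cball 0 R) z *\<^sub>R w z)
      \<le> norm (C * (indicator (cball 0 R) z *\<^sub>R \<bar>1 - cmod z\<bar> powr (- \<kappa>)))"
      using bound zero by (intro AE_I2) (force simp: indicator_def intro: order_trans[OF _ abs_ge_self])
  qed
qed

text \<open>
  Classical derivatives off the circle are weak derivatives across it, provided that the map is
  continuous and the derivatives grow slower than the inverse distance to the circle: the product
  with a test function has directional derivatives with integral zero, in the directions \<open>1\<close>
  and \<open>\<i>\<close>.
\<close>

lemma weak_derivatives_off_circle:
  fixes \<Phi> p q :: "complex \<Rightarrow> complex"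
  assumes cont: "continuous_on UNIV \<Phi>"
    and der: "\<And>z. cmod z \<noteq> 1 \<Longrightarrow> (\<Phi> has_derivative (\<lambda>v. p z * v + q z * cnj v)) (at z)"
    and cp: "continuous_on (- sphere 0 1) p" and cq: "continuous_on (- sphere 0 1) q"
    and zp: "\<And>z. cmod z = 1 \<Longrightarrow> p z = 0" and zq: "\<And>z. cmod z = 1 \<Longrightarrow> q z = 0"
    and \<kappa>: "0 \<le> \<kappa>" "\<kappa> < 1"
    and bp: "\<And>R. \<exists>C. \<forall>z. cmod z \<le> R \<and> cmod z \<noteq> 1 \<longrightarrow> cmod (p z) \<le> C * \<bar>1 - cmod z\<bar> powr (- \<kappa>)"
    and bq: "\<And>R. \<exists>C. \<forall>z. cmod z \<le> R \<and> cmod z \<noteq> 1 \<longrightarrow> cmod (q z) \<le> C * \<bar>1 - cmod z\<bar> powr (- \<kappa>)"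
  shows "weak_d_z UNIV \<Phi> p" "weak_d_zbar UNIV \<Phi> q"
proof -
  have ip: "set_integrable lborel (cball 0 R) p" for R
    using bp[of R] set_integrable_off_circle[OF cp zp \<kappa>, of R] by blast
  have iq: "set_integrable lborel (cball 0 R) q" for R
    using bq[of R] set_integrable_off_circle[OF cq zq \<kappa>, of R] by blast
  have loc: "locally_integrable_on w UNIV" if w: "\<And>R. set_integrable lborel (cball 0 R) w" for w
    unfolding locally_integrable_on_def
  proof (intro allI impI)
    fix K :: "complex set" assume K: "compact K \<and> K \<subseteq> UNIV"
    obtain R where "K \<subseteq> cball 0 R"
      using K compact_imp_bounded by (meson bounded_subset_ballD ball_subset_cball order_trans)
    then have "set_integrable lborel K w"
      using K by (intro set_integrable_subset[OF w[of R]]) (auto intro: borel_closed compact_imp_closed)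
    then show "w absolutely_integrable_on K"
      by (auto simp: set_integrable_def integrable_completion)
  qed
  have main: "(LINT z:UNIV|lebesgue. \<Phi> z * d_z \<psi> z) = - (LINT z:UNIV|lebesgue. p z * \<psi> z) \<and>
      (LINT z:UNIV|lebesgue. \<Phi> z * d_zbar \<psi> z) = - (LINT z:UNIV|lebesgue. q z * \<psi> z)"
    if \<psi>: "test_function UNIV \<psi>" for \<psi>
  proof -
    define D where "D = (\<lambda>v z. frechet_derivative \<psi> (at z) v)"
    have "Ck 1 \<psi>" using \<psi> unfolding test_function_def by blast
    then have diff: "\<psi> differentiable (at z)" and contD: "continuous_on UNIV (D v)" for z v
      unfolding D_def by (auto simp: One_nat_def)
    have d\<psi>: "(\<psi> has_derivative (\<lambda>v. D v z)) (at z)" for z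
      unfolding D_def using diff[of z] by (simp add: frechet_derivative_works[symmetric])
    have c\<psi>: "continuous_on UNIV \<psi>"
      using diff by (simp add: continuous_on_eq_continuous_at differentiable_imp_continuous_within)
    have "compact (closure {z. \<psi> z \<noteq> 0})" using \<psi> by (simp add: test_function_def)
    then obtain R where R: "closure {z. \<psi> z \<noteq> 0} \<subseteq> cball 0 R"
      by (meson bounded_subset_ballD ball_subset_cball order_trans compact_imp_bounded)
    have s\<psi>: "\<psi> z = 0" if "z \<notin> cball 0 R" for z
      using that R closure_subset[of "{z. \<psi> z \<noteq> 0}"] by blast
    have sD: "D v z = 0" if "z \<notin> cball 0 R" for z v
    proof -
      have "(\<psi> has_derivative (\<lambda>v. 0)) (at z)"
        by (rule has_derivative_transform_within_open[of "\<lambda>_. 0" _ _ _ "- cball 0 R"])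
          (use s\<psi> that in auto)
      then have "frechet_derivative \<psi> (at z) = (\<lambda>v. 0)" by (rule frechet_derivative_at[symmetric])
      then show ?thesis by (simp add: D_def)
    qed
    have i1: "integrable lborel (\<lambda>z. p z * \<psi> z)" "integrable lborel (\<lambda>z. q z * \<psi> z)"
      by (rule integrable_mult_bounded_support[OF ip c\<psi> s\<psi>], assumption)
        (rule integrable_mult_bounded_support[OF iq c\<psi> s\<psi>], assumption)
    have i\<Phi>: "set_integrable lborel (cball 0 R) \<Phi>"
      unfolding set_integrable_def
      by (intro borel_integrable_compact continuous_on_subset[OF cont]) auto
    have i2: "integrable lborel (\<lambda>z. \<Phi> z * D v z)" for v
      by (rule integrable_mult_bounded_support[OF i\<Phi> contD sD])
    have parts: "integral\<^sup>L lborel (\<lambda>z. \<Phi> z * D v z) = - (v * integral\<^sup>L lborel (\<lambda>z. p z * \<psi> z) + cnj v * integral\<^sup>L lborel (\<lambda>z. q z * \<psi> z))"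
      if v: "v \<noteq> 0" for v
    proof -
      define u' where "u' = (\<lambda>z. v * (p z * \<psi> z) + cnj v * (q z * \<psi> z) + \<Phi> z * D v z)"
      have iu': "integrable lborel u'"
        unfolding u'_def by (intro Bochner_Integration.integrable_add integrable_mult_right i1 i2)
      have "integral\<^sup>L lborel u' = 0"
      proof (rule integral_directional_derivative_eq_0[OF _ _ v _ iu'])
        show "continuous_on UNIV (\<lambda>z. \<Phi> z * \<psi> z)" by (intro continuous_intros cont c\<psi>)
        show "\<Phi> z * \<psi> z = 0" if "z \<notin> cball 0 R" for z using s\<psi>[OF that] by simp
        fix z :: complex assume z: "cmod z \<noteq> 1"
        have 1: "((\<lambda>s. z + of_real s * v) has_derivative (\<lambda>s. of_real s * v)) (at (0::real))"
          by (auto intro!: derivative_eq_intros)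
        have "((\<lambda>z. \<Phi> z * \<psi> z) has_derivative (\<lambda>v. \<Phi> z * D v z + (p z * v + q z * cnj v) * \<psi> z)) (at (z + of_real 0 * v))"
          using has_derivative_mult[OF der[OF z] d\<psi>[of z]] by simp
        from has_derivative_compose[OF 1 this]
        have *: "((\<lambda>s. \<Phi> (z + of_real s * v) * \<psi> (z + of_real s * v)) has_derivative
          (\<lambda>s. \<Phi> z * D (of_real s * v) z + (p z * (of_real s * v) + q z * cnj (of_real s * v)) * \<psi> z)) (at 0)" .
        have lin: "D (of_real s * v) z = of_real s * D v z" for s
          using linear_scale[OF has_derivative_linear[OF d\<psi>[of z]], of s v] by (simp add: scaleR_conv_of_real)
        have "(\<lambda>s. \<Phi> z * D (of_real s * v) z + (p z * (of_real s * v) + q z * cnj (of_real s * v)) * \<psi> z) = (\<lambda>s. s *\<^sub>R u' z)"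
          unfolding lin u'_def by (auto simp: scaleR_conv_of_real algebra_simps)
        with * show "((\<lambda>s. \<Phi> (z + of_real s * v) * \<psi> (z + of_real s * v)) has_vector_derivative u' z) (at 0)"
          unfolding has_vector_derivative_def by simp
      qed
      moreover have "integral\<^sup>L lborel u' = v * integral\<^sup>L lborel (\<lambda>z. p z * \<psi> z) + cnj v * integral\<^sup>L lborel (\<lambda>z. q z * \<psi> z)
          + integral\<^sup>L lborel (\<lambda>z. \<Phi> z * D v z)"
        unfolding u'_def using i1 i2[of v] by (simp add: Bochner_Integration.integral_add)
      ultimately show ?thesis by (metis add.commute eq_neg_iff_add_eq_0)
    qed
    have leb: "(LINT z:UNIV|lebesgue. w z) = integral\<^sup>L lborel w" if "integrable lborel w" for w :: "complex \<Rightarrow> complex"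
      using that by (simp add: set_lebesgue_integral_def integral_completion)
    have dz: "(\<lambda>z. \<Phi> z * d_z \<psi> z) = (\<lambda>z. (\<Phi> z * D 1 z - \<i> * (\<Phi> z * D \<i> z)) / 2)"
      "(\<lambda>z. \<Phi> z * d_zbar \<psi> z) = (\<lambda>z. (\<Phi> z * D 1 z + \<i> * (\<Phi> z * D \<i> z)) / 2)"
      by (auto simp: d_z_def d_zbar_def D_def algebra_simps)
    have "integral\<^sup>L lborel (\<lambda>z. \<Phi> z * d_z \<psi> z) = - integral\<^sup>L lborel (\<lambda>z. p z * \<psi> z)"
      "integral\<^sup>L lborel (\<lambda>z. \<Phi> z * d_zbar \<psi> z) = - integral\<^sup>L lborel (\<lambda>z. q z * \<psi> z)"
      unfolding dz using i2 parts[of 1] parts[of \<i>]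
      by (simp_all add: Bochner_Integration.integral_diff Bochner_Integration.integral_add) (simp_all add: algebra_simps)
    moreover have "integrable lborel (\<lambda>z. \<Phi> z * d_z \<psi> z)" "integrable lborel (\<lambda>z. \<Phi> z * d_zbar \<psi> z)"
      unfolding dz using i2 by (auto intro!: integrable_divide)
    ultimately show ?thesis using i1 by (simp add: leb)
  qed
  show "weak_d_z UNIV \<Phi> p" "weak_d_zbar UNIV \<Phi> q"
    unfolding weak_d_z_def weak_d_zbar_def using loc[OF ip] loc[OF iq] main by auto
qed

section \<open>The Loewner chain: transition inequality and zeros\<close>

text \<open>
  What remains of the problem once the integral operator is evaluated. By \<open>ode\<close>, \<open>z\<^sup>\<gamma> h2(z)\<close> is a
  primitive of \<open>\<gamma> z\<^sup>\<gamma>\<^sup>-\<^sup>1 h(z)\<close>. The assumption \<open>mk\<close> is the hypothesis of the theorem at the origin and \<open>cond\<close> is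
  the hypothesis elsewhere. The assumption \<open>growth\<close> makes \<open>N\<close> below close to \<open>1\<close> on \<open>|z| \<le> r exp(-t)\<close>,
  uniformly in \<open>t\<close>, when \<open>r\<close> is small; for \<open>Re \<gamma> < 0\<close> it restricts the Taylor coefficients of \<open>h2 - h\<close>.
\<close>

locale loewner_data =
  fixes h h2 :: "complex \<Rightarrow> complex" and \<gamma> :: complex and m k Cg :: real
  assumes m: "0 < m" and \<gamma>: "\<gamma> \<noteq> 0" and k0: "0 \<le> k" and k1: "k < 1"
    and hol_h: "h holomorphic_on ball 0 1" and h_nz: "\<And>z. cmod z < 1 \<Longrightarrow> h z \<noteq> 0" and h_0: "h 0 = 1"
    and hol_h2: "h2 holomorphic_on ball 0 1" and h2_0: "h2 0 = 1"
    and ode: "\<And>z. cmod z < 1 \<Longrightarrow> z * deriv h2 z = \<gamma> * (h z - h2 z)"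
    and mk: "\<bar>m - 1\<bar> \<le> k * (m + 1)"
    and cond: "\<And>z. cmod z < 1 \<Longrightarrow> z \<noteq> 0 \<Longrightarrow>
      cmod ((1 - exp (of_real ((m + 1) * ln (cmod z)) * \<gamma>)) / \<gamma> * (z * deriv h z / h z) - of_real ((m - 1) / 2))
        \<le> k * ((m + 1) / 2)"
    and growth: "\<And>z t. 0 \<le> t \<Longrightarrow> cmod z \<le> exp (- t) / 2 \<Longrightarrow>
      cmod ((h2 z - h z) * exp (- (of_real ((m + 1) * t) * \<gamma>))) \<le> Cg * (cmod z * exp t)"
begin

definition m1 :: real where "m1 = m + 1"
definition e :: "real \<Rightarrow> complex" where "e t = exp (- (of_real (m1 * t) * \<gamma>))"
definition A :: "complex \<Rightarrow> real \<Rightarrow> complex" where "A z t = (1 - e t) * (z * deriv h z / h z) / \<gamma>"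
definition W :: "complex \<Rightarrow> real \<Rightarrow> complex" where "W z t = (1 + A z t) / of_real m1"
definition N :: "complex \<Rightarrow> real \<Rightarrow> complex" where "N z t = h z + (h2 z - h z) * e t"
definition Dom :: "(complex \<times> real) set" where
  "Dom = {p. 0 \<le> snd p \<and> cmod (fst p) \<le> exp (- snd p) \<and> cmod (fst p) < 1}"
text \<open>
  In the coordinate \<open>y = log z\<close>, level points move to the left with speed at least \<open>2/(1+k)\<close>; \<open>c0\<close> lies
  halfway between this and the speed \<open>1\<close> of the boundary \<open>Re y = -t\<close>. The absolute speed is at most \<open>2/(1-k) < C0\<close>.
  The set \<open>Reg b s\<close> is a left half-plane \<open>Re y \<le> b\<close> at time \<open>s\<close> that recedes with speed \<open>c0\<close>.
\<close>

definition c0 :: real where "c0 = (1 + 2 / (1 + k)) / 2"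
definition C0 :: real where "C0 = 2 / (1 - k) + 1"
definition Reg :: "real \<Rightarrow> real \<Rightarrow> (complex \<times> real) set" where
  "Reg b s = {p. s \<le> snd p \<and> Re (fst p) \<le> b - c0 * (snd p - s)}"

lemma m1: "1 < m1" "complex_of_real m1 \<noteq> 0" "m = m1 - 1"
proof -
  show "1 < m1" "m = m1 - 1" using m by (auto simp: m1_def)
  then show "complex_of_real m1 \<noteq> 0" using m by simp
qed

lemma m1_nz [simp]: "m1 \<noteq> 0" using m1 by simp

lemma c0_gt_1: "1 < c0"
  using k0 k1 by (simp add: c0_def field_simps)

lemma C0_pos: "0 < C0" using k1 by (simp add: C0_def add_pos_pos)

lemma e_0 [simp]: "e 0 = 1" by (simp add: e_def)

lemma e_deriv: "(e has_vector_derivative (- (of_real m1 * \<gamma>) * e t)) (at t within S)"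
proof -
  have "((\<lambda>z. exp (- (of_real m1 * z * \<gamma>))) has_field_derivative (- (of_real m1 * \<gamma>) * e t)) (at (of_real t))"
    by (auto intro!: derivative_eq_intros simp: e_def mult_ac)
  then have "((\<lambda>t. exp (- (of_real m1 * of_real t * \<gamma>))) has_vector_derivative (- (of_real m1 * \<gamma>) * e t)) (at t within S)"
    by (rule has_vector_derivative_real_field)
  then show ?thesis unfolding e_def[abs_def] by simp
qed

lemma hol_A: "(\<lambda>z. A z t) holomorphic_on ball 0 1"
  unfolding A_def using h_nz
  by (intro holomorphic_intros hol_h) (auto simp: \<gamma>)

text \<open>
  On the circle \<open>|z| = exp(-t)\<close>, \<open>(m+1) \<gamma> ln|z| = -(m+1) \<gamma> t\<close> and the bound is the hypothesis. For fixed
  \<open>t\<close> the function \<open>A\<close> is holomorphic, which gives the bound inside the circle.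
\<close>

lemma A_bound:
  assumes "0 \<le> t" "cmod z \<le> exp (- t)" "cmod z < 1"
  shows "cmod (A z t - of_real ((m - 1) / 2)) \<le> k * (m1 / 2)"
proof (cases "t = 0")
  case True
  have "cmod (- of_real ((m - 1) / 2) :: complex) = \<bar>m - 1\<bar> / 2"
    unfolding norm_minus_cancel norm_of_real by simp
  then show ?thesis using True mk by (simp add: A_def m1_def)
next
  case False
  then have t: "0 < t" using assms by simp
  then have e1: "exp (- t) < 1" by simp
  show ?thesis
  proof (rule maximum_modulus_frontier[of "\<lambda>z. A z t - of_real ((m - 1) / 2)" "cball 0 (exp (-t))"])
    have sub: "cball 0 (exp (-t)) \<subseteq> ball (0::complex) 1" using e1 by (auto simp del: exp_less_one_iff intro: le_less_trans)
    have "(\<lambda>z. A z t - of_real ((m - 1) / 2)) holomorphic_on cball 0 (exp (-t))"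
      by (intro holomorphic_intros holomorphic_on_subset[OF hol_A sub])
    then show "(\<lambda>z. A z t - of_real ((m - 1) / 2)) holomorphic_on interior (cball 0 (exp (-t)))"
      "continuous_on (closure (cball 0 (exp (-t)))) (\<lambda>z. A z t - of_real ((m - 1) / 2))"
      using holomorphic_on_subset interior_subset holomorphic_on_imp_continuous_on by auto
    fix z assume "z \<in> frontier (cball (0::complex) (exp (-t)))"
    then have z: "cmod z = exp (- t)" by simp
    then have "z \<noteq> 0" "ln (cmod z) = - t" by auto
    with cond[of z] z e1 show "cmod (A z t - of_real ((m - 1) / 2)) \<le> k * (m1 / 2)"
      by (simp add: A_def e_def m1_def mult.commute)
  qed (use assms in auto)
qed

lemma W_bound:
  assumes "0 \<le> t" "cmod z \<le> exp (- t)" "cmod z < 1"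
  shows "cmod (W z t - 1 / 2) \<le> k / 2"
proof -
  have eq: "W z t - 1 / 2 = (A z t - of_real ((m - 1) / 2)) / of_real m1"
  proof -
    have "A z t - of_real ((m - 1) / 2) = (1 + A z t) - of_real m1 / 2" by (simp add: m1_def field_simps)
    then show ?thesis unfolding W_def by (simp only:) (simp add: diff_divide_distrib)
  qed
  have "cmod (W z t - 1 / 2) = cmod (A z t - of_real ((m - 1) / 2)) / m1"
    unfolding eq norm_divide[of _ "of_real m1"] norm_of_real using m1(1) by simp
  also have "\<dots> \<le> k / 2" using A_bound[OF assms] m1 by (simp add: field_simps)
  finally show ?thesis .
qed

text \<open>
  Inversion maps the disk \<open>|w - 1/2| \<le> k/2\<close> to the disk with diameter from \<open>2/(1+k)\<close> to \<open>2/(1-k)\<close>.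
\<close>

lemma disk_half:
  assumes "cmod (w - 1 / 2) \<le> k / 2"
  shows "(1 - k) / 2 \<le> cmod w" "w \<noteq> 0" "2 / (1 + k) \<le> Re (1 / w)" "cmod (1 / w) \<le> 2 / (1 - k)" "cmod w \<le> 1"
proof -
  have "cmod (1 / 2 :: complex) \<le> cmod w + cmod (w - 1 / 2)"
    by (metis norm_minus_commute norm_triangle_sub add.commute)
  then show 1: "(1 - k) / 2 \<le> cmod w" using assms by (simp add: field_simps)
  then show w: "w \<noteq> 0" using k1 by auto
  show "cmod (1 / w) \<le> 2 / (1 - k)" using 1 w k1 by (simp add: norm_divide field_simps)
  show "cmod w \<le> 1" using norm_triangle_sub[of w "1/2"] assms k1 by simp
  have "(cmod (w - 1 / 2))\<^sup>2 \<le> (k / 2)\<^sup>2" using assms by (intro power_mono) auto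
  then have 2: "(Re w)\<^sup>2 + (Im w)\<^sup>2 \<le> Re w - (1 - k\<^sup>2) / 4"
    unfolding cmod_power2 by (simp add: power2_eq_square field_simps)
  have 3: "Re w \<le> (1 + k) / 2"
    using assms complex_Re_le_cmod[of "w - 1/2"] by simp
  have "2 * ((Re w)\<^sup>2 + (Im w)\<^sup>2) \<le> 2 * (Re w - (1 - k\<^sup>2) / 4)"
    using mult_left_mono[OF 2, of 2] by (simp only: zero_le_numeral)
  also have "\<dots> = (1 + k) * Re w + (1 - k) * (Re w - (1 + k) / 2)" by (simp add: power2_eq_square field_simps)
  also have "\<dots> \<le> (1 + k) * Re w" using 3 k1 mult_nonneg_nonpos[of "1 - k" "Re w - (1 + k) / 2"] by simp
  finally have 4: "2 * (cmod w)\<^sup>2 \<le> (1 + k) * Re w" by (simp add: cmod_power2)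
  have "2 / (1 + k) \<le> Re w / (cmod w)\<^sup>2" using 4 w k0 by (simp add: field_simps)
  also have "\<dots> = Re (1 / w)" by (simp add: Re_divide cmod_power2)
  finally show "2 / (1 + k) \<le> Re (1 / w)" .
qed

lemma closed_Reg: "closed (Reg b s)"
  unfolding Reg_def by (intro closed_Collect_conj closed_Collect_le continuous_intros)

lemma Reg_Dom:
  assumes "p \<in> Reg b s" "0 \<le> s" "b \<le> - s" "b < 0"
  shows "0 \<le> snd p" "Re (fst p) < 0" "Re (fst p) \<le> - snd p" "(exp (fst p), snd p) \<in> Dom"
proof -
  have *: "s \<le> snd p" "Re (fst p) \<le> b - c0 * (snd p - s)" using assms by (auto simp: Reg_def)
  have "1 * (snd p - s) \<le> c0 * (snd p - s)" using * c0_gt_1 by (intro mult_right_mono) auto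
  then have "Re (fst p) \<le> b - (snd p - s)" using * by (simp add: algebra_simps)
  then show "0 \<le> snd p" "Re (fst p) < 0" "Re (fst p) \<le> - snd p" using * assms by linarith+
  then show "(exp (fst p), snd p) \<in> Dom" by (simp add: Dom_def)
qed

text \<open>
  Level points move at least as fast to the left as the boundary of \<open>Reg\<close>, so they stay in it.
\<close>

lemma level_step:
  assumes der: "(Q has_derivative (\<lambda>d. a * (w * fst d + of_real (snd d)))) (at (y0, t0) within Reg b s)"
    and a: "a \<noteq> 0" and w: "cmod (w - 1 / 2) \<le> k / 2" and Q0: "Q (y0, t0) = 0"
    and mem: "(y0, t0) \<in> Reg b s" and cont: "continuous_on (Reg b s) Q"
  shows "\<exists>\<eta>>0. \<forall>\<epsilon>. 0 < \<epsilon> \<and> \<epsilon> < \<eta> \<longrightarrow>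
    (\<exists>y. (y, t0 + \<epsilon>) \<in> Reg b s \<and> Q (y, t0 + \<epsilon>) = 0 \<and> dist y y0 \<le> C0 * \<epsilon>)"
proof -
  \<comment> \<open>The tolerance that reduces the speed \<open>2/(1+k)\<close> to \<open>c0\<close>.\<close>
  define \<delta> where "\<delta> = (2 / (1 + k) - 1) / 2"
  have "(1 + x) / 2 + (x - 1) / 2 = x" for x :: real by (simp add: field_simps)
  then have \<delta>: "0 < \<delta>" "\<delta> \<le> 1" "c0 + \<delta> = 2 / (1 + k)"
    using k0 k1 by (auto simp: \<delta>_def c0_def) (auto simp: field_simps)
  note wf = disk_half[OF w]
  have near: "(y, t0 + \<epsilon>) \<in> Reg b s \<and> dist y y0 \<le> C0 * \<epsilon>"
    if "0 < \<epsilon>" "cmod (y - (y0 - of_real \<epsilon> / w)) \<le> \<delta> * \<epsilon>" for \<epsilon> y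
  proof -
    have "Re (y - (y0 - of_real \<epsilon> / w)) \<le> \<delta> * \<epsilon>"
      using that(2) complex_Re_le_cmod order_trans by blast
    moreover have "Re (of_real \<epsilon> / w) = \<epsilon> * Re (1 / w)"
      by (simp add: Re_divide)
    ultimately have "Re y \<le> Re y0 - \<epsilon> * Re (1 / w) + \<delta> * \<epsilon>" by simp
    also have "\<epsilon> * (2 / (1 + k)) \<le> \<epsilon> * Re (1 / w)" using that wf by (intro mult_left_mono) auto
    then have "Re y0 - \<epsilon> * Re (1 / w) + \<delta> * \<epsilon> \<le> Re y0 - c0 * \<epsilon>" 
      unfolding \<delta>(3)[symmetric] by (simp add: algebra_simps)
    finally have 1: "Re y \<le> Re y0 - c0 * \<epsilon>" .
    have "cmod (y - y0) \<le> cmod (y - (y0 - of_real \<epsilon> / w)) + cmod (of_real \<epsilon> * (1 / w))"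
      using norm_triangle_ineq4[of "y - (y0 - of_real \<epsilon> / w)" "of_real \<epsilon> * (1 / w)"] by simp
    also have "cmod (of_real \<epsilon> * (1 / w)) = \<epsilon> * cmod (1 / w)"
      using that by (simp only: norm_mult norm_of_real abs_of_pos)
    also have "\<dots> \<le> \<epsilon> * (2 / (1 - k))" using that wf by (intro mult_left_mono) auto
    finally have "cmod (y - y0) \<le> cmod (y - (y0 - of_real \<epsilon> / w)) + \<epsilon> * (2 / (1 - k))" by simp
    moreover have "\<delta> * \<epsilon> \<le> 1 * \<epsilon>" using \<delta> that by (intro mult_right_mono) auto
    ultimately have "cmod (y - y0) \<le> C0 * \<epsilon>" using that(2) by (simp add: C0_def algebra_simps)
    with 1 mem that show ?thesis by (simp add: Reg_def dist_norm algebra_simps)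
  qed
  have "\<exists>e>0. \<forall>\<epsilon>. 0 < \<epsilon> \<and> \<epsilon> < e \<longrightarrow>
           (\<exists>y. cmod (y - (y0 - of_real \<epsilon> / w)) \<le> \<delta> * \<epsilon> \<and> Q (y, t0 + \<epsilon>) = 0)"
    by (rule level_point_moves[OF der a wf(2) Q0 \<delta>(1) cont]) (use near in blast)
  then show ?thesis using near by meson
qed

definition N' :: "complex \<Rightarrow> real \<Rightarrow> complex" where
  "N' z t = deriv h z + (deriv h2 z - deriv h z) * e t"

text \<open>
  With \<open>N\<^sub>t = \<gamma> (m+1) (h - N)\<close>, this is the Loewner equation \<open>z P\<^sub>z = W P\<^sub>t\<close> for \<open>P = z exp((m+1)t) N\<^sup>1\<^sup>/\<^sup>\<gamma>\<close>.
\<close>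

lemma z_N':
  assumes "cmod z < 1"
  shows "z * N' z t = \<gamma> * (of_real m1 * h z * W z t - N z t)"
proof -
  have 0: "z * N' z t = z * deriv h z + (\<gamma> * (h z - h2 z) - z * deriv h z) * e t"
    unfolding N'_def ode[OF assms, symmetric] by (simp add: algebra_simps)
  have "\<gamma> * (of_real m1 * h z * W z t) = \<gamma> * h z * (1 + A z t)"
    unfolding W_def by simp
  also have "\<dots> = \<gamma> * h z + (1 - e t) * (z * deriv h z)"
    unfolding A_def using \<gamma> h_nz[OF assms] by (simp add: field_simps)
  finally show ?thesis
    unfolding 0 N_def by (simp add: algebra_simps)
qed

lemma N_derivative:
  assumes "cmod z < 1"
  shows "((\<lambda>p. N (fst p) (snd p)) has_derivative
    (\<lambda>d. N' z t * fst d + \<gamma> * of_real m1 * (h z - N z t) * of_real (snd d))) (at (z, t) within S)"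
proof -
  have dh: "(h has_derivative (\<lambda>d. deriv h z * d)) (at z)"
    using holomorphic_derivI[OF hol_h] assms by (simp add: has_field_derivative_def)
  have dh2: "(h2 has_derivative (\<lambda>d. deriv h2 z * d)) (at z)"
    using holomorphic_derivI[OF hol_h2] assms by (simp add: has_field_derivative_def)
  have de: "(e has_derivative (\<lambda>d. d *\<^sub>R (- (of_real m1 * \<gamma>) * e t))) (at t)"
    using e_deriv by (simp add: has_vector_derivative_def)
  have f: "(fst has_derivative fst) (at (z, t) within S)" and s: "(snd has_derivative snd) (at (z, t) within S)"
    by (auto intro: derivative_eq_intros)
  note 1 = has_derivative_compose[OF f, of h, simplified, OF dh]
  note 2 = has_derivative_compose[OF f, of h2, simplified, OF dh2]
  note 3 = has_derivative_compose[OF s, of e, simplified, OF de]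
  have "((\<lambda>p. h (fst p) + (h2 (fst p) - h (fst p)) * e (snd p)) has_derivative
    (\<lambda>d. deriv h z * fst d + ((h2 z - h z) * (snd d *\<^sub>R (- (of_real m1 * \<gamma>) * e t)) + (deriv h2 z * fst d - deriv h z * fst d) * e t)))
      (at (z, t) within S)"
    using has_derivative_add[OF 1 has_derivative_mult[OF has_derivative_diff[OF 2 1] 3]] by simp
  then show ?thesis unfolding N_def N'_def
    by (simp add: scaleR_conv_of_real algebra_simps)
qed

lemma continuous_N: "continuous_on ({z. cmod z < 1} \<times> UNIV) (\<lambda>p. N (fst p) (snd p))"
  using N_derivative has_derivative_continuous
  by (force simp: continuous_on_eq_continuous_within)

lemma N_exp_derivative:
  assumes "Re y < 0"
  shows "((\<lambda>p. N (exp (fst p)) (snd p)) has_derivative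
    (\<lambda>d. \<gamma> * (of_real m1 * h (exp y) * W (exp y) t - N (exp y) t) * fst d
       + \<gamma> * of_real m1 * (h (exp y) - N (exp y) t) * of_real (snd d))) (at (y, t) within S)"
proof -
  have z: "cmod (exp y) < 1" using assms by simp
  have 1: "((\<lambda>p. (exp (fst p), snd p)) has_derivative (\<lambda>d. (exp y * fst d, snd d))) (at (y, t) within S)"
  proof -
    have "(exp has_derivative (\<lambda>x. exp y * x)) (at y)"
      using DERIV_exp[of y] by (simp add: has_field_derivative_def)
    moreover have "(fst has_derivative fst) (at (y, t) within S)" by (auto intro: derivative_eq_intros)
    ultimately have "((\<lambda>p. exp (fst p)) has_derivative (\<lambda>d. exp y * fst d)) (at (y, t) within S)"
      using has_derivative_compose[of fst fst "(y, t)" S exp "\<lambda>x. exp y * x"] by simp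
    then show ?thesis by (auto intro!: derivative_eq_intros)
  qed
  have "((\<lambda>p. N (fst (exp (fst p), snd p)) (snd (exp (fst p), snd p))) has_derivative
    (\<lambda>d. N' (exp y) t * fst (exp y * fst d, snd d) + \<gamma> * of_real m1 * (h (exp y) - N (exp y) t) * of_real (snd (exp y * fst d, snd d))))
     (at (y, t) within S)"
    by (rule has_derivative_compose[OF 1]) (use N_derivative[OF z, of t UNIV] in simp)
  moreover have "N' (exp y) t * (exp y * x) = \<gamma> * (of_real m1 * h (exp y) * W (exp y) t - N (exp y) t) * x" for x
    using z_N'[OF z, of t] by (metis mult.assoc mult.commute)
  ultimately show ?thesis by simp
qed

text \<open>
  At time \<open>t\<close> the natural scale is \<open>exp(-t)\<close>: there \<open>h2 - h\<close> is controlled by \<open>growth\<close>, and \<open>A\<close>, which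
  is bounded and vanishes at \<open>0\<close>, by the Schwarz lemma. The second quantity is \<open>z P\<^sub>z / P\<close>, whose
  closeness to \<open>1\<close> will give injectivity.
\<close>

lemma near_origin:
  obtains r where "0 < r" "r \<le> 1 / 2"
    "\<And>z t. 0 \<le> t \<Longrightarrow> cmod z \<le> r * exp (- t) \<Longrightarrow> cmod (N z t - 1) \<le> 1 / 4"
    "\<And>z t. 0 \<le> t \<Longrightarrow> cmod z \<le> r * exp (- t) \<Longrightarrow> cmod (of_real m1 * h z * W z t / N z t - 1) \<le> 1 / 2"
proof -
  have sub: "cball 0 (1/2) \<subseteq> ball (0::complex) 1" by auto
  have "continuous_on (cball 0 (1/2)) (deriv h)"
    by (intro holomorphic_on_imp_continuous_on holomorphic_on_subset[OF holomorphic_deriv[OF hol_h open_ball] sub])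
  then have "bounded (deriv h ` cball 0 (1/2))"
    by (intro compact_imp_bounded compact_continuous_image) auto
  then obtain B where B: "\<forall>z\<in>cball 0 (1/2). cmod (deriv h z) \<le> B" by (auto simp: bounded_iff)
  have h1: "cmod (h z - 1) \<le> B * cmod z" if "cmod z \<le> 1 / 2" for z
  proof -
    have "norm (h z - h 0) \<le> B * norm (z - 0)"
    proof (rule field_differentiable_bound[of "cball 0 (1/2)" h "deriv h"])
      fix x :: complex assume "x \<in> cball 0 (1/2)"
      then show "(h has_field_derivative deriv h x) (at x within cball 0 (1/2))" "cmod (deriv h x) \<le> B"
        using B holomorphic_derivI[OF hol_h open_ball, of x] by (auto intro: has_field_derivative_at_within)
    qed (use that in auto)
    then show ?thesis by (simp add: h_0)
  qed
  have "cmod (deriv h 0) \<le> B" using B by simp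
  then have B0: "0 \<le> B" using norm_ge_zero[of "deriv h 0"] by linarith
  \<comment> \<open>An upper bound for \<open>|A|\<close>; the summand \<open>1\<close> makes it strict, as in the Schwarz lemma.\<close>
  define M where "M = k * m1 + 1"
  have M: "M > 0" using k0 m1(1) by (simp add: M_def add_nonneg_pos)
  have Cg0: "0 \<le> Cg"
  proof -
    have "0 \<le> cmod ((h2 (1/2) - h (1/2)) * exp (- (of_real ((m + 1) * 0) * \<gamma>)))" by (rule norm_ge_zero)
    also have "\<dots> \<le> Cg * (cmod (1/2) * exp 0)" by (rule growth) auto
    finally show ?thesis by simp
  qed
  define r where "r = min (1/2) (1 / (8 * (B + Cg + 2 * M + 1)))"
  have D: "0 < B + Cg + 2 * M + 1" using B0 Cg0 M by linarith
  have r: "0 < r" "r \<le> 1/2" using D by (auto simp: r_def)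
  have rD: "r * (B + Cg + 2 * M + 1) \<le> 1 / 8"
  proof -
    have "r * (B + Cg + 2 * M + 1) \<le> (1 / (8 * (B + Cg + 2 * M + 1))) * (B + Cg + 2 * M + 1)"
      using D by (intro mult_right_mono) (auto simp: r_def)
    also have "\<dots> = 1 / 8" using D by simp
    finally show ?thesis .
  qed
  have r1: "r * B + r * Cg \<le> 1/8" "r * Cg + 2 * (r * M) \<le> 1 / 8" "r * B \<le> 1/8" "r * M \<le> 1 / 8"
  proof -
    have "0 \<le> r * B" "0 \<le> r * Cg" "0 \<le> r * M" using r B0 Cg0 M by auto
    then show "r * B + r * Cg \<le> 1/8" "r * Cg + 2 * (r * M) \<le> 1 / 8" "r * B \<le> 1/8" "r * M \<le> 1 / 8"
      using rD r by (auto simp: algebra_simps)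
  qed
  have est: "cmod (h z - 1) \<le> r * B \<and> cmod (N z t - h z) \<le> r * Cg \<and> cmod (A z t) \<le> r * M"
    if t: "0 \<le> t" and z: "cmod z \<le> r * exp (- t)" for z t
  proof (intro conjI)
    have e1: "exp (-t) \<le> 1" using t by simp
    have "r * exp (-t) \<le> r * 1" using r e1 by (intro mult_left_mono) auto
    then have zr: "cmod z \<le> r" using z by simp
    have "B * cmod z \<le> B * r" using zr B0 by (intro mult_left_mono)
    then show "cmod (h z - 1) \<le> r * B" using h1[of z] zr r by (simp add: mult.commute)
    have "r * exp (-t) \<le> (1/2) * exp (-t)" using r by (intro mult_right_mono) auto
    then have "cmod ((h2 z - h z) * e t) \<le> Cg * (cmod z * exp t)"
      unfolding e_def m1_def using z by (intro growth t) linarith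
    also have "\<dots> \<le> Cg * (r * exp (-t) * exp t)" using z Cg0 by (intro mult_left_mono mult_right_mono) auto
    also have "\<dots> = r * Cg" by (simp add: mult.assoc exp_add[symmetric] mult.commute)
    finally show "cmod (N z t - h z) \<le> r * Cg" by (simp add: N_def)
    have shr: "cmod (of_real (exp (-t)) * s) < 1" "cmod (of_real (exp (-t)) * s) \<le> exp (-t)" if "cmod s < 1" for s :: complex
      using mult_right_mono[OF e1, of "cmod s"] mult_left_mono[of "cmod s" 1 "exp (-t)"] that
      by (simp_all add: norm_mult)
    define f where "f = (\<lambda>s. A (of_real (exp (-t)) * s) t / of_real M)"
    have "cmod (f (z * of_real (exp t))) \<le> cmod (z * of_real (exp t))"
    proof (rule Schwarz_Lemma(1))
      have "((\<lambda>z. A z t) \<circ> (\<lambda>s. of_real (exp (-t)) * s)) holomorphic_on ball 0 1"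
        by (rule holomorphic_on_compose_gen[OF _ hol_A]) (use shr in \<open>auto intro!: holomorphic_intros\<close>)
      then show "f holomorphic_on ball 0 1" unfolding f_def
        using M by (intro holomorphic_intros) (simp_all add: o_def)
      show "f 0 = 0" by (simp add: f_def A_def)
      fix s :: complex assume s: "cmod s < 1"
      have c: "cmod (of_real (exp (-t)) * s) \<le> exp (-t)" "cmod (of_real (exp (-t)) * s) < 1"
        using shr[OF s] by auto
      have "cmod (A (of_real (exp (-t)) * s) t) \<le> cmod (A (of_real (exp (-t)) * s) t - of_real ((m - 1) / 2)) + cmod (of_real ((m - 1) / 2) :: complex)"
        by (metis norm_triangle_sub add.commute)
      also have "\<dots> \<le> k * (m1 / 2) + \<bar>m - 1\<bar> / 2"
        using A_bound[OF t c] unfolding norm_of_real by simp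
      also have "\<dots> < M" using mk[folded m1_def] by (simp add: M_def)
      finally show "cmod (f s) < 1" using M by (simp add: f_def norm_divide)
    next
      have "cmod z * exp t \<le> r * exp (-t) * exp t" using z by (intro mult_right_mono) auto
      also have "\<dots> = r" by (simp add: mult.assoc exp_add[symmetric])
      finally show "cmod (z * of_real (exp t)) < 1" using r by (simp add: norm_mult)
    qed
    moreover have "of_real (exp (-t)) * (z * of_real (exp t)) = z"
      by (simp add: mult.left_commute exp_minus field_simps)
    ultimately have "cmod (A z t) / M \<le> cmod z * exp t" using M by (simp add: f_def norm_divide norm_mult)
    also have "\<dots> \<le> r * exp (-t) * exp t" using z by (intro mult_right_mono) auto
    also have "\<dots> = r" by (simp add: mult.assoc exp_add[symmetric])
    finally show "cmod (A z t) \<le> r * M" using M by (simp add: field_simps)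
  qed
  show thesis
  proof (rule that[OF r])
    fix z t assume t: "0 \<le> t" and z: "cmod z \<le> r * exp (- t)"
    note es = est[OF t z]
    have "cmod (N z t - 1) \<le> cmod (N z t - h z) + cmod (h z - 1)"
      using norm_triangle_ineq[of "N z t - h z" "h z - 1"] by simp
    then have N1: "cmod (N z t - 1) \<le> 1 / 8" using es r1 by linarith
    then show "cmod (N z t - 1) \<le> 1 / 4" by linarith
    have "1 \<le> cmod (N z t) + cmod (N z t - 1)" by (metis norm_minus_commute norm_triangle_sub norm_one add.commute)
    then have Nn: "7 / 8 \<le> cmod (N z t)" using N1 by linarith
    then have N0: "N z t \<noteq> 0" by auto
    have h2: "cmod (h z) \<le> 2" using norm_triangle_sub[of "h z" 1] es r1 by simp
      have "of_real m1 * h z * W z t = h z * (1 + A z t)" unfolding W_def by simp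
    then have "of_real m1 * h z * W z t / N z t - 1 = (- (N z t - h z) + h z * A z t) / N z t"
      using N0 by (simp add: field_simps)
    then have "cmod (of_real m1 * h z * W z t / N z t - 1) = cmod (- (N z t - h z) + h z * A z t) / cmod (N z t)"
      by (simp add: norm_divide)
    also have "\<dots> \<le> (1/8) / (7/8)"
    proof (intro frac_le Nn)
      have "cmod (- (N z t - h z) + h z * A z t) \<le> cmod (N z t - h z) + cmod (h z) * cmod (A z t)"
        using norm_triangle_ineq[of "- (N z t - h z)" "h z * A z t"] by (simp add: norm_mult norm_minus_commute)
      also have "\<dots> \<le> r * Cg + 2 * (r * M)" using es h2 by (intro add_mono mult_mono) auto
      finally show "cmod (- (N z t - h z) + h z * A z t) \<le> 1/8" using r1 by linarith
    qed auto
    finally show "cmod (of_real m1 * h z * W z t / N z t - 1) \<le> 1 / 2" by simp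
  qed
qed

definition small_radius :: "real \<Rightarrow> bool" where
  "small_radius r \<longleftrightarrow> 0 < r \<and> r \<le> 1 / 2 \<and> (\<forall>z t. 0 \<le> t \<and> cmod z \<le> r * exp (- t) \<longrightarrow>
     cmod (N z t - 1) \<le> 1 / 4 \<and> cmod (of_real m1 * h z * W z t / N z t - 1) \<le> 1 / 2)"

definition r0 :: real where "r0 = (SOME r. small_radius r)"

lemma small_radius_r0: "small_radius r0"
proof -
  obtain r where "small_radius r" unfolding small_radius_def using near_origin by metis
  then show ?thesis unfolding r0_def by (rule someI)
qed

lemma r0: "0 < r0" "r0 \<le> 1 / 2" using small_radius_r0 by (auto simp: small_radius_def)

lemma near0:
  assumes "0 \<le> t" "cmod z \<le> r0 * exp (- t)"
  shows "cmod (N z t - 1) \<le> 1 / 4" "cmod (of_real m1 * h z * W z t / N z t - 1) \<le> 1 / 2"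
  using small_radius_r0 assms by (auto simp: small_radius_def)

text \<open>
  After time \<open>c1\<close>, a level point starting on \<open>|z| \<le> exp(-s)\<close> has gained the factor \<open>r0\<close> on the shrinking circle.
\<close>

definition c1 :: real where "c1 = - ln r0 / (c0 - 1)"

lemma c1: "0 \<le> c1" "(c0 - 1) * c1 = - ln r0"
  using r0 c0_gt_1 by (auto simp: c1_def divide_nonpos_pos)

lemma Reg_arrive:
  assumes "(y, s + c1) \<in> Reg b s" "b \<le> - s"
  shows "Re y \<le> - (s + c1) + ln r0" "cmod (exp y) \<le> r0 * exp (- (s + c1))"
proof -
  have "Re y \<le> b - c0 * c1" using assms by (simp add: Reg_def)
  then show 1: "Re y \<le> - (s + c1) + ln r0" using c1(2) assms by (simp add: algebra_simps)
  then have "cmod (exp y) \<le> exp (- (s + c1) + ln r0)" by simp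
  also have "\<dots> = r0 * exp (- (s + c1))" using r0 by (simp add: exp_add)
  finally show "cmod (exp y) \<le> r0 * exp (- (s + c1))" .
qed

lemma continuous_N_exp:
  assumes "0 \<le> s" "b \<le> - s" "b < 0"
  shows "continuous_on (Reg b s) (\<lambda>p. N (exp (fst p)) (snd p))"
proof -
  have "(exp (fst p), snd p) \<in> {z. cmod z < 1} \<times> UNIV" if "p \<in> Reg b s" for p
    using Reg_Dom(2)[OF that assms] by simp
  then have "(\<lambda>p. (exp (fst p), snd p)) ` Reg b s \<subseteq> {z. cmod z < 1} \<times> UNIV" by blast
  from continuous_on_compose2[OF continuous_N _ this] show ?thesis
    by (simp add: continuous_intros)
qed

lemma N_0 [simp]: "N 0 t = 1" by (simp add: N_def h_0 h2_0)

text \<open>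
  At a zero of \<open>N\<close> the derivatives in \<open>y = log z\<close> and \<open>t\<close> have the quotient \<open>W\<close>, so zeros move
  like level points of \<open>P\<close>. A zero would reach, after time \<open>c1\<close>, the region where \<open>N\<close> is close to \<open>1\<close>.
\<close>

lemma N_nonzero:
  assumes "(z, s) \<in> Dom"
  shows "N z s \<noteq> 0"
proof
  assume N0: "N z s = 0"
  then have z: "z \<noteq> 0" by auto
  define y0 where "y0 = Ln z"
  have z_eq: "exp y0 = z" using z by (simp add: y0_def)
  have s: "0 \<le> s" and zs: "cmod z \<le> exp (- s)" "cmod z < 1" using assms by (auto simp: Dom_def)
  have "Re y0 = ln (cmod z)" using z by (simp add: y0_def)
  moreover have "ln (cmod z) \<le> - s" using zs z by (metis ln_exp ln_le_cancel_iff zero_less_norm_iff exp_gt_zero)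
  moreover have "ln (cmod z) < 0" using zs z by simp
  ultimately have y0: "Re y0 \<le> - s" "Re y0 < 0" by auto
  note R = Reg_Dom[OF _ s y0]
  define Q where "Q = (\<lambda>p. N (exp (fst p)) (snd p))"
  have contQ: "continuous_on (Reg (Re y0) s) Q" unfolding Q_def by (rule continuous_N_exp[OF s y0])
  have "\<exists>y. (y, s + c1) \<in> {p \<in> Reg (Re y0) s. Q p = 0} \<and> dist y y0 \<le> C0 * (s + c1 - s)"
  proof (rule forward_tracking)
    show "closed {p \<in> Reg (Re y0) s. Q p = 0}"
      by (rule continuous_closed_preimage_constant[OF contQ closed_Reg])
    show "(y0, s) \<in> {p \<in> Reg (Re y0) s. Q p = 0}" using N0 z_eq by (simp add: Reg_def Q_def)
    fix y t assume yt: "(y, t) \<in> {p \<in> Reg (Re y0) s. Q p = 0}" "s \<le> t" "t < s + c1"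
    then have mem: "(y, t) \<in> Reg (Re y0) s" and N0: "N (exp y) t = 0" by (auto simp: Q_def)
    have Dm: "0 \<le> t" "cmod (exp y) \<le> exp (-t)" "cmod (exp y) < 1" using R[OF mem] by (auto simp: Dom_def)
    have "\<exists>\<eta>>0. \<forall>\<epsilon>. 0 < \<epsilon> \<and> \<epsilon> < \<eta> \<longrightarrow>
      (\<exists>y'. (y', t + \<epsilon>) \<in> Reg (Re y0) s \<and> Q (y', t + \<epsilon>) = 0 \<and> dist y' y \<le> C0 * \<epsilon>)"
    proof (rule level_step[OF _ _ W_bound[OF Dm] _ mem contQ])
      show "(Q has_derivative (\<lambda>d. (\<gamma> * of_real m1 * h (exp y)) * (W (exp y) t * fst d + of_real (snd d)))) (at (y, t) within Reg (Re y0) s)"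
        using N_exp_derivative[of y t "Reg (Re y0) s"] R(2)[OF mem] unfolding Q_def N0
        by (simp add: algebra_simps)
      show "\<gamma> * of_real m1 * h (exp y) \<noteq> 0" using \<gamma> h_nz Dm by simp
    qed (use N0 in \<open>simp add: Q_def\<close>)
    then obtain \<eta> where \<eta>: "\<eta> > 0" "\<And>\<epsilon>. 0 < \<epsilon> \<Longrightarrow> \<epsilon> < \<eta> \<Longrightarrow> \<exists>y'. (y', t + \<epsilon>) \<in> Reg (Re y0) s \<and> Q (y', t + \<epsilon>) = 0 \<and> dist y' y \<le> C0 * \<epsilon>"
      by blast
    define \<epsilon> where "\<epsilon> = min (\<eta> / 2) (s + c1 - t)"
    have "0 < \<epsilon>" "\<epsilon> < \<eta>" "t + \<epsilon> \<le> s + c1" using \<eta>(1) yt by (auto simp: \<epsilon>_def)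
    with \<eta>(2)[of \<epsilon>] show "\<exists>\<epsilon> y'. 0 < \<epsilon> \<and> t + \<epsilon> \<le> s + c1 \<and> (y', t + \<epsilon>) \<in> {p \<in> Reg (Re y0) s. Q p = 0} \<and> dist y' y \<le> C0 * \<epsilon>"
      by blast
  qed (use C0_pos c1 in auto)
  then obtain y where y: "(y, s + c1) \<in> Reg (Re y0) s" "N (exp y) (s + c1) = 0" by (auto simp: Q_def)
  have "cmod (N (exp y) (s + c1) - 1) \<le> 1 / 4"
    using Reg_arrive[OF y(1) y0(1)] s c1 by (intro near0) auto
  then show False using y(2) by simp
qed

lemma Dom_starlike: "starlike Dom"
  using starlike_scaled_disks[of 1] by (simp add: Dom_def)

lemma exists_L:
  "\<exists>L. continuous_on Dom L \<and> (\<forall>p\<in>Dom. exp (L p) = N (fst p) (snd p)) \<and> L (0, 0) = 0"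
proof -
  have "continuous_on Dom (\<lambda>p. N (fst p) (snd p))"
    by (rule continuous_on_subset[OF continuous_N]) (auto simp: Dom_def)
  then obtain g where g: "continuous_on Dom g" "\<And>p. p \<in> Dom \<Longrightarrow> N (fst p) (snd p) = exp (g p)"
    using continuous_logarithm_on_contractible[of Dom "\<lambda>p. N (fst p) (snd p)"]
      starlike_imp_contractible[OF Dom_starlike] N_nonzero by (metis prod.collapse)
  have "(0, 0) \<in> Dom" by (simp add: Dom_def)
  from g(2)[OF this] have "exp (g (0, 0)) = 1" by simp
  with g show ?thesis
    by (intro exI[of _ "\<lambda>p. g p - g (0, 0)"]) (auto simp: exp_diff intro!: continuous_intros)
qed

definition L :: "complex \<times> real \<Rightarrow> complex" where
  "L = (SOME L. continuous_on Dom L \<and> (\<forall>p\<in>Dom. exp (L p) = N (fst p) (snd p)) \<and> L (0, 0) = 0)"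

lemma L: "continuous_on Dom L" "\<And>p. p \<in> Dom \<Longrightarrow> exp (L p) = N (fst p) (snd p)" "L (0, 0) = 0"
  using someI_ex[OF exists_L] unfolding L_def[symmetric] by auto

text \<open>
  Both sides are continuous logarithms of \<open>N\<close> on a connected set and agree at the origin.
\<close>

lemma L_near0:
  assumes "0 \<le> t" "cmod z \<le> r0 * exp (- t)"
  shows "L (z, t) = Ln (N z t)" "cmod (L (z, t)) \<le> 1 / 2"
proof -
  define S where "S = {p::complex \<times> real. 0 \<le> snd p \<and> cmod (fst p) \<le> r0 * exp (- snd p) \<and> cmod (fst p) < 1}"
  have SD: "S \<subseteq> Dom"
  proof
    fix p assume p: "p \<in> S"
    have "r0 * exp (- snd p) \<le> 1 * exp (- snd p)" using r0 by (intro mult_right_mono) auto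
    then have "cmod (fst p) \<le> exp (- snd p)" using p unfolding S_def mem_Collect_eq by linarith
    then show "p \<in> Dom" using p by (auto simp: S_def Dom_def)
  qed
  have N1: "cmod (N (fst p) (snd p) - 1) \<le> 1 / 4" if "p \<in> S" for p
    using that near0(1)[of "snd p" "fst p"] by (auto simp: S_def)
  have npos: "w \<notin> \<real>\<^sub>\<le>\<^sub>0" if "cmod (w - 1) \<le> 1 / 4" for w
    using that abs_Re_le_cmod[of "w - 1"] by (auto simp: complex_nonpos_Reals_iff)
  have "r0 * exp (-t) < 1"
  proof -
    have "r0 * exp (-t) \<le> r0 * 1" using r0 assms by (intro mult_left_mono) auto
    then show ?thesis using r0 by linarith
  qed
  then have zS: "(z, t) \<in> S" using assms by (simp add: S_def)
  show *: "L (z, t) = Ln (N z t)"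
  proof -
    have "L (z, t) = (\<lambda>p. Ln (N (fst p) (snd p))) (z, t)"
    proof (rule continuous_logarithm_unique[of S])
      show "connected S" using starlike_scaled_disks[OF r0(1)] by (auto simp: S_def intro: starlike_imp_connected)
      show "continuous_on S L" by (rule continuous_on_subset[OF L(1) SD])
      have "continuous_on S (\<lambda>p. N (fst p) (snd p))"
        by (rule continuous_on_subset[OF continuous_N]) (auto simp: S_def)
      then show "continuous_on S (\<lambda>p. Ln (N (fst p) (snd p)))"
        using N1 npos by (auto intro!: continuous_on_Ln')
      show "exp (L p) = exp (Ln (N (fst p) (snd p)))" if "p \<in> S" for p
        using L(2)[of p] N_nonzero[of "fst p" "snd p"] that SD by auto
      show "(0, 0) \<in> S" using r0 by (simp add: S_def)
    qed (use zS in \<open>auto simp: L(3)\<close>)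
    then show ?thesis by simp
  qed
  have "cmod (Ln (1 + (N z t - 1))) \<le> 2 * cmod (N z t - 1)"
    using near0(1)[OF assms] by (intro norm_Ln_le) simp
  then show "cmod (L (z, t)) \<le> 1 / 2" using near0(1)[OF assms] by (simp add: *)
qed

section \<open>The Loewner chain: univalence and bounds\<close>

text \<open>
  The logarithm of \<open>P\<close> in the coordinate \<open>y = log z\<close>. Since \<open>L\<close> depends on
  \<open>y\<close> through \<open>exp y\<close>, \<open>Y\<close> commutes with the translation by \<open>2 \<pi> \<i>\<close>, so injectivity of \<open>Y\<close> gives that of \<open>P\<close>.
\<close>

definition Y :: "complex \<Rightarrow> real \<Rightarrow> complex" where
  "Y y t = y + of_real (m1 * t) + L (exp y, t) / \<gamma>"

text \<open>
  The time derivative of \<open>Y\<close>; its derivative in \<open>y\<close> is \<open>D W\<close>.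
\<close>

definition D :: "complex \<Rightarrow> real \<Rightarrow> complex" where "D z t = of_real m1 * h z / N z t"

lemma D_nz: "(z, t) \<in> Dom \<Longrightarrow> D z t \<noteq> 0"
  using N_nonzero h_nz by (auto simp: D_def Dom_def)

lemma Y_derivative:
  assumes p: "(y, t) \<in> Reg b s" and s: "0 \<le> s" "b \<le> - s" "b < 0"
  shows "((\<lambda>p. Y (fst p) (snd p)) has_derivative (\<lambda>d. D (exp y) t * (W (exp y) t * fst d + of_real (snd d)))) (at (y, t) within Reg b s)"
proof -
  note R = Reg_Dom[OF _ s]
  define l where "l = (\<lambda>p. L (exp (fst p), snd p))"
  have contl: "continuous_on (Reg b s) l"
    unfolding l_def by (intro continuous_on_compose2[OF L(1)] continuous_intros) (use R in auto)
  have expl: "exp (l p) = N (exp (fst p)) (snd p)" if "p \<in> Reg b s" for p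
    unfolding l_def using L(2)[OF R(4)[OF that]] by simp
  have N0: "N (exp y) t \<noteq> 0" using N_nonzero R(4)[OF p] by simp
  have "((\<lambda>p. exp (l p)) has_derivative
    (\<lambda>d. \<gamma> * (of_real m1 * h (exp y) * W (exp y) t - N (exp y) t) * fst d
       + \<gamma> * of_real m1 * (h (exp y) - N (exp y) t) * of_real (snd d))) (at (y, t) within Reg b s)"
    by (rule has_derivative_transform[OF p _ N_exp_derivative]) (use expl R(2)[OF p] in auto)
  from has_derivative_logarithm[OF _ p this] contl p
  have dl: "(l has_derivative (\<lambda>d. (\<gamma> * (of_real m1 * h (exp y) * W (exp y) t - N (exp y) t) * fst d
       + \<gamma> * of_real m1 * (h (exp y) - N (exp y) t) * of_real (snd d)) / N (exp y) t)) (at (y, t) within Reg b s)"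
    by (simp add: continuous_on_eq_continuous_within expl[OF p])
  have "((\<lambda>p. fst p + of_real m1 * of_real (snd p) + l p * inverse \<gamma>) has_derivative
    (\<lambda>d. fst d + of_real m1 * of_real (snd d) + (\<gamma> * (of_real m1 * h (exp y) * W (exp y) t - N (exp y) t) * fst d
       + \<gamma> * of_real m1 * (h (exp y) - N (exp y) t) * of_real (snd d)) / N (exp y) t * inverse \<gamma>)) (at (y, t) within Reg b s)"
    by (intro has_derivative_add has_derivative_mult_left has_derivative_mult_right dl has_derivative_of_real has_derivative_fst has_derivative_snd has_derivative_ident)
  moreover have "fst d + of_real m1 * of_real (snd d) + (\<gamma> * (of_real m1 * h (exp y) * W (exp y) t - N (exp y) t) * fst d
       + \<gamma> * of_real m1 * (h (exp y) - N (exp y) t) * of_real (snd d)) / N (exp y) t * inverse \<gamma>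
     = D (exp y) t * (W (exp y) t * fst d + of_real (snd d))" for d :: "complex \<times> real"
    using N0 \<gamma> unfolding D_def by (simp add: field_simps)
  ultimately show ?thesis unfolding Y_def l_def by (simp add: divide_inverse)
qed

lemma continuous_Y:
  assumes s: "0 \<le> s" "b \<le> - s" "b < 0"
  shows "continuous_on (Reg b s) (\<lambda>p. Y (fst p) (snd p))"
  using Y_derivative[OF _ s] has_derivative_continuous
  by (force simp: continuous_on_eq_continuous_within)

lemma Y_field_derivative:
  assumes p: "(y, t) \<in> Reg b s" and s: "0 \<le> s" "b \<le> - s" "b < 0"
  shows "((\<lambda>y. Y y t) has_field_derivative D (exp y) t * W (exp y) t) (at y within {y. (y, t) \<in> Reg b s})"
proof -
  have 1: "((\<lambda>y. (y, t)) has_derivative (\<lambda>d. (d, 0))) (at y within {y. (y, t) \<in> Reg b s})"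
    by (auto intro!: derivative_eq_intros)
  have "((\<lambda>p. Y (fst p) (snd p)) has_derivative (\<lambda>d. D (exp y) t * (W (exp y) t * fst d + of_real (snd d))))
    (at (y, t) within (\<lambda>y. (y, t)) ` {y. (y, t) \<in> Reg b s})"
    by (rule has_derivative_subset[OF Y_derivative[OF assms]]) auto
  from has_derivative_in_compose[OF 1 this]
  moreover have "(\<lambda>d. D (exp y) t * (W (exp y) t * d)) = (*) (D (exp y) t * W (exp y) t)"
    by (auto simp: mult.assoc)
  ultimately show ?thesis by (simp add: has_field_derivative_def)
qed

lemma continuous_A: "continuous_on ({z. cmod z < 1} \<times> UNIV) (\<lambda>p. A (fst p) (snd p))"
proof -
  have ce: "continuous_on UNIV e"
    using e_deriv has_vector_derivative_continuous by (force simp: continuous_on_eq_continuous_within)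
  have ch: "continuous_on (ball 0 1) h" "continuous_on (ball 0 1) (deriv h)"
    using hol_h holomorphic_deriv[OF hol_h] by (auto intro: holomorphic_on_imp_continuous_on)
  show ?thesis unfolding A_def
    by (intro continuous_intros continuous_on_compose2[OF ce] continuous_on_compose2[OF ch(1)] continuous_on_compose2[OF ch(2)])
      (use h_nz \<gamma> in auto)
qed

lemma continuous_D_W: "continuous_on Dom (\<lambda>p. D (fst p) (snd p))" "continuous_on Dom (\<lambda>p. W (fst p) (snd p))"
proof -
  have ch: "continuous_on (ball 0 1) h" using hol_h by (rule holomorphic_on_imp_continuous_on)
  have DD: "Dom \<subseteq> {z. cmod z < 1} \<times> UNIV" by (auto simp: Dom_def)
  have N0: "p \<in> Dom \<Longrightarrow> N (fst p) (snd p) \<noteq> 0" for p using N_nonzero by simp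
  show "continuous_on Dom (\<lambda>p. D (fst p) (snd p))" unfolding D_def
    by (intro continuous_intros continuous_on_compose2[OF ch] continuous_on_subset[OF continuous_N DD])
      (use N0 in \<open>auto simp: Dom_def\<close>)
  show "continuous_on Dom (\<lambda>p. W (fst p) (snd p))" unfolding W_def
    by (intro continuous_intros continuous_on_subset[OF continuous_A DD]) simp
qed

lemma convex_Reg_slice: "convex {y. (y, t) \<in> Reg b s}"
proof -
  have "{y. (y, t) \<in> Reg b s} = (if s \<le> t then {y. Re y \<le> b - c0 * (t - s)} else {})"
    by (auto simp: Reg_def)
  then show ?thesis by (simp add: convex_halfspace_Re_le)
qed

lemma Y_step:
  assumes p: "(y, t) \<in> Reg b s" and s: "0 \<le> s" "b \<le> - s" "b < 0" and Y: "Y y t = v"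
  shows "\<exists>\<eta>>0. \<forall>\<epsilon>. 0 < \<epsilon> \<and> \<epsilon> < \<eta> \<longrightarrow>
    (\<exists>y'. (y', t + \<epsilon>) \<in> Reg b s \<and> Y y' (t + \<epsilon>) = v \<and> dist y' y \<le> C0 * \<epsilon>)"
proof -
  have Dm: "0 \<le> t" "cmod (exp y) \<le> exp (-t)" "cmod (exp y) < 1" using Reg_Dom[OF p s] by (auto simp: Dom_def)
  have "\<exists>\<eta>>0. \<forall>\<epsilon>. 0 < \<epsilon> \<and> \<epsilon> < \<eta> \<longrightarrow>
    (\<exists>y'. (y', t + \<epsilon>) \<in> Reg b s \<and> (\<lambda>p. Y (fst p) (snd p) - v) (y', t + \<epsilon>) = 0 \<and> dist y' y \<le> C0 * \<epsilon>)"
  proof (rule level_step[OF _ _ W_bound[OF Dm] _ p])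
    show "((\<lambda>p. Y (fst p) (snd p) - v) has_derivative (\<lambda>d. D (exp y) t * (W (exp y) t * fst d + of_real (snd d)))) (at (y, t) within Reg b s)"
      using has_derivative_diff[OF Y_derivative[OF p s] has_derivative_const[of v]] by simp
    show "continuous_on (Reg b s) (\<lambda>p. Y (fst p) (snd p) - v)" by (intro continuous_intros continuous_Y s)
    show "D (exp y) t \<noteq> 0" using D_nz Reg_Dom(4)[OF p s] by simp
  qed (simp add: Y)
  then show ?thesis by simp
qed

lemma Y_track:
  assumes s: "0 \<le> s" "Re y0 \<le> - s" "Re y0 < 0" and T: "s \<le> T"
  shows "\<exists>y. (y, T) \<in> Reg (Re y0) s \<and> Y y T = Y y0 s \<and> dist y y0 \<le> C0 * (T - s)"
proof -
  define Z where "Z = {p \<in> Reg (Re y0) s. (\<lambda>p. Y (fst p) (snd p)) p = Y y0 s}"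
  have "\<exists>y. (y, T) \<in> Z \<and> dist y y0 \<le> C0 * (T - s)"
  proof (rule forward_tracking)
    show "closed Z" unfolding Z_def
      by (rule continuous_closed_preimage_constant[OF continuous_Y[OF s] closed_Reg])
    show "(y0, s) \<in> Z" by (simp add: Z_def Reg_def)
    fix y t assume yt: "(y, t) \<in> Z" "s \<le> t" "t < T"
    then obtain \<eta> where \<eta>: "\<eta> > 0" "\<And>\<epsilon>. 0 < \<epsilon> \<Longrightarrow> \<epsilon> < \<eta> \<Longrightarrow> \<exists>y'. (y', t + \<epsilon>) \<in> Reg (Re y0) s \<and> Y y' (t + \<epsilon>) = Y y0 s \<and> dist y' y \<le> C0 * \<epsilon>"
      using Y_step[of y t "Re y0" s "Y y0 s"] s by (auto simp: Z_def)
    define \<epsilon> where "\<epsilon> = min (\<eta> / 2) (T - t)"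
    have "0 < \<epsilon>" "\<epsilon> < \<eta>" "t + \<epsilon> \<le> T" using \<eta>(1) yt by (auto simp: \<epsilon>_def)
    with \<eta>(2)[of \<epsilon>] show "\<exists>\<epsilon> y'. 0 < \<epsilon> \<and> t + \<epsilon> \<le> T \<and> (y', t + \<epsilon>) \<in> Z \<and> dist y' y \<le> C0 * \<epsilon>"
      by (auto simp: Z_def)
  qed (use C0_pos T in auto)
  then show ?thesis by (auto simp: Z_def)
qed

text \<open>
  The neighbourhood is uniform in the time \<open>u\<close>; this keeps distinct points with equal values
  from merging in a limit.
\<close>

lemma Y_locally_injective:
  assumes p: "(a, t) \<in> Reg b s" and s: "0 \<le> s" "b \<le> - s" "b < 0"
  shows "\<exists>d>0. \<forall>y1 y2 u. (y1, u) \<in> Reg b s \<and> (y2, u) \<in> Reg b s \<and> dist (y1, u) (a, t) < d \<and> dist (y2, u) (a, t) < d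
    \<and> Y y1 u = Y y2 u \<longrightarrow> y1 = y2"
proof -
  note R = Reg_Dom[OF _ s]
  define f where "f = (\<lambda>p. D (exp (fst p)) (snd p) * W (exp (fst p)) (snd p))"
  have "continuous_on (Reg b s) (\<lambda>p. D (fst (exp (fst p), snd p)) (snd (exp (fst p), snd p)))"
    by (rule continuous_on_compose2[OF continuous_D_W(1)]) (use R in \<open>auto intro!: continuous_intros\<close>)
  moreover have "continuous_on (Reg b s) (\<lambda>p. W (fst (exp (fst p), snd p)) (snd (exp (fst p), snd p)))"
    by (rule continuous_on_compose2[OF continuous_D_W(2)]) (use R in \<open>auto intro!: continuous_intros\<close>)
  ultimately have cf: "continuous_on (Reg b s) f" unfolding f_def by (auto intro!: continuous_intros)
  define f0 where "f0 = f (a, t)"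
  have "W (exp a) t \<noteq> 0" using R[OF p] by (intro disk_half(2) W_bound) auto
  then have f0: "f0 \<noteq> 0" using D_nz R(4)[OF p] by (simp add: f0_def f_def)
  then have "0 < cmod f0 / 2" by simp
  then obtain d where d: "d > 0" "\<And>q. q \<in> Reg b s \<Longrightarrow> dist q (a, t) < d \<Longrightarrow> dist (f q) f0 < cmod f0 / 2"
    using cf p unfolding continuous_on_iff f0_def by meson
  have "y1 = y2" if y: "(y1, u) \<in> Reg b s" "(y2, u) \<in> Reg b s" "dist (y1, u) (a, t) < d" "dist (y2, u) (a, t) < d"
    "Y y1 u = Y y2 u" for y1 y2 u
  proof -
    define S where "S = {y. (y, u) \<in> Reg b s} \<inter> {y. dist (y, u) (a, t) < d}"
    have "{y. dist (y, u) (a, t) < d} = (\<lambda>y. (y, u)) -` ball (a, t) d" by (auto simp: dist_commute)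
    moreover have "convex ((\<lambda>y::complex. (y, u)) -` ball (a, t) d)"
    proof (rule convexI)
      fix x y :: complex and v w :: real
      assume "x \<in> (\<lambda>y. (y, u)) -` ball (a, t) d" "y \<in> (\<lambda>y. (y, u)) -` ball (a, t) d" and vw: "0 \<le> v" "0 \<le> w" "v + w = 1"
      then have "v *\<^sub>R (x, u) + w *\<^sub>R (y, u) \<in> ball (a, t) d"
        by (intro convexD[OF convex_ball]) (simp_all only: vimage_eq)
      moreover have "v *\<^sub>R (x, u) + w *\<^sub>R (y, u) = (v *\<^sub>R x + w *\<^sub>R y, u)"
        using vw by (simp add: distrib_right[symmetric])
      ultimately show "v *\<^sub>R x + w *\<^sub>R y \<in> (\<lambda>y. (y, u)) -` ball (a, t) d" by simp
    qed
    ultimately have cvx: "convex S" unfolding S_def by (intro convex_Int convex_Reg_slice) simp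
    have "cmod (Y y1 u - Y y2 u - f0 * (y1 - y2)) \<le> cmod f0 / 2 * cmod (y1 - y2)"
    proof (rule nearly_linear_on_convex[OF cvx, of "\<lambda>y. Y y u" "\<lambda>y. f (y, u)"])
      fix y assume yS: "y \<in> S"
      then show "((\<lambda>y. Y y u) has_field_derivative f (y, u)) (at y within S)"
        using has_field_derivative_subset[OF Y_field_derivative[OF _ s, of y u], of S] by (auto simp: S_def f_def)
      show "cmod (f (y, u) - f0) \<le> cmod f0 / 2"
        using d(2)[of "(y, u)"] yS by (auto simp: S_def dist_norm)
    qed (use y in \<open>auto simp: S_def\<close>)
    then have "cmod f0 * cmod (y1 - y2) \<le> cmod f0 / 2 * cmod (y1 - y2)" using y(5) by (simp add: norm_mult)
    then show ?thesis using f0 by (simp add: field_simps)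
  qed
  then show ?thesis using d(1) by blast
qed

lemma Y_injective_near0:
  assumes "0 \<le> t" "Re x \<le> - t + ln r0" "Re y \<le> - t + ln r0" "Y x t = Y y t"
  shows "x = y"
proof -
  define b where "b = - t + ln r0"
  have "ln r0 < 0" using r0 by (simp add: ln_less_zero_iff)
  then have b: "b \<le> - t" "b < 0" using assms(1) by (auto simp: b_def)
  have in_iff: "(y, t) \<in> Reg b t \<longleftrightarrow> Re y \<le> b" for y by (simp add: Reg_def)
  have "cmod (Y x t - Y y t - 1 * (x - y)) \<le> 1 / 2 * cmod (x - y)"
  proof (rule nearly_linear_on_convex[OF convex_Reg_slice[of t b t]])
    fix y assume y: "y \<in> {y. (y, t) \<in> Reg b t}"
    show "((\<lambda>y. Y y t) has_field_derivative D (exp y) t * W (exp y) t) (at y within {y. (y, t) \<in> Reg b t})"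
      using y b assms(1) by (intro Y_field_derivative) auto
    have "Re y \<le> b" using y in_iff by blast
    then have "cmod (exp y) \<le> exp (- t + ln r0)" by (simp add: b_def)
    also have "\<dots> = r0 * exp (-t)" using r0 exp_add[of "-t" "ln r0"] by simp
    finally show "cmod (D (exp y) t * W (exp y) t - 1) \<le> 1 / 2"
      using near0(2)[OF assms(1), of "exp y"] by (simp add: D_def)
  qed (use assms in \<open>simp_all add: Reg_def b_def\<close>)
  then show ?thesis using assms(4) norm_minus_commute[of x y] by simp
qed

text \<open>
  Two points with the same value are moved forward as a pair. They cannot merge, by local
  injectivity, and arrive as distinct points with equal values where \<open>Y\<close> is close to a translation.
\<close>

lemma Y_injective:
  assumes s: "0 \<le> s" and x: "Re x \<le> - s" "Re x < 0" and y: "Re y \<le> - s" "Re y < 0" and eq: "Y x s = Y y s"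
  shows "x = y"
proof (rule ccontr)
  assume ne: "x \<noteq> y"
  define b where "b = max (Re x) (Re y)"
  have b: "b \<le> - s" "b < 0" using x y by (auto simp: b_def)
  note R = Reg_Dom[OF _ s b]
  define v where "v = Y x s"
  define Z0 where "Z0 = {p \<in> Reg b s. (\<lambda>p. Y (fst p) (snd p)) p = v}"
  have clZ0: "closed Z0" unfolding Z0_def
    by (rule continuous_closed_preimage_constant[OF continuous_Y[OF s b] closed_Reg])
  define Z where "Z = {q::(complex \<times> complex) \<times> real. (fst (fst q), snd q) \<in> Z0 \<and> (snd (fst q), snd q) \<in> Z0 \<and> fst (fst q) \<noteq> snd (fst q)}"
  have "closed Z" unfolding closed_sequential_limits
  proof (intro allI impI, elim conjE)
    fix q l assume q: "\<forall>n. q n \<in> Z" and lim: "q \<longlonglongrightarrow> l"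
    have l1: "(\<lambda>n. (fst (fst (q n)), snd (q n))) \<longlonglongrightarrow> (fst (fst l), snd l)"
      and l2: "(\<lambda>n. (snd (fst (q n)), snd (q n))) \<longlonglongrightarrow> (snd (fst l), snd l)"
      using lim by (auto intro!: tendsto_intros)
    have m1: "(fst (fst l), snd l) \<in> Z0"
      by (rule Lim_in_closed_set[OF clZ0 _ _ l1]) (use q in \<open>auto simp: Z_def\<close>)
    have m2: "(snd (fst l), snd l) \<in> Z0"
      by (rule Lim_in_closed_set[OF clZ0 _ _ l2]) (use q in \<open>auto simp: Z_def\<close>)
    have "fst (fst l) \<noteq> snd (fst l)"
    proof
      assume same: "fst (fst l) = snd (fst l)"
      obtain d where d: "d > 0" and inj: "\<And>y1 y2 u. (y1, u) \<in> Reg b s \<Longrightarrow> (y2, u) \<in> Reg b s \<Longrightarrow>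
        dist (y1, u) (fst (fst l), snd l) < d \<Longrightarrow> dist (y2, u) (fst (fst l), snd l) < d \<Longrightarrow> Y y1 u = Y y2 u \<Longrightarrow> y1 = y2"
        using Y_locally_injective[of "fst (fst l)" "snd l" b s] m1 s b unfolding Z0_def by fast
      have "\<forall>\<^sub>F n in sequentially. dist (fst (fst (q n)), snd (q n)) (fst (fst l), snd l) < d"
        using l1 d by (rule tendstoD)
      moreover have "\<forall>\<^sub>F n in sequentially. dist (snd (fst (q n)), snd (q n)) (fst (fst l), snd l) < d"
        using l2 d unfolding same by (rule tendstoD)
      ultimately have "\<forall>\<^sub>F n in sequentially. False"
      proof eventually_elim
        case (elim n)
        have "q n \<in> Z" using q by blast
        then show ?case using inj[OF _ _ elim] by (auto simp: Z_def Z0_def)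
      qed
      then show False by simp
    qed
    then show "l \<in> Z" using m1 m2 by (simp add: Z_def)
  qed
  moreover have "((x, y), s) \<in> Z" using ne eq by (auto simp: Z_def Z0_def Reg_def b_def v_def)
  moreover have "\<exists>\<epsilon> p'. 0 < \<epsilon> \<and> t + \<epsilon> \<le> s + c1 \<and> (p', t + \<epsilon>) \<in> Z \<and> dist p' p \<le> (2 * C0) * \<epsilon>"
    if p: "(p, t) \<in> Z" and t: "s \<le> t" "t < s + c1" for p t
  proof -
    obtain y1 y2 where p12: "p = (y1, y2)" by (cases p)
    have m: "(y1, t) \<in> Reg b s" "(y2, t) \<in> Reg b s" "Y y1 t = v" "Y y2 t = v" "y1 \<noteq> y2"
      using p by (auto simp: Z_def Z0_def p12)
    obtain \<eta>1 where \<eta>1: "\<eta>1 > 0" "\<And>\<epsilon>. 0 < \<epsilon> \<Longrightarrow> \<epsilon> < \<eta>1 \<Longrightarrow> \<exists>y'. (y', t + \<epsilon>) \<in> Reg b s \<and> Y y' (t + \<epsilon>) = v \<and> dist y' y1 \<le> C0 * \<epsilon>"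
      using Y_step[OF m(1) s b m(3)] by blast
    obtain \<eta>2 where \<eta>2: "\<eta>2 > 0" "\<And>\<epsilon>. 0 < \<epsilon> \<Longrightarrow> \<epsilon> < \<eta>2 \<Longrightarrow> \<exists>y'. (y', t + \<epsilon>) \<in> Reg b s \<and> Y y' (t + \<epsilon>) = v \<and> dist y' y2 \<le> C0 * \<epsilon>"
      using Y_step[OF m(2) s b m(4)] by blast
    \<comment> \<open>Each point moves by at most \<open>C0 \<epsilon>\<close>, a quarter of their distance, so they stay distinct.\<close>
    define \<epsilon> where "\<epsilon> = Min {\<eta>1 / 2, \<eta>2 / 2, s + c1 - t, dist y1 y2 / (4 * C0)}"
    have \<epsilon>: "0 < \<epsilon>" "\<epsilon> < \<eta>1" "\<epsilon> < \<eta>2" "t + \<epsilon> \<le> s + c1" "\<epsilon> \<le> dist y1 y2 / (4 * C0)"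
      using \<eta>1(1) \<eta>2(1) t m(5) C0_pos by (auto simp: \<epsilon>_def)
    obtain z1 where z1: "(z1, t + \<epsilon>) \<in> Reg b s" "Y z1 (t + \<epsilon>) = v" "dist z1 y1 \<le> C0 * \<epsilon>" using \<eta>1(2) \<epsilon> by blast
    obtain z2 where z2: "(z2, t + \<epsilon>) \<in> Reg b s" "Y z2 (t + \<epsilon>) = v" "dist z2 y2 \<le> C0 * \<epsilon>" using \<eta>2(2) \<epsilon> by blast
    have "4 * (C0 * \<epsilon>) \<le> dist y1 y2" using \<epsilon>(5) C0_pos by (simp add: field_simps)
    moreover have "0 < dist y1 y2" using m(5) by simp
    moreover have "dist y1 y2 \<le> dist z1 y1 + dist z1 z2 + dist z2 y2"
      by (metis dist_commute dist_triangle add.commute add_left_mono order_trans dist_triangle2 add.assoc)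
    ultimately have "0 < dist z1 z2" using z1(3) z2(3) by linarith
    then have "z1 \<noteq> z2" by auto
    moreover have "dist (z1, z2) (y1, y2) \<le> dist z1 y1 + dist z2 y2"
      unfolding dist_Pair_Pair by (rule sqrt_sum_squares_le_sum) auto
    ultimately show ?thesis using \<epsilon> z1 z2
      by (intro exI[of _ \<epsilon>] exI[of _ "(z1, z2)"]) (auto simp: Z_def Z0_def p12 algebra_simps)
  qed
  ultimately obtain p where p: "(p, s + c1) \<in> Z"
    using forward_tracking[of Z "2 * C0" s "s + c1" "(x, y)"] C0_pos c1 by (metis add_increasing2 less_imp_le mult_2 order_refl add_nonneg_nonneg)
  obtain y1 y2 where p12: "p = (y1, y2)" by (cases p)
  have "(y1, s + c1) \<in> Reg b s" "(y2, s + c1) \<in> Reg b s" "Y y1 (s + c1) = Y y2 (s + c1)" "y1 \<noteq> y2"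
    using p by (auto simp: Z_def Z0_def p12)
  then show False
    using Y_injective_near0[of "s + c1" y1 y2] Reg_arrive(1)[of _ s b] b s c1 by auto
qed

definition CL :: real where "CL = 1 / (2 * cmod \<gamma>) + C0 * c1 + m1 * c1"

lemma CL0: "0 \<le> CL" using C0_pos c1 m1 by (simp add: CL_def)

text \<open>
  Moving forward for the fixed time \<open>c1\<close> changes \<open>y\<close> by at most \<open>C0 c1\<close>, leaves \<open>Y\<close> unchanged, and ends
  where \<open>|log N| \<le> 1/2\<close>.
\<close>

lemma Y_bound:
  assumes s: "0 \<le> s" "Re y \<le> - s" "Re y < 0"
  shows "cmod (Y y s - (y + of_real (m1 * s))) \<le> CL"
proof -
  obtain y' where y': "(y', s + c1) \<in> Reg (Re y) s" "Y y' (s + c1) = Y y s" "dist y' y \<le> C0 * (s + c1 - s)"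
    using Y_track[OF s, of "s + c1"] c1 by auto
  have "Y y s - (y + of_real (m1 * s)) = L (exp y', s + c1) / \<gamma> + ((y' - y) + of_real (m1 * c1))"
    unfolding y'(2)[symmetric] by (simp add: Y_def algebra_simps)
  also have "cmod \<dots> \<le> cmod (L (exp y', s + c1)) / cmod \<gamma> + (cmod (y' - y) + cmod (of_real (m1 * c1) :: complex))"
    by (intro norm_triangle_le add_mono order_refl) (auto simp: norm_divide intro: norm_triangle_ineq)
  also have "cmod (L (exp y', s + c1)) / cmod \<gamma> \<le> (1 / 2) / cmod \<gamma>"
    using Reg_arrive(2)[OF y'(1) s(2)] s c1 by (intro divide_right_mono L_near0(2)) auto
  also have "cmod (of_real (m1 * c1) :: complex) = m1 * c1" unfolding norm_of_real using m1(1) c1 by simp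
  finally show ?thesis using y'(3) by (simp add: CL_def dist_norm)
qed

lemma L_bound:
  assumes "(z, s) \<in> Dom"
  shows "cmod (L (z, s)) \<le> CL * cmod \<gamma>"
proof (cases "z = 0")
  case True
  then show ?thesis using L_near0(1)[of s 0] assms r0 CL0 by (simp add: Dom_def)
next
  case False
  define y where "y = Ln z"
  have z: "exp y = z" using False by (simp add: y_def)
  have s: "0 \<le> s" and zs: "cmod z \<le> exp (- s)" "cmod z < 1" using assms by (auto simp: Dom_def)
  have "exp (Re y) \<le> exp (- s)" "exp (Re y) < exp 0" using zs unfolding z[symmetric] by auto
  then have "Re y \<le> - s" "Re y < 0" by auto
  from Y_bound[OF s this] have "cmod (L (z, s) / \<gamma>) \<le> CL" by (simp add: Y_def z)
  then show ?thesis using \<gamma> by (simp add: norm_divide field_simps)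
qed

definition P :: "complex \<Rightarrow> real \<Rightarrow> complex" where "P z t = z * exp (of_real (m1 * t) + L (z, t) / \<gamma>)"
text \<open>
  Chosen such that the time derivative of \<open>P\<close> is \<open>z S\<close> and its derivative in \<open>z\<close> is \<open>S W\<close>.
\<close>

definition S :: "complex \<Rightarrow> real \<Rightarrow> complex" where "S z t = exp (of_real (m1 * t) + L (z, t) / \<gamma>) * D z t"

lemma P_exp: "P (exp y) t = exp (Y y t)"
  by (simp add: P_def Y_def exp_add mult_ac)

text \<open>
  The relation \<open>z P\<^sub>z = W P\<^sub>t\<close>, in a form that is meaningful at \<open>z = 0\<close> as well. Derivatives are taken within
  \<open>Dom\<close>, since the extension uses its boundary \<open>|z| = exp(-t)\<close>.
\<close>

lemma P_derivative:
  assumes p: "(z, t) \<in> Dom"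
  shows "((\<lambda>p. P (fst p) (snd p)) has_derivative (\<lambda>d. S z t * (W z t * fst d + z * of_real (snd d)))) (at (z, t) within Dom)"
proof -
  have z1: "cmod z < 1" using p by (simp add: Dom_def)
  have N0: "N z t \<noteq> 0" by (rule N_nonzero[OF p])
  have "((\<lambda>p. exp (L p)) has_derivative (\<lambda>d. N' z t * fst d + \<gamma> * of_real m1 * (h z - N z t) * of_real (snd d))) (at (z, t) within Dom)"
    by (rule has_derivative_transform[OF p _ N_derivative[OF z1]]) (use L(2) in auto)
  from has_derivative_logarithm[OF _ p this] L(1) p
  have dL: "(L has_derivative (\<lambda>d. (N' z t * fst d + \<gamma> * of_real m1 * (h z - N z t) * of_real (snd d)) / N z t)) (at (z, t) within Dom)"
    by (simp add: continuous_on_eq_continuous_within L(2)[OF p])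
  define l' where "l' = (\<lambda>d::complex \<times> real. of_real m1 * of_real (snd d) + (N' z t * fst d + \<gamma> * of_real m1 * (h z - N z t) * of_real (snd d)) / N z t * inverse \<gamma>)"
  have dl: "((\<lambda>p. of_real m1 * of_real (snd p) + L p * inverse \<gamma>) has_derivative l') (at (z, t) within Dom)"
    unfolding l'_def
    by (intro has_derivative_add has_derivative_mult_left has_derivative_mult_right dL has_derivative_of_real has_derivative_snd has_derivative_ident)
  have dexp: "(exp has_derivative (\<lambda>x. exp w * x)) (at w)" for w :: complex
    using DERIV_exp[of w] by (simp add: has_field_derivative_def)
  define X where "X = exp (of_real m1 * of_real t + L (z, t) * inverse \<gamma>)"
  have "((\<lambda>p. exp (of_real m1 * of_real (snd p) + L p * inverse \<gamma>)) has_derivative (\<lambda>d. X * l' d)) (at (z, t) within Dom)"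
    using has_derivative_compose[OF dl dexp] by (simp add: X_def)
  from has_derivative_mult[OF has_derivative_fst[OF has_derivative_ident] this]
  have "((\<lambda>p. fst p * exp (of_real m1 * of_real (snd p) + L p * inverse \<gamma>)) has_derivative (\<lambda>d. z * (X * l' d) + fst d * X)) (at (z, t) within Dom)"
    by (simp add: X_def)
  moreover have "z * (X * l' d) + fst d * X = S z t * (W z t * fst d + z * of_real (snd d))" for d
  proof -
    have "z * l' d + fst d = D z t * (W z t * fst d + z * of_real (snd d))"
    proof -
      have "z * l' d = z * of_real m1 * of_real (snd d) + ((z * N' z t) * fst d + \<gamma> * of_real m1 * (h z - N z t) * z * of_real (snd d)) / N z t * inverse \<gamma>"
        by (simp add: l'_def algebra_simps)
      also have "\<dots> = D z t * (W z t * fst d + z * of_real (snd d)) - fst d"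
        unfolding z_N'[OF z1, folded m1_def] D_def using N0 \<gamma> by (simp add: field_simps)
      finally show ?thesis by simp
    qed
    then have "X * (z * l' d + fst d) = X * (D z t * (W z t * fst d + z * of_real (snd d)))" by simp
    then show ?thesis by (simp add: S_def X_def divide_inverse algebra_simps)
  qed
  ultimately show ?thesis unfolding P_def by (simp add: divide_inverse)
qed

lemma continuous_P: "continuous_on Dom (\<lambda>p. P (fst p) (snd p))"
  using P_derivative has_derivative_continuous
  by (force simp: continuous_on_eq_continuous_within)

lemma continuous_S: "continuous_on Dom (\<lambda>p. S (fst p) (snd p))"
  unfolding S_def using L(1) \<gamma>
  by (intro continuous_intros continuous_D_W) auto

lemma P_lower:
  assumes "cmod z = exp (- t)" "0 < t"
  shows "exp (m * t - CL) \<le> cmod (P z t)"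
proof -
  have z: "z \<noteq> 0" using assms(1) by auto
  define y where "y = Ln z"
  have zy: "exp y = z" using z by (simp add: y_def)
  have Rey: "Re y = - t" using z assms by (simp add: y_def)
  have "\<bar>Re (Y y t - (y + of_real (m1 * t)))\<bar> \<le> CL"
    using Y_bound[of t y] Rey assms abs_Re_le_cmod order_trans by (metis less_imp_le neg_less_0_iff_less order_refl)
  then have "m * t - CL \<le> Re (Y y t)" using Rey by (simp add: m1_def algebra_simps)
  then show ?thesis using P_exp[of y t] by (simp add: zy)
qed

definition KS :: real where "KS = m1 * exp (CL + CL * cmod \<gamma>)"

lemma KS0: "0 \<le> KS" using m1 by (simp add: KS_def)

lemma S_bound:
  assumes p: "(z, t) \<in> Dom"
  shows "cmod (S z t) \<le> KS * exp (m1 * t) * cmod (h z)"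
proof -
  note Lb = L_bound[OF p]
  have "cmod (L (z, t) / \<gamma>) \<le> CL" using Lb \<gamma> by (simp add: norm_divide field_simps)
  then have "Re (L (z, t) / \<gamma>) \<le> CL" using complex_Re_le_cmod order_trans by blast
  then have 1: "cmod (exp (of_real (m1 * t) + L (z, t) / \<gamma>)) \<le> exp (m1 * t + CL)" by simp
  have "- (CL * cmod \<gamma>) \<le> Re (L (z, t))" using Lb abs_Re_le_cmod[of "L (z, t)"] by linarith
  then have "exp (- (CL * cmod \<gamma>)) \<le> cmod (N z t)" using L(2)[OF p] by (metis exp_le_cancel_iff norm_exp_eq_Re fst_conv snd_conv)
  then have "cmod (D z t) \<le> m1 * cmod (h z) / exp (- (CL * cmod \<gamma>))"
    unfolding D_def norm_divide norm_mult norm_of_real using m1(1) by (intro frac_le) auto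
  then have 2: "cmod (D z t) \<le> m1 * cmod (h z) * exp (CL * cmod \<gamma>)" by (simp add: exp_minus divide_inverse)
  have "cmod (S z t) \<le> exp (m1 * t + CL) * (m1 * cmod (h z) * exp (CL * cmod \<gamma>))"
    unfolding S_def norm_mult using 1 2 by (intro mult_mono) auto
  also have "\<dots> = KS * exp (m1 * t) * cmod (h z)" by (simp add: KS_def exp_add mult_ac)
  finally show ?thesis .
qed

definition \<kappa> :: real where "\<kappa> = 2 * k / (1 + k)"

lemma \<kappa>: "0 \<le> \<kappa>" "\<kappa> < 1" using k0 k1 by (auto simp: \<kappa>_def field_simps)

text \<open>
  To first order \<open>1 - e(t)\<close> is \<open>(m+1) \<gamma> t\<close>. The factor \<open>(1+k)/2\<close> lies strictly between \<open>k\<close> and \<open>1\<close>: some loss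
  has to be allowed, and \<open>k/((1+k)/2) = \<kappa>\<close> is still less than \<open>1\<close>.
\<close>

lemma one_minus_e_lower:
  obtains t1 where "0 < t1" "\<And>t. 0 < t \<Longrightarrow> t \<le> t1 \<Longrightarrow> (1 + k) / 2 * (m1 * cmod \<gamma> * t) \<le> cmod (1 - e t)"
proof -
  define \<epsilon> where "\<epsilon> = (1 - (1 + k) / 2) * (m1 * cmod \<gamma>)"
  have \<epsilon>: "0 < \<epsilon>" using k1 m1 \<gamma> by (simp add: \<epsilon>_def)
  have "(e has_derivative (\<lambda>d. d *\<^sub>R (- (of_real m1 * \<gamma>)))) (at 0)"
    using e_deriv[of 0 UNIV] by (simp add: has_vector_derivative_def m1_def)
  then obtain d where d: "d > 0" "\<And>t. norm (t - 0) < d \<Longrightarrow> norm (e t - e 0 - (t - 0) *\<^sub>R (- (of_real m1 * \<gamma>))) \<le> \<epsilon> * norm (t - 0)"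
    using \<epsilon> unfolding has_derivative_at_alt by blast
  show thesis
  proof (rule that[of "d / 2"])
    fix t :: real assume t: "0 < t" "t \<le> d / 2"
    have "cmod (e t - 1 + of_real t * (of_real m1 * \<gamma>)) \<le> \<epsilon> * t"
      using d(2)[of t] t d(1) by (simp add: scaleR_conv_of_real)
    moreover have "cmod (of_real t * (of_real m1 * \<gamma>)) \<le> cmod (1 - e t) + cmod (e t - 1 + of_real t * (of_real m1 * \<gamma>))"
      using norm_triangle_ineq[of "1 - e t" "e t - 1 + of_real t * (of_real m1 * \<gamma>)"] by simp
    moreover have "cmod (of_real t * (of_real m1 * \<gamma>)) = m1 * cmod \<gamma> * t"
      using t m1(1) by (simp add: norm_mult mult_ac)
    ultimately have "m1 * cmod \<gamma> * t - \<epsilon> * t \<le> cmod (1 - e t)" by linarith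
    then show "(1 + k) / 2 * (m1 * cmod \<gamma> * t) \<le> cmod (1 - e t)" by (simp add: \<epsilon>_def algebra_simps)
  qed (use d in simp)
qed

text \<open>
  Let \<open>|z| = exp(-t)\<close>. The bound on \<open>A\<close> and the size of \<open>1 - e(t)\<close> give \<open>|z h'/h| \<le> \<kappa>/t\<close> for small \<open>t\<close>, so that
  \<open>|h|\<^sup>2 t\<^sup>2\<^sup>\<kappa>\<close> is nondecreasing in \<open>t\<close> along radii.
\<close>

lemma h_growth:
  obtains C where "0 \<le> C" "\<And>z. cmod z < 1 \<Longrightarrow> cmod (h z) \<le> C * (1 - cmod z) powr (- \<kappa>)"
proof -
  obtain t1 where t1: "0 < t1" "\<And>t. 0 < t \<Longrightarrow> t \<le> t1 \<Longrightarrow> (1 + k) / 2 * (m1 * cmod \<gamma> * t) \<le> cmod (1 - e t)"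
    using one_minus_e_lower by blast
  have G: "cmod (z * deriv h z / h z) \<le> \<kappa> / t" if t: "0 < t" "t \<le> t1" and z: "cmod z = exp (- t)" for z t
  proof -
    have "cmod (A z t) \<le> cmod (A z t - of_real ((m - 1) / 2)) + cmod (of_real ((m - 1) / 2) :: complex)"
      by (metis norm_triangle_sub add.commute)
    also have "cmod (of_real ((m - 1) / 2) :: complex) = \<bar>m - 1\<bar> / 2" unfolding norm_of_real by simp
    finally have "cmod (A z t) \<le> k * m1" using A_bound[of t z] t z mk[folded m1_def] by (simp add: m1_def[symmetric])
    moreover have "cmod (A z t) = cmod (1 - e t) * cmod (z * deriv h z / h z) / cmod \<gamma>"
      by (simp add: A_def norm_mult norm_divide)
    ultimately have 1: "cmod (1 - e t) * cmod (z * deriv h z / h z) \<le> k * m1 * cmod \<gamma>" using \<gamma> by (simp add: field_simps)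
    have "(1 + k) / 2 * (m1 * cmod \<gamma> * t) * cmod (z * deriv h z / h z) \<le> cmod (1 - e t) * cmod (z * deriv h z / h z)"
      using t1(2)[OF t] by (intro mult_right_mono) auto
    also note 1
    finally have "(m1 * cmod \<gamma>) * ((1 + k) / 2 * t * cmod (z * deriv h z / h z)) \<le> (m1 * cmod \<gamma>) * k" by (simp add: mult_ac)
    moreover have "0 < m1 * cmod \<gamma>" using m1 \<gamma> by simp
    ultimately have "(1 + k) / 2 * t * cmod (z * deriv h z / h z) \<le> k" by (metis mult_le_cancel_left_pos)
    then have "cmod (z * deriv h z / h z) * ((1 + k) * t) \<le> 2 * k" by (simp add: mult_ac)
    moreover have "0 < (1 + k) * t" using t k0 by simp
    ultimately have "cmod (z * deriv h z / h z) \<le> 2 * k / ((1 + k) * t)" by (simp only: pos_le_divide_eq)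
    then show ?thesis by (simp add: \<kappa>_def)
  qed
  have "continuous_on (cball 0 (exp (- t1))) h"
  proof (intro holomorphic_on_imp_continuous_on holomorphic_on_subset[OF hol_h] subsetI)
    fix z assume "z \<in> cball (0::complex) (exp (- t1))"
    moreover have "exp (- t1) < 1" using t1(1) by simp
    ultimately show "z \<in> ball 0 1" unfolding mem_ball mem_cball by linarith
  qed
  then have "bounded (h ` cball 0 (exp (- t1)))" by (intro compact_imp_bounded compact_continuous_image) auto
  then obtain M where "\<forall>z\<in>cball 0 (exp (- t1)). cmod (h z) \<le> M" by (auto simp: bounded_iff)
  then have M: "cmod (h z) \<le> M" if "cmod z \<le> exp (- t1)" for z using that by simp
  have M0: "0 \<le> M" using M[of 0] by (simp add: h_0)
  have ray: "cmod (h z) * t powr \<kappa> \<le> M * t1 powr \<kappa>" if t: "0 < t" "t \<le> t1" and z: "cmod z = exp (- t)" for z t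
  proof -
    define w where "w = z * of_real (exp t)"
    have w: "cmod w = 1" using z by (simp add: w_def norm_mult exp_add[symmetric])
    define H where "H = (\<lambda>s. h (of_real (exp (- s)) * w))"
    \<comment> \<open>The logarithmic derivative of \<open>\<phi>\<close> is \<open>2 (\<kappa>/s - Re(\<zeta> h'/h))\<close>.\<close>
    define \<phi> where "\<phi> = (\<lambda>s. (H s \<bullet> H s) * (s powr \<kappa>)\<^sup>2)"
    have "\<phi> t \<le> \<phi> t1"
    proof (rule DERIV_nonneg_imp_nondecreasing[OF t(2)])
      fix s assume s: "t \<le> s" "s \<le> t1"
      then have s0: "0 < s" using t by simp
      define \<zeta> where "\<zeta> = of_real (exp (- s)) * w"
      have \<zeta>: "cmod \<zeta> = exp (- s)" using w by (simp add: \<zeta>_def norm_mult)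
      have \<zeta>1: "cmod \<zeta> < 1" using \<zeta> s0 by simp
      define g where "g = \<zeta> * deriv h \<zeta> / h \<zeta>"
      have dz: "((\<lambda>s. of_real (exp (- s)) * w) has_vector_derivative - \<zeta>) (at s)"
        unfolding \<zeta>_def by (auto intro!: derivative_eq_intros simp: has_vector_derivative_def scaleR_conv_of_real)
      have "(H has_vector_derivative - \<zeta> * deriv h \<zeta>) (at s)"
        unfolding H_def using field_vector_diff_chain_at[OF dz, of h "deriv h \<zeta>"] holomorphic_derivI[OF hol_h open_ball, of \<zeta>] \<zeta>1
        by (simp add: o_def \<zeta>_def)
      moreover have "- \<zeta> * deriv h \<zeta> = - g * H s" using h_nz[OF \<zeta>1] by (simp add: g_def H_def \<zeta>_def)
      ultimately have dH: "(H has_vector_derivative - g * H s) (at s)" by simp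
      have "((\<lambda>s. H s \<bullet> H s) has_derivative (\<lambda>x. H s \<bullet> (x *\<^sub>R (- g * H s)) + (x *\<^sub>R (- g * H s)) \<bullet> H s)) (at s)"
        using dH unfolding has_vector_derivative_def by (intro has_derivative_inner)
      moreover have "(\<lambda>x. H s \<bullet> (x *\<^sub>R (- g * H s)) + (x *\<^sub>R (- g * H s)) \<bullet> H s) = (*) (- 2 * Re g * (H s \<bullet> H s))"
        by (rule ext) (simp add: inner_complex_def algebra_simps)
      ultimately have d1: "((\<lambda>s. H s \<bullet> H s) has_real_derivative (- 2 * Re g * (H s \<bullet> H s))) (at s)"
        by (simp add: has_field_derivative_def)
      have d2: "((\<lambda>s. (s powr \<kappa>)\<^sup>2) has_real_derivative (2 * \<kappa> / s * (s powr \<kappa>)\<^sup>2)) (at s)"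
        using s0 by (auto intro!: derivative_eq_intros simp: power2_eq_square powr_diff)
      have "(\<phi> has_real_derivative (2 * (H s \<bullet> H s) * (s powr \<kappa>)\<^sup>2 * (\<kappa> / s - Re g))) (at s)"
        unfolding \<phi>_def using DERIV_mult[OF d1 d2] by (simp add: algebra_simps)
      moreover have "Re g \<le> \<kappa> / s"
        using G[OF s0 s(2) \<zeta>] complex_Re_le_cmod[of g] by (simp add: g_def)
      then have "0 \<le> 2 * (H s \<bullet> H s) * (s powr \<kappa>)\<^sup>2 * (\<kappa> / s - Re g)" by simp
      ultimately show "\<exists>y. (\<phi> has_real_derivative y) (at s) \<and> 0 \<le> y" by blast
    qed
    then have "(cmod (H t) * t powr \<kappa>)\<^sup>2 \<le> (cmod (H t1) * t1 powr \<kappa>)\<^sup>2"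
      by (simp add: \<phi>_def power_mult_distrib power2_norm_eq_inner)
    then have "cmod (H t) * t powr \<kappa> \<le> cmod (H t1) * t1 powr \<kappa>"
      by (rule power2_le_imp_le) simp
    also have "cmod (H t1) \<le> M" unfolding H_def using w by (intro M) (simp add: norm_mult)
    then have "cmod (H t1) * t1 powr \<kappa> \<le> M * t1 powr \<kappa>" by (intro mult_right_mono) auto
    moreover have "H t = h z" by (simp add: H_def w_def mult.left_commute exp_minus field_simps)
    ultimately show ?thesis by simp
  qed
  define C where "C = M + M * t1 powr \<kappa>"
  show thesis
  proof (rule that[of C])
    show "0 \<le> C" using M0 by (simp add: C_def)
    fix z assume z: "cmod z < 1"
    show "cmod (h z) \<le> C * (1 - cmod z) powr (- \<kappa>)"
    proof (cases "cmod z \<le> exp (- t1)")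
      case True
      have "1 \<le> (1 - cmod z) powr (- \<kappa>)"
        using powr_mono2'[of "-\<kappa>" "1 - cmod z" 1] z \<kappa> by simp
      then have "M * 1 \<le> M * (1 - cmod z) powr (- \<kappa>)" using M0 by (intro mult_left_mono)
      also have "\<dots> \<le> C * (1 - cmod z) powr (- \<kappa>)" using M0 by (intro mult_right_mono) (auto simp: C_def)
      finally show ?thesis using M[OF True] by simp
    next
      case False
      define t where "t = - ln (cmod z)"
      have z0: "0 < cmod z" using False by (metis exp_gt_zero less_trans not_le)
      have t: "cmod z = exp (- t)" using z0 by (simp add: t_def)
      have t0: "0 < t" "t \<le> t1" using False z unfolding t by auto
      have "1 - t \<le> exp (- t)" using exp_ge_add_one_self[of "- t"] by simp
      then have "1 - cmod z \<le> t" using t by simp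
      then have "t powr (- \<kappa>) \<le> (1 - cmod z) powr (- \<kappa>)" using z \<kappa> by (intro powr_mono2') auto
      moreover have "cmod (h z) \<le> (M * t1 powr \<kappa>) * t powr (- \<kappa>)"
        using ray[OF t0 t] t0 by (simp add: powr_minus field_simps)
      moreover have "(M * t1 powr \<kappa>) * t powr (- \<kappa>) \<le> C * t powr (- \<kappa>)"
        using M0 by (intro mult_right_mono) (auto simp: C_def)
      moreover have "C * t powr (- \<kappa>) \<le> C * (1 - cmod z) powr (- \<kappa>)"
        using calculation(1) M0 by (intro mult_left_mono) (auto simp: C_def)
      ultimately show ?thesis by linarith
    qed
  qed
qed

section \<open>Approximating homeomorphisms\<close>

definition mx :: "complex \<Rightarrow> real" where "mx z = max 1 (cmod z)"
definition zeta :: "real \<Rightarrow> complex \<Rightarrow> complex" where "zeta \<tau> z = of_real (exp (- \<tau>) / (mx z)\<^sup>2) * z"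
definition tm :: "real \<Rightarrow> complex \<Rightarrow> real" where "tm \<tau> z = \<tau> + ln (mx z)"
text \<open>
  For \<open>\<tau> > 0\<close> the chain is used from time \<open>\<tau>\<close> on: the closed unit disk is mapped by \<open>P\<close> at time \<open>\<tau>\<close>, on the disk
  \<open>|\<zeta>| \<le> exp(-\<tau>)\<close>, and the circle \<open>|z| = R > 1\<close> by the values of \<open>P\<close> at time \<open>\<tau> + ln R\<close> on \<open>|\<zeta>| = exp(-\<tau>)/R\<close>. All
  points used lie in the open unit disk, away from the boundary singularities of \<open>h\<close>; \<open>\<tau> = 0\<close> is the desired extension.
\<close>

definition PT :: "real \<Rightarrow> complex \<Rightarrow> complex" where "PT \<tau> z = P (zeta \<tau> z) (tm \<tau> z)"

lemma mx: "1 \<le> mx z" "cmod z \<le> mx z" "0 < mx z" by (auto simp: mx_def)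

lemma zeta_norm: "cmod (zeta \<tau> z) = exp (- tm \<tau> z) * (cmod z / mx z)"
proof -
  have "exp (- tm \<tau> z) = exp (- \<tau>) / mx z" using mx(3)[of z] by (simp add: tm_def exp_diff)
  then show ?thesis using mx(3)[of z]
    by (simp add: zeta_def norm_mult norm_divide power2_eq_square)
qed

lemma zeta_norm_gt: "1 \<le> cmod z \<Longrightarrow> cmod (zeta \<tau> z) = exp (- tm \<tau> z)"
  unfolding zeta_norm by (auto simp: mx_def)

lemma zeta_norm_le: "cmod (zeta \<tau> z) \<le> exp (- tm \<tau> z)"
proof -
  have "cmod z / mx z \<le> 1" using mx(2,3)[of z] by simp
  then have "exp (- tm \<tau> z) * (cmod z / mx z) \<le> exp (- tm \<tau> z) * 1" by (intro mult_left_mono) auto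
  then show ?thesis unfolding zeta_norm by simp
qed

lemma tm_ge: "\<tau> \<le> tm \<tau> z" using mx(1)[of z] by (simp add: tm_def)

lemma zeta_Dom:
  assumes "0 \<le> \<tau>" "0 < \<tau> \<or> cmod z \<noteq> 1"
  shows "(zeta \<tau> z, tm \<tau> z) \<in> Dom"
proof -
  have "cmod (zeta \<tau> z) < 1"
  proof (cases "0 < \<tau> \<or> 1 < cmod z")
    case True
    then have "0 < tm \<tau> z"
    proof
      assume "1 < cmod z"
      then have "0 < ln (cmod z)" using ln_gt_zero by blast
      with \<open>1 < cmod z\<close> have "0 < ln (mx z)" by (simp add: mx_def max_def)
      then show ?thesis using assms(1) by (simp add: tm_def)
    qed (use tm_ge[of \<tau> z] in simp)
    then show ?thesis using zeta_norm_le[of \<tau> z] by (meson exp_less_one_iff le_less_trans neg_less_0_iff_less)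
  next
    case False
    then show ?thesis using assms by (auto simp: zeta_def mx_def)
  qed
  then show ?thesis using zeta_norm_le[of \<tau> z] tm_ge[of \<tau> z] assms by (auto simp: Dom_def)
qed

lemma log_in_Dom:
  assumes "(z, t) \<in> Dom" "z \<noteq> 0"
  obtains y where "exp y = z" "Re y \<le> - t" "Re y < 0" "0 \<le> t"
proof -
  have "exp (Re (Ln z)) \<le> exp (- t)" "exp (Re (Ln z)) < exp 0"
    using assms by (auto simp: Dom_def)
  then have "Re (Ln z) \<le> - t" "Re (Ln z) < 0" unfolding exp_le_cancel_iff exp_less_cancel_iff .
  then show thesis using that[of "Ln z"] assms by (auto simp: Dom_def)
qed

lemma P_injective:
  assumes a: "(a, t) \<in> Dom" and b: "(b, t) \<in> Dom" and eq: "P a t = P b t"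
  shows "a = b"
proof (cases "a = 0 \<or> b = 0")
  case True
  then show ?thesis using eq by (auto simp: P_def)
next
  case False
  then obtain x y where x: "exp x = a" "Re x \<le> - t" "Re x < 0" "0 \<le> t" and y: "exp y = b" "Re y \<le> - t" "Re y < 0"
    using log_in_Dom[OF a] log_in_Dom[OF b] by metis
  have "exp (Y x t) = exp (Y y t)" using eq x y by (simp add: P_exp[symmetric])
  then obtain n :: int where n: "Y x t = Y y t + (of_int (2 * n) * pi) * \<i>" unfolding exp_eq by blast
  \<comment> \<open>Another logarithm of \<open>b\<close>, for which the values of \<open>Y\<close> agree exactly.\<close>
  define y' where "y' = y + (of_int (2 * n) * pi) * \<i>"
  have ey: "exp y' = exp y" unfolding y'_def exp_eq by blast
  then have "Y x t = Y y' t" using n by (simp add: Y_def) (simp add: y'_def)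
  moreover have "Re y' = Re y" by (simp add: y'_def)
  ultimately have "x = y'" using x y Y_injective[of t x y'] by simp
  then show ?thesis using x y ey by simp
qed

lemma P_track:
  assumes p: "(a, s) \<in> Dom" and T: "s < T"
  shows "\<exists>b. P b T = P a s \<and> (b, T) \<in> Dom \<and> cmod b < exp (- T)"
proof (cases "a = 0")
  case True
  then show ?thesis using p T by (intro exI[of _ 0]) (auto simp: P_def Dom_def)
next
  case False
  then obtain y where y: "exp y = a" "Re y \<le> - s" "Re y < 0" "0 \<le> s" using log_in_Dom[OF p] by metis
  obtain x where x: "(x, T) \<in> Reg (Re y) s" "Y x T = Y y s" using Y_track[OF y(4,2,3)] T by (meson less_imp_le)
  have "1 * (T - s) < c0 * (T - s)" using T c0_gt_1 by (intro mult_strict_right_mono) auto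
  moreover have "Re x \<le> Re y - c0 * (T - s)" using x(1) by (simp add: Reg_def)
  ultimately have "Re x < - T" using y(2) by (simp add: algebra_simps)
  moreover have "P (exp x) T = P a s" using x(2) y(1) by (metis P_exp)
  ultimately show ?thesis using T y(4) by (intro exI[of _ "exp x"]) (auto simp: Dom_def)
qed

text \<open>
  Points with the same time are separated by injectivity of \<open>P\<close> at that time. If the times
  differ, the later point \<open>b\<close> lies outside the unit circle, so \<open>|zeta \<tau> b| = exp(-tm \<tau> b)\<close>; moving the earlier
  point forward to the time of \<open>b\<close> puts it strictly inside the circle through \<open>zeta \<tau> b\<close>, and again injectivity
  separates them. For \<open>\<tau> = 0\<close> the unit circle is excluded because there \<open>zeta\<close> has modulus one, outside
  the domain of the chain.
\<close>

lemma PT_injective: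
  assumes \<tau>: "0 \<le> \<tau>"
  shows "inj_on (PT \<tau>) {z. 0 < \<tau> \<or> cmod z \<noteq> 1}"
proof -
  have lt: False if a: "0 < \<tau> \<or> cmod a \<noteq> 1" and b: "0 < \<tau> \<or> cmod b \<noteq> 1" and eq: "PT \<tau> a = PT \<tau> b" and lt: "tm \<tau> a < tm \<tau> b" for a b
  proof -
    have b1: "1 < cmod b"
    proof (rule ccontr)
      assume "\<not> 1 < cmod b"
      then have "tm \<tau> b = \<tau>" by (simp add: tm_def mx_def)
      then show False using lt tm_ge[of \<tau> a] by simp
    qed
    obtain c where c: "P c (tm \<tau> b) = PT \<tau> a" "(c, tm \<tau> b) \<in> Dom" "cmod c < exp (- tm \<tau> b)"
      using P_track[OF zeta_Dom[OF \<tau> a] lt] by (auto simp: PT_def)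
    have "c = zeta \<tau> b"
      by (rule P_injective[OF c(2) zeta_Dom[OF \<tau> b]]) (use c(1) eq in \<open>simp add: PT_def\<close>)
    then show False using c(3) zeta_norm_gt[of b \<tau>] b1 by simp
  qed
  show ?thesis
  proof (rule inj_onI)
    fix a b assume a: "a \<in> {z. 0 < \<tau> \<or> cmod z \<noteq> 1}" and b: "b \<in> {z. 0 < \<tau> \<or> cmod z \<noteq> 1}" and eq: "PT \<tau> a = PT \<tau> b"
    have t: "tm \<tau> a = tm \<tau> b" using lt[of a b] lt[of b a] a b eq by fastforce
    have "zeta \<tau> a = zeta \<tau> b"
    proof (rule P_injective[of _ "tm \<tau> a"])
      show "(zeta \<tau> a, tm \<tau> a) \<in> Dom" using a by (intro zeta_Dom \<tau>) simp
      show "(zeta \<tau> b, tm \<tau> a) \<in> Dom" unfolding t using b by (intro zeta_Dom \<tau>) simp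
      show "P (zeta \<tau> a) (tm \<tau> a) = P (zeta \<tau> b) (tm \<tau> a)" using eq t by (simp add: PT_def)
    qed
    moreover have "mx a = mx b" using t mx(3) by (simp add: tm_def)
    ultimately show "a = b" using mx(3)[of b] by (simp add: zeta_def)
  qed
qed

lemma continuous_zeta: "continuous_on UNIV (zeta \<tau>)" "continuous_on UNIV (tm \<tau>)"
proof -
  have mxn: "mx z \<noteq> 0" for z using mx(3)[of z] by simp
  have "continuous_on UNIV mx" unfolding mx_def by (intro continuous_intros)
  then show "continuous_on UNIV (zeta \<tau>)" "continuous_on UNIV (tm \<tau>)"
    unfolding zeta_def tm_def using mxn by (auto intro!: continuous_intros)
qed

lemma continuous_PT:
  assumes "0 \<le> \<tau>"
  shows "continuous_on {z. 0 < \<tau> \<or> cmod z \<noteq> 1} (PT \<tau>)"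
proof -
  have "continuous_on {z. 0 < \<tau> \<or> cmod z \<noteq> 1} (\<lambda>z. P (fst (zeta \<tau> z, tm \<tau> z)) (snd (zeta \<tau> z, tm \<tau> z)))"
    by (rule continuous_on_compose2[OF continuous_P])
      (use zeta_Dom[OF assms] in \<open>auto intro!: continuous_intros continuous_on_subset[OF continuous_zeta(1)] continuous_on_subset[OF continuous_zeta(2)]\<close>)
  then show ?thesis unfolding PT_def[abs_def] by simp
qed

lemma PT_lower:
  assumes "0 \<le> \<tau>" "1 < cmod z"
  shows "exp (- CL) * cmod z powr m \<le> cmod (PT \<tau> z)"
proof -
  have lnz: "ln (cmod z) > 0" using assms(2) by (rule ln_gt_zero)
  have t: "ln (cmod z) \<le> tm \<tau> z" using assms by (simp add: tm_def mx_def max_def)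
  have "cmod z powr m = exp (m * ln (cmod z))" using assms by (auto simp: powr_def)
  also have "exp (- CL) * \<dots> = exp (m * ln (cmod z) - CL)" by (simp add: exp_diff exp_minus field_simps)
  also have "\<dots> \<le> exp (m * tm \<tau> z - CL)" using t m by simp
  also have "\<dots> \<le> cmod (PT \<tau> z)" unfolding PT_def
    using assms t lnz by (intro P_lower zeta_norm_gt) auto
  finally show ?thesis .
qed

lemma proper_of_lower:
  assumes "\<And>z. 1 < cmod z \<Longrightarrow> exp (- CL) * cmod z powr m \<le> cmod (f z)"
  shows "\<exists>R. \<forall>z. R < cmod z \<longrightarrow> B < cmod (f z)"
proof -
  define R where "R = max 1 ((exp CL * max 1 B) powr (1 / m))"
  have "B < cmod (f z)" if "R < cmod z" for z
  proof -
    have "((exp CL * max 1 B) powr (1 / m)) powr m < cmod z powr m"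
      using that m by (intro powr_less_mono2) (auto simp: R_def)
    then have "exp CL * max 1 B < cmod z powr m" using m by (simp add: powr_powr)
    then have "exp (- CL) * (exp CL * max 1 B) < exp (- CL) * cmod z powr m" by simp
    moreover have "exp (- CL) * (exp CL * max 1 B) = max 1 B" by (simp add: mult.assoc[symmetric] exp_add[symmetric])
    ultimately show ?thesis using assms[of z] that by (simp add: R_def)
  qed
  then show ?thesis by blast
qed

lemma PT_homeomorphism:
  assumes "0 < \<tau>"
  shows "\<exists>g. homeomorphism UNIV UNIV (PT \<tau>) g"
proof (rule homeomorphism_of_injective_proper)
  have "{z::complex. 0 < \<tau> \<or> cmod z \<noteq> 1} = UNIV" using assms by simp
  then show "continuous_on UNIV (PT \<tau>)" "inj (PT \<tau>)"
    using PT_injective[of \<tau>] continuous_PT[of \<tau>] assms by simp_all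
  fix B
  have "exp (- CL) * cmod z powr m \<le> cmod (PT \<tau> z)" if "1 < cmod z" for z
    using PT_lower[of \<tau> z] that assms by simp
  then show "\<exists>R. \<forall>z. R < cmod z \<longrightarrow> B < cmod (PT \<tau> z)" by (rule proper_of_lower)
qed

text \<open>
  For \<open>0 < \<tau> \<le> 1\<close> the derivative in \<open>\<tau>\<close> is \<open>S \<zeta> (1 - W)\<close> at a point with \<open>1 - |\<zeta>| \<ge> \<tau>/2\<close>, hence at most a multiple of
  \<open>\<tau>\<^sup>-\<^sup>\<kappa>\<close>, uniformly in \<open>|z| \<le> R\<close>. As \<open>\<kappa> < 1\<close> this is integrable at \<open>0\<close>.
\<close>

lemma PT_cauchy:
  "\<exists>B\<ge>0. \<forall>z \<sigma> \<tau>. cmod z \<le> R \<and> 0 < \<sigma> \<and> \<sigma> \<le> \<tau> \<and> \<tau> \<le> 1 \<longrightarrow>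
    cmod (PT \<tau> z - PT \<sigma> z) \<le> B * (\<tau> powr (1 - \<kappa>) - \<sigma> powr (1 - \<kappa>))"
proof -
  obtain C where C: "0 \<le> C" "\<And>z. cmod z < 1 \<Longrightarrow> cmod (h z) \<le> C * (1 - cmod z) powr (- \<kappa>)"
    using h_growth by blast
  define T where "T = 1 + ln (max 1 R)"
  define B0 where "B0 = KS * exp (m1 * T) * (C * 2 powr \<kappa>) * 2"
  have B0: "0 \<le> B0" unfolding B0_def using KS0 C(1) by simp
  define B where "B = B0 / (1 - \<kappa>)"
  have key: "cmod (PT \<tau> z - PT \<sigma> z) \<le> B * (\<tau> powr (1 - \<kappa>) - \<sigma> powr (1 - \<kappa>))"
    if z: "cmod z \<le> R" and \<sigma>\<tau>: "0 < \<sigma>" "\<sigma> \<le> \<tau>" "\<tau> \<le> 1" for z \<sigma> \<tau>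
  proof (cases "\<sigma> = \<tau>")
    case False
    then have lt: "\<sigma> < \<tau>" using \<sigma>\<tau> by simp
    define V where "V = (\<lambda>x. S (zeta x z) (tm x z) * (W (zeta x z) (tm x z) * (- zeta x z) + zeta x z))"
    have der: "((\<lambda>x. PT x z) has_vector_derivative V x) (at x)" if x: "0 < x" for x
    proof -
      have dz: "((\<lambda>x. (zeta x z, tm x z)) has_derivative (\<lambda>d. (- of_real d * zeta x z, d))) (at x within {0<..})"
      proof (rule has_derivative_Pair)
        show "((\<lambda>x. tm x z) has_derivative (\<lambda>d. d)) (at x within {0<..})"
          unfolding tm_def by (auto intro!: derivative_eq_intros)
        have "((\<lambda>x. exp (- x) / (mx z)\<^sup>2) has_real_derivative (- exp (- x) / (mx z)\<^sup>2)) (at x within {0<..})"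
          using mx(3)[of z] by (auto intro!: derivative_eq_intros simp: power2_eq_square)
        then have "((\<lambda>x. of_real (exp (- x) / (mx z)\<^sup>2) * z) has_vector_derivative (of_real (- exp (- x) / (mx z)\<^sup>2) * z)) (at x within {0<..})"
          by (intro has_vector_derivative_mult_left has_vector_derivative_of_real) (simp add: has_real_derivative_iff_has_vector_derivative)
        then show "((\<lambda>x. zeta x z) has_derivative (\<lambda>d. - of_real d * zeta x z)) (at x within {0<..})"
          unfolding has_vector_derivative_def zeta_def by (simp add: scaleR_conv_of_real mult_ac)
      qed
      have "((\<lambda>p. P (fst p) (snd p)) has_derivative (\<lambda>d. S (zeta x z) (tm x z) * (W (zeta x z) (tm x z) * fst d + zeta x z * of_real (snd d))))
         (at (zeta x z, tm x z) within (\<lambda>x. (zeta x z, tm x z)) ` {0<..})"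
        by (rule has_derivative_subset[OF P_derivative]) (use x zeta_Dom in auto)
      from has_derivative_in_compose[OF dz this]
      have "((\<lambda>x. PT x z) has_derivative (\<lambda>d. d *\<^sub>R V x)) (at x within {0<..})"
        unfolding PT_def V_def by (simp add: scaleR_conv_of_real algebra_simps)
      then have "((\<lambda>x. PT x z) has_vector_derivative V x) (at x within {0<..})" by (simp add: has_vector_derivative_def)
      then show ?thesis using x at_within_open[of x "{0<..}"] by simp
    qed
    have bnd: "cmod (V x) \<le> B0 * x powr (- \<kappa>)" if x: "0 < x" "x \<le> 1" for x
    proof -
      define \<zeta> where "\<zeta> = zeta x z"
      define t where "t = tm x z"
      have Dm: "(\<zeta>, t) \<in> Dom" unfolding \<zeta>_def t_def using x by (intro zeta_Dom) auto
      have z1: "cmod \<zeta> < 1" using Dm by (simp add: Dom_def)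
      have t: "x \<le> t" "t \<le> T"
      proof -
        show "x \<le> t" unfolding t_def by (rule tm_ge)
        have "mx z \<le> max 1 R" using z by (simp add: mx_def)
        then show "t \<le> T" unfolding t_def tm_def T_def using x mx(3)[of z] by (intro add_mono ln_mono) auto
      qed
      have "cmod \<zeta> \<le> exp (- t)" using Dm by (simp add: Dom_def)
      also have "\<dots> \<le> exp (- x)" using t by simp
      also have "\<dots> \<le> 1 / (1 + x)"
        using x exp_ge_add_one_self[of x] by (simp add: exp_minus inverse_eq_divide frac_le)
      finally have "x / 2 \<le> 1 - cmod \<zeta>"
      proof -
        assume "cmod \<zeta> \<le> 1 / (1 + x)"
        moreover have "1 / (1 + x) \<le> 1 - x / 2"
        proof -
          have "(1 - x / 2) * (1 + x) = 1 + x * (1 - x) / 2" by (simp add: field_simps)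
          moreover have "0 \<le> x * (1 - x)" using x by simp
          ultimately show ?thesis using x by (simp add: pos_divide_le_eq)
        qed
        ultimately show ?thesis by linarith
      qed
      then have "(1 - cmod \<zeta>) powr (- \<kappa>) \<le> (x / 2) powr (- \<kappa>)" using x \<kappa> by (intro powr_mono2') auto
      also have "\<dots> = 2 powr \<kappa> * x powr (- \<kappa>)" using x by (simp add: powr_divide powr_minus field_simps)
      finally have "C * (1 - cmod \<zeta>) powr (- \<kappa>) \<le> C * (2 powr \<kappa> * x powr (- \<kappa>))" using C(1) by (rule mult_left_mono)
      with C(2)[OF z1] have hb: "cmod (h \<zeta>) \<le> C * 2 powr \<kappa> * x powr (- \<kappa>)" by simp
      have "exp (m1 * t) \<le> exp (m1 * T)" using t m1 by simp
      then have "KS * exp (m1 * t) * cmod (h \<zeta>) \<le> KS * exp (m1 * T) * (C * 2 powr \<kappa> * x powr (- \<kappa>))"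
        using hb KS0 by (intro mult_mono) auto
      with S_bound[OF Dm] have Sb: "cmod (S \<zeta> t) \<le> KS * exp (m1 * T) * (C * 2 powr \<kappa> * x powr (- \<kappa>))" by linarith
      have "cmod (W \<zeta> t) \<le> 1" using Dm by (intro disk_half(5) W_bound) (auto simp: Dom_def)
      then have "cmod (W \<zeta> t * (- \<zeta>) + \<zeta>) \<le> 1 * 1 + 1"
        using z1 by (intro norm_triangle_le add_mono) (auto simp: norm_mult intro!: mult_le_one)
      then have "cmod (S \<zeta> t * (W \<zeta> t * (- \<zeta>) + \<zeta>)) \<le> (KS * exp (m1 * T) * (C * 2 powr \<kappa> * x powr (- \<kappa>))) * (1 * 1 + 1)"
        unfolding norm_mult using Sb KS0 C(1) by (intro mult_mono) auto
      then show ?thesis by (simp add: V_def \<zeta>_def t_def B0_def mult_ac)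
    qed
    \<comment> \<open>Compare with \<open>B x\<^sup>1\<^sup>-\<^sup>\<kappa>\<close>, whose derivative is \<open>B0 x\<^sup>-\<^sup>\<kappa>\<close>.\<close>
    have "norm (PT \<tau> z - PT \<sigma> z) \<le> B * \<tau> powr (1 - \<kappa>) - B * \<sigma> powr (1 - \<kappa>)"
    proof (rule differentiable_bound_general[OF lt])
      show "continuous_on {\<sigma>..\<tau>} (\<lambda>x. PT x z)"
      proof (intro continuous_at_imp_continuous_on ballI)
        fix x assume "x \<in> {\<sigma>..\<tau>}"
        then show "isCont (\<lambda>x. PT x z) x" using \<sigma>\<tau> has_vector_derivative_continuous[OF der[of x]] by simp
      qed
      show "continuous_on {\<sigma>..\<tau>} (\<lambda>x. B * x powr (1 - \<kappa>))" using \<sigma>\<tau> by (intro continuous_intros) auto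
      fix x assume x: "\<sigma> < x" "x < \<tau>"
      then show "((\<lambda>x. PT x z) has_vector_derivative V x) (at x)" using \<sigma>\<tau> by (intro der) simp
      have "((\<lambda>x. B * x powr (1 - \<kappa>)) has_real_derivative B * ((1 - \<kappa>) * x powr (1 - \<kappa> - 1))) (at x)"
        using x \<sigma>\<tau> by (intro DERIV_cmult has_real_derivative_powr) auto
      moreover have "B * ((1 - \<kappa>) * x powr (1 - \<kappa> - 1)) = B0 * x powr (- \<kappa>)" using \<kappa> by (simp add: B_def)
      ultimately have "((\<lambda>x. B * x powr (1 - \<kappa>)) has_real_derivative B0 * x powr (- \<kappa>)) (at x)" by (simp only:)
      then show "((\<lambda>x. B * x powr (1 - \<kappa>)) has_vector_derivative B0 * x powr (- \<kappa>)) (at x)"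
        by (simp add: has_real_derivative_iff_has_vector_derivative)
      show "norm (V x) \<le> B0 * x powr (- \<kappa>)" using x \<sigma>\<tau> by (intro bnd) auto
    qed
    then show ?thesis by (simp add: algebra_simps)
  qed simp
  show ?thesis using B0 \<kappa> key by (intro exI[of _ B]) (auto simp: B_def)
qed

section \<open>The quasiconformal extension\<close>

definition step_time :: "nat \<Rightarrow> real" where "step_time n = 1 / real (Suc n)"
definition Ext :: "complex \<Rightarrow> complex" where "Ext z = lim (\<lambda>n. PT (step_time n) z)"

lemma step_time: "0 < step_time n" "step_time n \<le> 1" "step_time \<longlonglongrightarrow> 0"
  unfolding step_time_def using LIMSEQ_inverse_real_of_nat by (auto simp: inverse_eq_divide)

lemma uniform_limit_Ext: "uniform_limit (cball 0 R) (\<lambda>n. PT (step_time n)) Ext sequentially"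
proof -
  obtain B where B: "0 \<le> B" "\<And>z \<sigma> \<tau>. cmod z \<le> R \<Longrightarrow> 0 < \<sigma> \<Longrightarrow> \<sigma> \<le> \<tau> \<Longrightarrow> \<tau> \<le> 1 \<Longrightarrow>
    cmod (PT \<tau> z - PT \<sigma> z) \<le> B * (\<tau> powr (1 - \<kappa>) - \<sigma> powr (1 - \<kappa>))"
    using PT_cauchy[of R] by blast
  have "(\<lambda>n. B * step_time n powr (1 - \<kappa>)) \<longlonglongrightarrow> B * 0 powr (1 - \<kappa>)"
    using step_time \<kappa> by (intro tendsto_intros) (auto intro!: eventuallyI less_imp_le)
  then have lim0: "(\<lambda>n. B * step_time n powr (1 - \<kappa>)) \<longlonglongrightarrow> 0" using \<kappa> by simp
  have "uniformly_Cauchy_on (cball 0 R) (\<lambda>n. PT (step_time n))"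
  proof (rule uniformly_Cauchy_onI')
    fix \<epsilon> :: real assume "0 < \<epsilon>"
    from order_tendstoD(2)[OF lim0 this] obtain M where M: "\<And>n. M \<le> n \<Longrightarrow> B * step_time n powr (1 - \<kappa>) < \<epsilon>"
      by (auto simp: eventually_sequentially)
    have "dist (PT (step_time i) z) (PT (step_time n) z) < \<epsilon>" if "z \<in> cball 0 R" "M \<le> i" "i < n" for z i n
    proof -
      have "step_time n \<le> step_time i" using that by (simp add: step_time_def frac_le)
      then have "cmod (PT (step_time i) z - PT (step_time n) z) \<le> B * (step_time i powr (1 - \<kappa>) - step_time n powr (1 - \<kappa>))"
        using that step_time by (intro B(2)) auto
      also have "\<dots> \<le> B * step_time i powr (1 - \<kappa>)" using B(1) by (intro mult_left_mono) auto
      also have "\<dots> < \<epsilon>" using M that by simp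
      finally show ?thesis by (simp add: dist_norm)
    qed
    then show "\<exists>M. \<forall>x\<in>cball 0 R. \<forall>i\<ge>M. \<forall>n>i. dist (PT (step_time i) x) (PT (step_time n) x) < \<epsilon>" by blast
  qed
  then have "uniformly_convergent_on (cball 0 R) (\<lambda>n. PT (step_time n))"
    by (rule Cauchy_uniformly_convergent)
  then show ?thesis unfolding uniformly_convergent_uniform_limit_iff Ext_def[abs_def] .
qed

lemma PT_tendsto_Ext: "(\<lambda>n. PT (step_time n) z) \<longlonglongrightarrow> Ext z"
  by (rule tendsto_uniform_limitI[OF uniform_limit_Ext[of "cmod z"]]) simp

lemma continuous_PT_time:
  assumes "cmod z \<noteq> 1"
  shows "continuous_on {0..} (\<lambda>\<tau>. PT \<tau> z)"
proof -
  have "continuous_on {0..} (\<lambda>\<tau>. P (fst (zeta \<tau> z, tm \<tau> z)) (snd (zeta \<tau> z, tm \<tau> z)))"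
    by (rule continuous_on_compose2[OF continuous_P])
      (use zeta_Dom[of _ z] assms mx(3)[of z] in \<open>auto simp: zeta_def[abs_def] tm_def[abs_def] intro!: continuous_intros\<close>)
  then show ?thesis by (simp add: PT_def)
qed

lemma Ext_eq: 
  assumes "cmod z \<noteq> 1"
  shows "Ext z = PT 0 z"
proof -
  have "(\<lambda>n. PT (step_time n) z) \<longlonglongrightarrow> PT 0 z"
    using step_time by (intro continuous_on_tendsto_compose[OF continuous_PT_time[OF assms]]) (auto intro!: eventuallyI less_imp_le)
  then show ?thesis using PT_tendsto_Ext LIMSEQ_unique by blast
qed

lemma Ext_in: "cmod z < 1 \<Longrightarrow> Ext z = P z 0"
  by (simp add: Ext_eq PT_def zeta_def tm_def mx_def)

lemma Ext_out:
  assumes "1 < cmod z"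
  shows "Ext z = P (1 / cnj z) (ln (cmod z))"
proof -
  have "z \<noteq> 0" using assms by auto
  moreover have "(of_real (cmod z))\<^sup>2 = z * cnj z" by (metis complex_norm_square of_real_power)
  ultimately have "z / (of_real (cmod z))\<^sup>2 = 1 / cnj z" by simp
  then show ?thesis using assms by (simp add: Ext_eq PT_def zeta_def tm_def mx_def max_def)
qed

lemma continuous_Ext: "continuous_on UNIV Ext"
proof -
  have "isCont Ext z" for z
  proof -
    have "continuous_on (cball 0 (cmod z + 1)) Ext"
    proof (rule uniform_limit_theorem[OF _ uniform_limit_Ext])
      have "continuous_on UNIV (PT (step_time n))" for n
        using continuous_PT[of "step_time n"] step_time(1)[of n] by simp
      then show "\<forall>\<^sub>F n in sequentially. continuous_on (cball 0 (cmod z + 1)) (PT (step_time n))"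
        by (intro always_eventually allI) (rule continuous_on_subset, auto)
    qed simp
    moreover have "z \<in> interior (cball 0 (cmod z + 1))" by simp
    ultimately show ?thesis by (rule continuous_on_interior)
  qed
  then show ?thesis by (simp add: continuous_on_eq_continuous_at)
qed

lemma Ext_proper: "\<exists>R. \<forall>z. R < cmod z \<longrightarrow> B < cmod (Ext z)"
  using PT_lower[of 0] Ext_eq by (intro proper_of_lower) auto

lemma Ext_inj_off_circle: "inj_on Ext {z. cmod z \<noteq> 1}"
  using PT_injective[of 0] by (simp add: inj_on_def Ext_eq)

lemma P0_derivative:
  assumes "cmod z < 1"
  shows "((\<lambda>z. P z 0) has_field_derivative S z 0 * W z 0) (at z)"
proof -
  have 1: "((\<lambda>z. (z, 0::real)) has_derivative (\<lambda>d. (d, 0))) (at z within ball 0 1)" by (auto intro!: derivative_eq_intros)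
  have "((\<lambda>p. P (fst p) (snd p)) has_derivative (\<lambda>d. S z 0 * (W z 0 * fst d + z * of_real (snd d)))) (at (z, 0) within (\<lambda>z. (z, 0)) ` ball 0 1)"
    by (rule has_derivative_subset[OF P_derivative]) (use assms in \<open>auto simp: Dom_def\<close>)
  from has_derivative_in_compose[OF 1 this]
  have "((\<lambda>z. P z 0) has_derivative (\<lambda>d. S z 0 * (W z 0 * d))) (at z within ball 0 1)" by simp
  moreover have "(\<lambda>d. S z 0 * (W z 0 * d)) = (*) (S z 0 * W z 0)" by (auto simp: mult.assoc)
  ultimately show ?thesis using at_within_open[of z "ball 0 1"] assms by (simp add: has_field_derivative_def)
qed

lemma hol_P0: "(\<lambda>z. P z 0) holomorphic_on ball 0 1"
proof -
  have "\<exists>d. ((\<lambda>z. P z 0) has_field_derivative d) (at z)" if "z \<in> ball 0 1" for z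
    using P0_derivative[of z] that by auto
  then show ?thesis by (simp add: holomorphic_on_open)
qed

text \<open>
  A fibre is compact and connected, as \<open>Ext\<close> is a limit of homeomorphisms. If it meets the
  complement of the circle, it does so in one point, which is then isolated in the fibre and so is
  the whole fibre. Otherwise it lies in the circle and cannot have two points.
\<close>

lemma Ext_injective: "inj Ext"
proof (rule injI)
  fix a b assume eq: "Ext a = Ext b"
  define F where "F = {z. Ext z = Ext a}"
  have "closed F"
    using continuous_closed_preimage_constant[OF continuous_Ext closed_UNIV, of "Ext a"] by (simp add: F_def)
  moreover have "bounded F"
  proof -
    obtain R where R: "\<And>z. R < cmod z \<Longrightarrow> cmod (Ext a) < cmod (Ext z)" using Ext_proper by blast
    then have "F \<subseteq> cball 0 R" by (force simp: F_def not_less[symmetric])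
    then show ?thesis by (rule bounded_subset[OF bounded_cball])
  qed
  ultimately have cF: "compact F" by (simp add: compact_eq_bounded_closed)
  have "\<forall>n. \<exists>g. homeomorphism UNIV UNIV (PT (step_time n)) g"
    using PT_homeomorphism[OF step_time(1)] by blast
  then obtain g where g: "\<And>n. homeomorphism UNIV UNIV (PT (step_time n)) (g n)" by metis
  have conn: "connected F"
    unfolding F_def using cF[unfolded F_def] 
    by (rule connected_fibre_of_limit_of_homeomorphisms[OF g uniform_limit_Ext continuous_Ext])
  have aF: "a \<in> F" and bF: "b \<in> F" using eq by (auto simp: F_def)
  show "a = b"
  proof (cases "F \<subseteq> sphere 0 1")
    case True
    show ?thesis
    proof (rule boundary_values_not_constant_on_continuum[where w = "Ext a", OF _ _ _ conn True _ aF bF])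
      show "continuous_on (cball 0 1) Ext" by (rule continuous_on_subset[OF continuous_Ext]) auto
      show "Ext holomorphic_on ball 0 1"
        by (rule holomorphic_transform[OF hol_P0]) (simp add: Ext_in)
      show "inj_on Ext (ball 0 1)" by (rule inj_on_subset[OF Ext_inj_off_circle]) auto
    qed (simp add: F_def)
  next
    case False
    then have "\<exists>c\<in>F. cmod c \<noteq> 1" by (auto simp: subset_iff)
    then obtain c where c: "c \<in> F" "cmod c \<noteq> 1" by blast
    have only: "x = c" if "x \<in> F" "cmod x \<noteq> 1" for x
      using inj_onD[OF Ext_inj_off_circle, of x c] that c by (auto simp: F_def)
    have "F \<subseteq> {c} \<union> sphere 0 1" using only by auto
    moreover have "{c} \<inter> sphere 0 1 \<inter> F = {}" using c by auto
    ultimately have "{c} \<inter> F = {} \<or> sphere 0 1 \<inter> F = {}"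
      by (intro connected_closedD[OF conn]) auto
    then have "sphere 0 1 \<inter> F = {}" using c(1) by blast
    then have "cmod x \<noteq> 1" if "x \<in> F" for x using that by (auto simp: disjoint_iff)
    then show ?thesis using only aF bF by blast
  qed
qed

text \<open>
  The derivatives of \<open>Ext\<close> with respect to \<open>z\<close> and to \<open>cnj z\<close> off the circle; on the circle, a null set,
  the value is \<open>0\<close>.
\<close>

definition Ep :: "complex \<Rightarrow> complex" where
  "Ep z = (if cmod z < 1 then S z 0 * W z 0
           else if cmod z = 1 then 0
           else S (1 / cnj z) (ln (cmod z)) * (1 / cnj z) / (2 * z))"
definition Eq :: "complex \<Rightarrow> complex" where
  "Eq z = (if cmod z \<le> 1 then 0
           else S (1 / cnj z) (ln (cmod z)) * (1 / cnj z) * (1 / 2 - W (1 / cnj z) (ln (cmod z))) / cnj z)"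

lemma out_Dom:
  assumes z: "1 < cmod z"
  shows "(1 / cnj z, ln (cmod z)) \<in> Dom"
proof -
  have pos: "0 < cmod z" using z by (rule less_trans[OF zero_less_one])
  then have "1 / cmod z < 1" using z by (simp only: pos_divide_less_eq mult_1)
  moreover from exp_ln[OF pos] have "exp (- ln (cmod z)) = 1 / cmod z" by (simp add: exp_minus inverse_eq_divide)
  ultimately show ?thesis using ln_gt_zero[OF z] by (simp add: Dom_def norm_divide)
qed

text \<open>
  Outside the disk \<open>\<zeta> = 1/cnj z\<close> and \<open>t = ln|z|\<close>, so \<open>d\<zeta> = -\<zeta> cnj(dz)/cnj z\<close> and \<open>dt = (dz/z + cnj(dz)/cnj z)/2\<close>; insert
  this in \<open>dP = S (W d\<zeta> + \<zeta> dt)\<close>.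
\<close>

lemma Ext_derivative:
  assumes "cmod z \<noteq> 1"
  shows "(Ext has_derivative (\<lambda>v. Ep z * v + Eq z * cnj v)) (at z)"
proof (cases "cmod z < 1")
  case True
  have "((\<lambda>z. P z 0) has_derivative (\<lambda>v. Ep z * v + Eq z * cnj v)) (at z)"
    using P0_derivative[OF True] True by (simp add: has_field_derivative_def Ep_def Eq_def)
  then show ?thesis
    by (rule has_derivative_transform_within_open[of _ _ _ _ "ball 0 1"]) (use True Ext_in in auto)
next
  case False
  then have z: "1 < cmod z" using assms by linarith
  then have z0: "z \<noteq> 0" by auto
  define U where "U = {z::complex. 1 < cmod z}"
  have oU: "open U" unfolding U_def by (intro open_Collect_less continuous_intros)
  define \<zeta> where "\<zeta> = 1 / cnj z"
  define t where "t = ln (cmod z)"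
  have d1: "((\<lambda>z. 1 / cnj z) has_derivative (\<lambda>v. - \<zeta> * cnj v / cnj z)) (at z within U)"
    unfolding \<zeta>_def using z0 by (auto intro!: derivative_eq_intros simp: power2_eq_square field_simps)
  have "(cmod has_derivative (\<lambda>v. z \<bullet> v / cmod z)) (at z within U)"
  proof -
    have "(\<lambda>v. v \<bullet> sgn z) = (\<lambda>v. z \<bullet> v / cmod z)"
      by (auto simp: sgn_div_norm divide_inverse inner_commute)
    then show ?thesis using has_derivative_at_withinI[OF has_derivative_norm[OF z0], of U] by simp
  qed
  then have d2: "((\<lambda>z. ln (cmod z)) has_derivative (\<lambda>v. (z \<bullet> v / cmod z) / cmod z)) (at z within U)"
    using z0 by (auto intro!: derivative_eq_intros simp: divide_inverse)
  have re: "of_real ((z \<bullet> v / cmod z) / cmod z) = (v / z + cnj v / cnj z) / 2" for v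
  proof -
    have "(z * cnj z) * ((v / z + cnj v / cnj z) / 2) = (cnj z * v + z * cnj v) / 2" using z0 by (simp add: field_simps)
    also have "\<dots> = of_real (z \<bullet> v)" by (simp add: complex_eq_iff inner_complex_def)
    finally have "of_real ((cmod z)\<^sup>2) * ((v / z + cnj v / cnj z) / 2) = of_real (z \<bullet> v)"
      unfolding complex_norm_square .
    then show ?thesis using z0 by (simp add: power2_eq_square field_simps)
  qed
  have "((\<lambda>p. P (fst p) (snd p)) has_derivative (\<lambda>d. S \<zeta> t * (W \<zeta> t * fst d + \<zeta> * of_real (snd d)))) (at (\<zeta>, t) within (\<lambda>z. (1 / cnj z, ln (cmod z))) ` U)"
    by (rule has_derivative_subset[OF P_derivative]) (use out_Dom z in \<open>auto simp: \<zeta>_def t_def U_def\<close>)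
  from has_derivative_in_compose[OF has_derivative_Pair[OF d1 d2] this[unfolded \<zeta>_def t_def]]
  have "((\<lambda>z. P (1 / cnj z) (ln (cmod z))) has_derivative (\<lambda>v. S \<zeta> t * (W \<zeta> t * (- \<zeta> * cnj v / cnj z) + \<zeta> * of_real ((z \<bullet> v / cmod z) / cmod z)))) (at z within U)"
    by (simp add: \<zeta>_def t_def)
  moreover have "S \<zeta> t * (W \<zeta> t * (- \<zeta> * cnj v / cnj z) + \<zeta> * of_real ((z \<bullet> v / cmod z) / cmod z)) = Ep z * v + Eq z * cnj v" for v
    unfolding re Ep_def Eq_def using z by (simp add: \<zeta>_def[symmetric] t_def[symmetric] algebra_simps add_divide_distrib diff_divide_distrib)
  ultimately have "((\<lambda>z. P (1 / cnj z) (ln (cmod z))) has_derivative (\<lambda>v. Ep z * v + Eq z * cnj v)) (at z within U)" by simp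
  then have "((\<lambda>z. P (1 / cnj z) (ln (cmod z))) has_derivative (\<lambda>v. Ep z * v + Eq z * cnj v)) (at z)"
    using at_within_open[OF _ oU, of z] z by (simp add: U_def)
  then show ?thesis
    by (rule has_derivative_transform_within_open[OF _ oU]) (use z Ext_out in \<open>auto simp: U_def\<close>)
qed

text \<open>
  Outside the disk the quotient of moduli is \<open>|1 - 2W|\<close>.
\<close>

lemma Eq_le_Ep: "cmod (Eq z) \<le> k * cmod (Ep z)"
proof (cases "1 < cmod z")
  case True
  have "cmod (1 / 2 - W (1 / cnj z) (ln (cmod z))) \<le> k / 2"
    using W_bound[of "ln (cmod z)" "1 / cnj z"] out_Dom[OF True] by (auto simp: Dom_def norm_minus_commute)
  then have "cmod (S (1 / cnj z) (ln (cmod z)) * (1 / cnj z) / cnj z) * cmod (1 / 2 - W (1 / cnj z) (ln (cmod z)))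
    \<le> cmod (S (1 / cnj z) (ln (cmod z)) * (1 / cnj z) / cnj z) * (k / 2)"
    by (intro mult_left_mono) auto
  then show ?thesis using True by (simp add: Eq_def Ep_def norm_mult norm_divide mult_ac)
qed (use k0 in \<open>simp add: Eq_def\<close>)

lemma continuous_Ep_Eq: "continuous_on (- sphere 0 1) Ep" "continuous_on (- sphere 0 1) Eq"
proof -
  define U where "U = {z::complex. 1 < cmod z}"
  have oU: "open U" unfolding U_def by (intro open_Collect_less continuous_intros)
  have un: "- sphere 0 1 = ball 0 1 \<union> U" by (auto simp: U_def)
  have cin: "continuous_on (ball 0 1) (\<lambda>z. S z 0)" "continuous_on (ball 0 1) (\<lambda>z. W z 0)"
  proof -
    have c: "continuous_on (ball 0 1) (\<lambda>z::complex. (z, 0::real))" by (intro continuous_intros)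
    have i: "(\<lambda>z. (z, 0)) ` ball 0 1 \<subseteq> Dom" by (auto simp: Dom_def)
    show "continuous_on (ball 0 1) (\<lambda>z. S z 0)" "continuous_on (ball 0 1) (\<lambda>z. W z 0)"
      using continuous_on_compose2[OF continuous_S c i] continuous_on_compose2[OF continuous_D_W(2) c i] by simp_all
  qed
  have cmap: "continuous_on U (\<lambda>z. (1 / cnj z, ln (cmod z)))" unfolding U_def by (intro continuous_intros) auto
  have sub: "(\<lambda>z. (1 / cnj z, ln (cmod z))) ` U \<subseteq> Dom" using out_Dom by (auto simp: U_def)
  have cout: "continuous_on U (\<lambda>z. S (1 / cnj z) (ln (cmod z)))" "continuous_on U (\<lambda>z. W (1 / cnj z) (ln (cmod z)))"
    using continuous_on_compose2[OF continuous_S cmap sub] continuous_on_compose2[OF continuous_D_W(2) cmap sub] by auto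
  have "continuous_on (ball 0 1) Ep"
    using continuous_on_mult[OF cin] by (rule continuous_on_eq) (simp add: Ep_def)
  moreover have "continuous_on U (\<lambda>z. S (1 / cnj z) (ln (cmod z)) * (1 / cnj z) / (2 * z))"
    by (intro continuous_intros cout) (auto simp: U_def)
  then have "continuous_on U Ep" by (rule continuous_on_eq) (simp add: Ep_def U_def)
  ultimately show "continuous_on (- sphere 0 1) Ep" unfolding un by (intro continuous_on_open_Un oU) auto
  have "continuous_on (ball (0::complex) 1) (\<lambda>z. 0::complex)" by simp
  then have "continuous_on (ball 0 1) Eq" by (rule continuous_on_eq) (simp add: Eq_def)
  moreover have "continuous_on U (\<lambda>z. S (1 / cnj z) (ln (cmod z)) * (1 / cnj z) * (1 / 2 - W (1 / cnj z) (ln (cmod z))) / cnj z)"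
    by (intro continuous_intros cout) (auto simp: U_def)
  then have "continuous_on U Eq" by (rule continuous_on_eq) (simp add: Eq_def U_def)
  ultimately show "continuous_on (- sphere 0 1) Eq" unfolding un by (intro continuous_on_open_Un oU) auto
qed

lemma Ep_bound: "\<exists>C. \<forall>z. cmod z \<le> R \<and> cmod z \<noteq> 1 \<longrightarrow> cmod (Ep z) \<le> C * \<bar>1 - cmod z\<bar> powr (- \<kappa>)"
proof -
  obtain C where C: "0 \<le> C" "\<And>z. cmod z < 1 \<Longrightarrow> cmod (h z) \<le> C * (1 - cmod z) powr (- \<kappa>)"
    using h_growth by blast
  define R' where "R' = max 1 R"
  define B where "B = KS * exp (m1 * ln R') * (C * R' powr \<kappa>)"
  have "cmod (Ep z) \<le> B * \<bar>1 - cmod z\<bar> powr (- \<kappa>)" if z: "cmod z \<le> R" "cmod z \<noteq> 1" for z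
  proof -
    have main: "KS * exp (m1 * t) * cmod (h \<zeta>) \<le> B * \<bar>1 - cmod z\<bar> powr (- \<kappa>)"
      if t: "t \<le> ln R'" and \<zeta>: "cmod \<zeta> < 1" "\<bar>1 - cmod z\<bar> / R' \<le> 1 - cmod \<zeta>" for t \<zeta>
    proof -
      have pos: "0 < \<bar>1 - cmod z\<bar> / R'" using z by (simp add: R'_def)
      have "(1 - cmod \<zeta>) powr (- \<kappa>) \<le> (\<bar>1 - cmod z\<bar> / R') powr (- \<kappa>)"
        using pos \<zeta> \<kappa> by (intro powr_mono2') auto
      also have "\<dots> = R' powr \<kappa> * \<bar>1 - cmod z\<bar> powr (- \<kappa>)"
        by (simp add: powr_divide powr_minus R'_def field_simps)
      finally have "C * (1 - cmod \<zeta>) powr (- \<kappa>) \<le> C * (R' powr \<kappa> * \<bar>1 - cmod z\<bar> powr (- \<kappa>))" using C(1) by (rule mult_left_mono)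
      with C(2)[OF \<zeta>(1)] have hb: "cmod (h \<zeta>) \<le> C * R' powr \<kappa> * \<bar>1 - cmod z\<bar> powr (- \<kappa>)" by simp
      have "exp (m1 * t) \<le> exp (m1 * ln R')" using t m1 by simp
      then have "KS * exp (m1 * t) * cmod (h \<zeta>) \<le> KS * exp (m1 * ln R') * (C * R' powr \<kappa> * \<bar>1 - cmod z\<bar> powr (- \<kappa>))"
        using hb KS0 by (intro mult_mono) auto
      then show ?thesis by (simp add: B_def mult_ac)
    qed
    show ?thesis
    proof (cases "cmod z < 1")
      case True
      then have Dm: "(z, 0) \<in> Dom" by (simp add: Dom_def)
      have W1: "cmod (W z 0) \<le> 1" using True by (intro disk_half(5) W_bound) auto
      have "cmod (Ep z) \<le> (KS * exp (m1 * 0) * cmod (h z)) * 1"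
      proof -
        have "cmod (S z 0) * cmod (W z 0) \<le> (KS * exp (m1 * 0) * cmod (h z)) * 1"
          by (rule mult_mono[OF S_bound[OF Dm] W1]) (use KS0 in auto)
        then show ?thesis using True by (simp add: Ep_def norm_mult)
      qed
      also have "\<bar>1 - cmod z\<bar> / R' \<le> \<bar>1 - cmod z\<bar> / 1" by (intro divide_left_mono) (auto simp: R'_def)
      then have "KS * exp (m1 * 0) * cmod (h z) \<le> B * \<bar>1 - cmod z\<bar> powr (- \<kappa>)"
        using True by (intro main) (auto simp: R'_def)
      finally show ?thesis by simp
    next
      case False
      then have z1: "1 < cmod z" using z by simp
      note Dm = out_Dom[OF z1]
      have "cmod (Ep z) = cmod (S (1 / cnj z) (ln (cmod z))) * (1 / (cmod z * (2 * cmod z)))"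
        using z1 by (simp add: Ep_def norm_mult norm_divide)
      also have "\<dots> \<le> cmod (S (1 / cnj z) (ln (cmod z))) * 1"
      proof (intro mult_left_mono)
        have "1 * 1 \<le> cmod z * (2 * cmod z)" using z1 by (intro mult_mono) auto
        then show "1 / (cmod z * (2 * cmod z)) \<le> 1" using z1 by simp
      qed auto
      also have "\<dots> \<le> KS * exp (m1 * ln (cmod z)) * cmod (h (1 / cnj z))" using S_bound[OF Dm] by simp
      also have "\<dots> \<le> B * \<bar>1 - cmod z\<bar> powr (- \<kappa>)"
      proof (rule main)
        show "ln (cmod z) \<le> ln R'" using z z1 by (intro ln_mono) (auto simp: R'_def)
        show "cmod (1 / cnj z) < 1" using Dm by (simp add: Dom_def)
        have "(cmod z - 1) / R' \<le> (cmod z - 1) / cmod z" using z z1 less_trans[OF zero_less_one z1] by (intro frac_le) (auto simp: R'_def)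
        also have "\<dots> = 1 - cmod (1 / cnj z)" using z1 by (auto simp: norm_divide diff_divide_distrib)
        finally show "\<bar>1 - cmod z\<bar> / R' \<le> 1 - cmod (1 / cnj z)" using z1 by simp
      qed
      finally show ?thesis .
    qed
  qed
  then show ?thesis by blast
qed

theorem quasiconformal_extension: "has_quasiconformal_extension (\<lambda>z. P z 0)"
  unfolding has_quasiconformal_extension_def
proof (intro exI conjI)
  show "0 \<le> k" "k < 1" using k0 k1 .
  obtain g where g: "homeomorphism UNIV UNIV Ext g"
    using homeomorphism_of_injective_proper[OF continuous_Ext Ext_injective Ext_proper] by blast
  then show "surj Ext" by (simp add: homeomorphism_def)
  have bq: "\<exists>C. \<forall>z. cmod z \<le> R \<and> cmod z \<noteq> 1 \<longrightarrow> cmod (Eq z) \<le> C * \<bar>1 - cmod z\<bar> powr (- \<kappa>)" for R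
  proof -
    obtain C where C: "\<And>z. cmod z \<le> R \<Longrightarrow> cmod z \<noteq> 1 \<Longrightarrow> cmod (Ep z) \<le> C * \<bar>1 - cmod z\<bar> powr (- \<kappa>)"
      using Ep_bound[of R] by blast
    have "cmod (Eq z) \<le> (k * C) * \<bar>1 - cmod z\<bar> powr (- \<kappa>)" if "cmod z \<le> R" "cmod z \<noteq> 1" for z
      using Eq_le_Ep[of z] mult_left_mono[OF C[OF that] k0] by (simp add: mult_ac)
    then show ?thesis by blast
  qed
  have zero: "Ep z = 0" "Eq z = 0" if "cmod z = 1" for z using that by (simp_all add: Ep_def Eq_def)
  note weak = weak_derivatives_off_circle[OF continuous_Ext Ext_derivative continuous_Ep_Eq zero \<kappa> Ep_bound bq]
  show "quasiconformal_on k UNIV Ext"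
    unfolding quasiconformal_on_def
  proof (intro conjI exI)
    show "homeomorphism UNIV (range Ext) Ext g" using g \<open>surj Ext\<close> by simp
    show "weak_d_z UNIV Ext Ep" by (rule weak(1))
    show "weak_d_zbar UNIV Ext Eq" by (rule weak(2))
    show "AE z in lebesgue. z \<in> UNIV \<longrightarrow> cmod (Eq z) \<le> k * cmod (Ep z)" using Eq_le_Ep by simp
  qed simp
  show "\<forall>z\<in>unit_disk. Ext z = P z 0" by (simp add: unit_disk_def Ext_in)
qed

lemma P0_germ:
  "\<forall>\<^sub>F z in nhds 0. P z 0 = z * exp (Ln (h2 z) / \<gamma>)"
proof -
  have "\<forall>\<^sub>F z in nhds (0::complex). z \<in> ball 0 r0"
    using r0 by (intro eventually_nhds_in_open) auto
  then show ?thesis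
  proof eventually_elim
    case (elim z)
    then have "L (z, 0) = Ln (N z 0)" by (intro L_near0) auto
    then show ?case by (simp add: P_def N_def)
  qed
qed

end

section \<open>The integral operator\<close>

lemma power_series_zero_bound:
  fixes c :: "nat \<Rightarrow> complex"
  assumes sm: "\<And>z. cmod z < 1 \<Longrightarrow> summable (\<lambda>n. c n * z ^ n)" and zero: "\<And>n. n < N \<Longrightarrow> c n = 0"
  shows "\<exists>M\<ge>0. \<forall>z. cmod z \<le> 1 / 2 \<longrightarrow> cmod (\<Sum>n. c n * z ^ n) \<le> M * cmod z ^ N"
proof -
  have "summable (\<lambda>n. norm (c n * (1 / 2) ^ n))"
    by (rule powser_insidea[OF sm[of "3 / 4"]]) auto
  then have "summable (\<lambda>n. norm (c (n + N) * (1 / 2) ^ (n + N)))" by (rule summable_ignore_initial_segment)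
  then have "summable (\<lambda>n. 2 ^ N * norm (c (n + N) * (1 / 2) ^ (n + N)))" by (rule summable_mult)
  moreover have "2 ^ N * norm (c (n + N) * (1 / 2) ^ (n + N)) = norm (c (n + N)) * (1 / 2) ^ n" for n
    by (simp add: norm_mult norm_power norm_divide power_add power_divide)
  ultimately have sM: "summable (\<lambda>n. norm (c (n + N)) * (1 / 2) ^ n)" by simp
  define M where "M = (\<Sum>n. norm (c (n + N)) * (1 / 2) ^ n)"
  have "cmod (\<Sum>n. c n * z ^ n) \<le> M * cmod z ^ N" if z: "cmod z \<le> 1 / 2" for z
  proof -
    have bound: "norm (c (n + N) * z ^ n) \<le> norm (c (n + N)) * (1 / 2) ^ n" for n
      unfolding norm_mult norm_power using z by (intro mult_left_mono power_mono) auto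
    have s1: "summable (\<lambda>n. norm (c (n + N) * z ^ n))"
      by (rule summable_comparison_test'[OF sM, of 0]) (use bound in auto)
    have "(\<Sum>n. c n * z ^ n) = (\<Sum>n. c (n + N) * z ^ (n + N))"
      using suminf_split_initial_segment[OF sm[of z], of N] z zero by simp
    also have "\<dots> = (\<Sum>n. c (n + N) * z ^ n * z ^ N)" by (simp add: power_add mult.assoc)
    also have "\<dots> = (\<Sum>n. c (n + N) * z ^ n) * z ^ N"
      using suminf_mult2[OF summable_norm_cancel[OF s1], of "z ^ N"] by simp
    finally have "cmod (\<Sum>n. c n * z ^ n) = cmod (\<Sum>n. c (n + N) * z ^ n) * cmod z ^ N" by (simp add: norm_mult norm_power)
    also have "cmod (\<Sum>n. c (n + N) * z ^ n) \<le> (\<Sum>n. norm (c (n + N) * z ^ n))" by (rule summable_norm[OF s1])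
    also have "\<dots> \<le> M" unfolding M_def using bound s1 sM by (intro suminf_le) auto
    finally show ?thesis by (simp add: mult_right_mono)
  qed
  moreover have "0 \<le> M" unfolding M_def using sM by (intro suminf_nonneg) auto
  ultimately show ?thesis by blast
qed

text \<open>
  Comparing coefficients in \<open>z h2' = \<gamma> (h - h2)\<close> gives \<open>b\<^sub>n = \<gamma> a\<^sub>n/(n + \<gamma>)\<close>. A vanishing denominator means
  \<open>n = -Re \<gamma> < c\<close>, in which case \<open>a\<^sub>n\<close> vanishes. Both \<open>h2 - h\<close> and \<open>h2 - 1\<close> have a zero of order
  \<open>N \<ge> c\<close> at the origin.
\<close>

lemma power_averaging_ode_solution:
  fixes h :: "complex \<Rightarrow> complex" and \<gamma> :: complex and c :: real
  assumes hol: "h holomorphic_on ball 0 1" and h0: "h 0 = 1" and \<gamma>: "\<gamma> \<noteq> 0"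
    and c: "Re \<gamma> < 0 \<Longrightarrow> - Re \<gamma> < c"
    and vanish: "\<And>n. 1 \<le> n \<Longrightarrow> real n < c \<Longrightarrow> (deriv ^^ n) h 0 = 0"
  obtains h2 N M where "h2 holomorphic_on ball 0 1" "h2 0 = 1"
    "\<And>z. cmod z < 1 \<Longrightarrow> z * deriv h2 z = \<gamma> * (h z - h2 z)"
    "1 \<le> N" "c \<le> real N" "0 \<le> M"
    "\<And>z. cmod z \<le> 1 / 2 \<Longrightarrow> cmod (h2 z - h z) \<le> M * cmod z ^ N"
    "\<And>z. cmod z \<le> 1 / 2 \<Longrightarrow> cmod (h2 z - 1) \<le> M * cmod z ^ N"
proof -
  define a where "a = (\<lambda>n. (deriv ^^ n) h 0 / fact n)"
  define b where "b = (\<lambda>n. if n = 0 then 1 else \<gamma> * a n / (of_nat n + \<gamma>))"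
  have a0: "a 0 = 1" by (simp add: a_def h0)
  have sa: "(\<lambda>n. a n * z ^ n) sums h z" if "cmod z < 1" for z
    using holomorphic_power_series[OF hol, of z] that by (simp add: a_def)
  have coeff: "of_nat n * b n = \<gamma> * (a n - b n)" for n
  proof (cases "n = 0")
    case False
    show ?thesis
    proof (cases "of_nat n + \<gamma> = 0")
      case True
      then have "Re (of_nat n + \<gamma>) = 0" by simp
      then have "Re \<gamma> = - real n" by simp
      then have "real n < c" using c False by auto
      then have "a n = 0" using vanish[of n] False by (simp add: a_def)
      then show ?thesis using False by (simp add: b_def)
    next
      case nz: False
      have "b n * (of_nat n + \<gamma>) = \<gamma> * a n" using False nz by (simp add: b_def)
      then show ?thesis by (simp add: algebra_simps)
    qed
  qed (simp add: b_def a0)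
  have "(\<lambda>n. \<gamma> / (of_nat n + \<gamma>)) \<longlonglongrightarrow> 0"
    by (intro tendsto_divide_0[OF tendsto_const] tendsto_add_filterlim_at_infinity'[OF tendsto_of_nat tendsto_const])
  then have "Bseq (\<lambda>n. \<gamma> / (of_nat n + \<gamma>))" by (intro convergent_imp_Bseq) (auto simp: convergent_def)
  then obtain C where C: "C > 0" "\<And>n. cmod (\<gamma> / (of_nat n + \<gamma>)) \<le> C" by (auto simp: Bseq_def)
  have b_le: "cmod (b n) \<le> (C + 1) * cmod (a n)" for n
  proof (cases "n = 0")
    case True then show ?thesis using C(1) by (simp add: b_def a0)
  next
    case False
    have "cmod (b n) = cmod (\<gamma> / (of_nat n + \<gamma>)) * cmod (a n)" using False by (simp add: b_def norm_mult norm_divide)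
    also have "\<dots> \<le> (C + 1) * cmod (a n)" using C(2)[of n] by (intro mult_right_mono) auto
    finally show ?thesis .
  qed
  have sb: "summable (\<lambda>n. b n * z ^ n)" if z: "cmod z < 1" for z
  proof -
    obtain r where r: "cmod z < r" "r < 1" using z dense by blast
    have "0 \<le> r" using r norm_ge_zero[of z] by linarith
    then have "summable (\<lambda>n. norm (a n * z ^ n))"
      using r by (intro powser_insidea[OF sums_summable[OF sa[of "of_real r"]]]) auto
    then have "summable (\<lambda>n. (C + 1) * norm (a n * z ^ n))" by (rule summable_mult)
    then show ?thesis
    proof (rule summable_comparison_test'[of _ 0])
      fix n
      show "norm (b n * z ^ n) \<le> (C + 1) * norm (a n * z ^ n)"
        using mult_right_mono[OF b_le[of n], of "cmod z ^ n"] by (simp add: norm_mult norm_power mult.assoc)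
    qed
  qed
  define h2 where "h2 = (\<lambda>z. \<Sum>n. b n * z ^ n)"
  have dh2: "(h2 has_field_derivative (\<Sum>n. diffs b n * z ^ n)) (at z)" if "cmod z < 1" for z
    unfolding h2_def using termdiffs_strong'[of 1 b z] sb that by simp
  have ode: "z * deriv h2 z = \<gamma> * (h z - h2 z)" if z: "cmod z < 1" for z
  proof -
    have "summable (\<lambda>n. diffs b n * z ^ n)"
      using termdiff_converges[of z 1 b] sb z by simp
    from diffs_equiv[OF this] have "(\<lambda>n. z * (of_nat n * b n * z ^ (n - Suc 0))) sums (z * deriv h2 z)"
      using DERIV_imp_deriv[OF dh2[OF z]] by (simp add: sums_mult)
    moreover have "z * (of_nat n * b n * z ^ (n - Suc 0)) = \<gamma> * (a n * z ^ n - b n * z ^ n)" for n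
    proof -
      have "z * (of_nat n * b n * z ^ (n - Suc 0)) = (of_nat n * b n) * z ^ n" by (cases n) auto
      then show ?thesis by (simp add: coeff algebra_simps)
    qed
    ultimately have "(\<lambda>n. \<gamma> * (a n * z ^ n - b n * z ^ n)) sums (z * deriv h2 z)" by simp
    moreover have "(\<lambda>n. \<gamma> * (a n * z ^ n - b n * z ^ n)) sums (\<gamma> * (h z - h2 z))"
      unfolding h2_def using sb[OF z] by (intro sums_mult sums_diff sa[OF z]) (simp add: summable_sums)
    ultimately show ?thesis by (rule sums_unique2)
  qed
  define N where "N = nat \<lceil>max 1 c\<rceil>"
  have N: "1 \<le> N" "c \<le> real N" unfolding N_def by linarith+
  have az: "a n = 0" if "n < N" "n \<noteq> 0" for n
  proof -
    have "real n < max 1 c" using that unfolding N_def by linarith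
    then have "real n < c" using that(2) by auto
    then show ?thesis using vanish[of n] that by (simp add: a_def)
  qed
  obtain M1 where M1: "0 \<le> M1" "\<And>z. cmod z \<le> 1 / 2 \<Longrightarrow> cmod (\<Sum>n. (b n - a n) * z ^ n) \<le> M1 * cmod z ^ N"
  proof -
    have "summable (\<lambda>n. (b n - a n) * z ^ n)" if "cmod z < 1" for z
      using summable_diff[OF sb[OF that] sums_summable[OF sa[OF that]]] by (simp add: algebra_simps)
    moreover have "b n - a n = 0" if "n < N" for n using az[OF that] by (auto simp: b_def a0)
    ultimately show thesis using power_series_zero_bound[of "\<lambda>n. b n - a n" N] that by blast
  qed
  define b' where "b' = (\<lambda>n. if n = 0 then 0 else b n)"
  have b'_sums: "(\<lambda>n. b' n * z ^ n) sums (h2 z - 1)" if z: "cmod z < 1" for z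
  proof -
    have "(\<lambda>n. b n * z ^ n - (if n = 0 then 1 else 0)) sums (h2 z - 1)"
      unfolding h2_def using sb[OF z] sums_single[of 0 "\<lambda>_. 1::complex"] by (intro sums_diff) (auto simp: summable_sums)
    moreover have "b n * z ^ n - (if n = 0 then 1 else 0) = b' n * z ^ n" for n by (simp add: b'_def b_def)
    ultimately show ?thesis by simp
  qed
  obtain M2 where M2: "0 \<le> M2" "\<And>z. cmod z \<le> 1 / 2 \<Longrightarrow> cmod (\<Sum>n. b' n * z ^ n) \<le> M2 * cmod z ^ N"
  proof -
    have "b' n = 0" if "n < N" for n using az[OF that] by (auto simp: b'_def b_def)
    then obtain M2 where "0 \<le> M2" "\<forall>z. cmod z \<le> 1 / 2 \<longrightarrow> cmod (\<Sum>n. b' n * z ^ n) \<le> M2 * cmod z ^ N"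
      using power_series_zero_bound[OF sums_summable[OF b'_sums], of N] by blast
    then show thesis using that by blast
  qed
  show thesis
  proof (rule that[of h2 N "M1 + M2"])
    have "\<exists>d. (h2 has_field_derivative d) (at z)" if "z \<in> ball 0 1" for z using dh2[of z] that by auto
    then show "h2 holomorphic_on ball 0 1" by (simp add: holomorphic_on_open)
    show "h2 0 = 1" by (simp add: h2_def b_def)
    show "1 \<le> N" "c \<le> real N" "0 \<le> M1 + M2" using N M1 M2 by auto
    fix z :: complex assume z: "cmod z \<le> 1 / 2"
    then have z1: "cmod z < 1" by simp
    have "(\<lambda>n. b n * z ^ n - a n * z ^ n) sums (h2 z - h z)"
      unfolding h2_def using sb[OF z1] by (intro sums_diff sa[OF z1]) (simp add: summable_sums)
    then have "h2 z - h z = (\<Sum>n. (b n - a n) * z ^ n)" by (simp add: sums_iff algebra_simps)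
    then have "cmod (h2 z - h z) \<le> M1 * cmod z ^ N" using M1(2)[OF z] by simp
    also have "\<dots> \<le> (M1 + M2) * cmod z ^ N" using M2(1) by (intro mult_right_mono) auto
    finally show "cmod (h2 z - h z) \<le> (M1 + M2) * cmod z ^ N" .
    have "cmod (h2 z - 1) \<le> M2 * cmod z ^ N" using M2(2)[OF z] b'_sums[OF z1] by (simp add: sums_iff)
    also have "\<dots> \<le> (M1 + M2) * cmod z ^ N" using M1(1) by (intro mult_right_mono) auto
    finally show "cmod (h2 z - 1) \<le> (M1 + M2) * cmod z ^ N" .
  qed (use ode in auto)
qed

text \<open>
  The function \<open>u\<^sup>\<gamma> (h2(u) - s)\<close> is a primitive of \<open>\<gamma> u\<^sup>\<gamma>\<^sup>-\<^sup>1 (h(u) - s)\<close> along the ray, and the bound makes it tend to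
  \<open>0\<close> at the origin. For \<open>s = 0\<close> this needs \<open>Re \<gamma> > 0\<close>; the case \<open>s = 1\<close> is the one
  for the remaining \<open>\<gamma>\<close>.
\<close>

lemma power_weighted_contour_integral:
  fixes h h2 :: "complex \<Rightarrow> complex" and \<gamma> s z :: complex
  assumes hol: "h2 holomorphic_on ball 0 1"
    and ode: "\<And>u. cmod u < 1 \<Longrightarrow> u * deriv h2 u = \<gamma> * (h u - h2 u)"
    and z: "z \<noteq> 0" "cmod z < 1" and \<sigma>: "0 < \<sigma>"
    and bound: "\<And>u. u \<noteq> 0 \<Longrightarrow> cmod u \<le> cmod z \<Longrightarrow> cmod (h2 u - s) \<le> C * cmod u powr (\<sigma> - Re \<gamma>)"
  shows "((\<lambda>u. \<gamma> * (u powr (\<gamma> - 1) * (h u - s))) has_contour_integral (z powr \<gamma> * (h2 z - s))) (linepath 0 z)"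
proof -
  \<comment> \<open>With \<open>u = x z\<close>, \<open>p\<close> is \<open>u\<^sup>\<gamma>\<close> and \<open>\<Psi>\<close> the primitive.\<close>
  define p where "p = (\<lambda>x::real. exp (\<gamma> * (of_real (ln x) + Ln z)))"
  define \<Psi> where "\<Psi> = (\<lambda>x::real. if x = 0 then 0 else p x * (h2 (of_real x * z) - s))"
  have lnx: "Ln (of_real x * z) = of_real (ln x) + Ln z" if "0 < x" for x :: real
    using Ln_times_of_real[of x z] Ln_of_real[of x] that z by simp
  have powr_eq: "(of_real x * z) powr a = exp (a * (of_real (ln x) + Ln z))" if "0 < x" for x :: real and a
    using lnx[OF that] that z by (simp add: powr_def)
  have xz: "cmod (of_real x * z) < 1" "cmod (of_real x * z) \<le> cmod z" if "x \<in> {0..1}" for x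
  proof -
    have "\<bar>x\<bar> * cmod z \<le> 1 * cmod z" using that by (intro mult_right_mono) auto
    then show "cmod (of_real x * z) \<le> cmod z" by (simp add: norm_mult)
    then show "cmod (of_real x * z) < 1" using z by linarith
  qed
  have der: "(\<Psi> has_vector_derivative \<gamma> * ((of_real x * z) powr (\<gamma> - 1) * (h (of_real x * z) - s)) * z) (at x)"
    if x: "0 < x" "x \<le> 1" for x
  proof -
    define u where "u = of_real x * z"
    have u: "cmod u < 1" "u \<noteq> 0" using xz(1)[of x] x z by (auto simp: u_def)
    have d1: "(p has_vector_derivative (\<gamma> / of_real x * p x)) (at x)"
    proof -
      have "((\<lambda>x. \<gamma> * (of_real (ln x) + Ln z)) has_vector_derivative (\<gamma> / of_real x)) (at x)"
        using x by (auto intro!: derivative_eq_intros simp: has_vector_derivative_def scaleR_conv_of_real field_simps)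
      from field_vector_diff_chain_at[OF this DERIV_exp] show ?thesis by (simp add: p_def o_def mult_ac)
    qed
    have "((\<lambda>x. of_real x * z) has_vector_derivative z) (at x)"
      by (auto intro!: derivative_eq_intros simp: has_vector_derivative_def scaleR_conv_of_real)
    from field_vector_diff_chain_at[OF this, of h2 "deriv h2 u"]
    have "((\<lambda>x. h2 (of_real x * z)) has_vector_derivative (z * deriv h2 u)) (at x)"
      using holomorphic_derivI[OF hol open_ball, of u] u by (simp add: u_def o_def)
    then have d2: "((\<lambda>x. h2 (of_real x * z) - s) has_vector_derivative (z * deriv h2 u)) (at x)"
      by (auto intro!: derivative_eq_intros)
    have d: "((\<lambda>x. p x * (h2 (of_real x * z) - s)) has_vector_derivative (p x * (z * deriv h2 u) + \<gamma> / of_real x * p x * (h2 u - s))) (at x)"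
      using has_vector_derivative_mult[OF d1 d2] by (simp add: u_def)
    have "p x * (z * deriv h2 u) + \<gamma> / of_real x * p x * (h2 u - s) = p x / of_real x * (u * deriv h2 u + \<gamma> * (h2 u - s))"
      using x by (simp add: u_def field_simps)
    also have "\<dots> = p x / of_real x * (\<gamma> * (h u - s))" using ode[OF u(1)] by (simp add: algebra_simps)
    also have "\<dots> = \<gamma> * (p x / u * (h u - s)) * z" using x z by (simp add: u_def)
    also have "p x / u = u powr (\<gamma> - 1)"
    proof -
      have "exp (Ln u) = u" using u by simp
      moreover have "Ln u = of_real (ln x) + Ln z" unfolding u_def by (rule lnx[OF x(1)])
      ultimately have ex: "exp (of_real (ln x) + Ln z) = u" by simp
      have "u powr (\<gamma> - 1) = exp (\<gamma> * (of_real (ln x) + Ln z) - (of_real (ln x) + Ln z))"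
        unfolding u_def powr_eq[OF x(1)] by (simp only: left_diff_distrib mult_1)
      also have "\<dots> = p x / u" unfolding exp_diff ex p_def ..
      finally show ?thesis by simp
    qed
    finally have eq: "p x * (z * deriv h2 u) + \<gamma> / of_real x * p x * (h2 u - s) = \<gamma> * (u powr (\<gamma> - 1) * (h u - s)) * z" .
    have "(\<Psi> has_vector_derivative (\<gamma> * (u powr (\<gamma> - 1) * (h u - s)) * z)) (at x)"
      using d[unfolded eq]
      by (rule has_vector_derivative_transform_within_open[of _ _ _ "{0<..}"]) (use x in \<open>auto simp: \<Psi>_def\<close>)
    then show ?thesis by (simp add: u_def)
  qed
  have cont: "continuous_on {0..1} \<Psi>"
  proof (unfold continuous_on_eq_continuous_within)
    show "\<forall>x\<in>{0..1}. continuous (at x within {0..1}) \<Psi>"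
    proof
      fix x :: real assume x: "x \<in> {0..1}"
      show "continuous (at x within {0..1}) \<Psi>"
      proof (cases "x = 0")
        case False
        then have "isCont \<Psi> x" using der[of x] x by (intro has_vector_derivative_continuous) auto
        then show ?thesis by (rule continuous_at_imp_continuous_at_within)
      next
        case True
        define K where "K = exp (Re (\<gamma> * Ln z)) * (C * cmod z powr (\<sigma> - Re \<gamma>))"
        have "cmod (\<Psi> y) \<le> K * y powr \<sigma>" if y: "0 < y" "y \<le> 1" for y
        proof -
          have "cmod (h2 (of_real y * z) - s) \<le> C * cmod (of_real y * z) powr (\<sigma> - Re \<gamma>)"
            using y z xz(2)[of y] by (intro bound) auto
          also have "\<dots> = C * (y powr (\<sigma> - Re \<gamma>) * cmod z powr (\<sigma> - Re \<gamma>))" using y by (simp add: norm_mult powr_mult)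
          finally have 1: "cmod (h2 (of_real y * z) - s) \<le> C * (y powr (\<sigma> - Re \<gamma>) * cmod z powr (\<sigma> - Re \<gamma>))" .
          have "cmod (p y) = exp (Re \<gamma> * ln y + Re (\<gamma> * Ln z))" by (simp add: p_def algebra_simps)
          also have "\<dots> = y powr Re \<gamma> * exp (Re (\<gamma> * Ln z))" using y by (simp add: exp_add powr_def)
          finally have 2: "cmod (p y) = y powr Re \<gamma> * exp (Re (\<gamma> * Ln z))" .
          have "cmod (\<Psi> y) = cmod (p y) * cmod (h2 (of_real y * z) - s)" using y by (simp add: \<Psi>_def norm_mult)
          also have "\<dots> \<le> cmod (p y) * (C * (y powr (\<sigma> - Re \<gamma>) * cmod z powr (\<sigma> - Re \<gamma>)))" using 1 by (intro mult_left_mono) auto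
          also have "\<dots> = K * (y powr Re \<gamma> * y powr (\<sigma> - Re \<gamma>))" by (simp add: 2 K_def mult_ac)
          also have "y powr Re \<gamma> * y powr (\<sigma> - Re \<gamma>) = y powr \<sigma>" by (simp add: powr_add[symmetric])
          finally show ?thesis .
        qed
        then have "\<forall>\<^sub>F y in at 0 within {0..1}. norm (\<Psi> y) \<le> K * y powr \<sigma>"
          unfolding eventually_at_filter by (intro always_eventually) auto
        moreover have "((\<lambda>y. K * y powr \<sigma>) \<longlongrightarrow> 0) (at 0 within {0..1})"
        proof -
          have "((\<lambda>y. K * y powr \<sigma>) \<longlongrightarrow> K * 0 powr \<sigma>) (at 0 within {0..1})"
            using \<sigma> by (intro tendsto_mult tendsto_const tendsto_powr' tendsto_ident_at) (auto simp: eventually_at_filter intro!: always_eventually)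
          then show ?thesis by simp
        qed
        ultimately have "(\<Psi> \<longlongrightarrow> 0) (at 0 within {0..1})" by (rule Lim_null_comparison)
        then show ?thesis unfolding True continuous_within by (simp add: \<Psi>_def)
      qed
    qed
  qed
  have "((\<lambda>x. \<gamma> * ((of_real x * z) powr (\<gamma> - 1) * (h (of_real x * z) - s)) * z) has_integral (\<Psi> 1 - \<Psi> 0)) {0..1}"
    by (rule fundamental_theorem_of_calculus_interior[OF _ cont]) (use der in auto)
  moreover have "\<Psi> 1 - \<Psi> 0 = z powr \<gamma> * (h2 z - s)" using powr_eq[of 1 \<gamma>] by (simp add: \<Psi>_def p_def)
  moreover have "linepath 0 z x = of_real x * z" for x :: real by (simp add: linepath_def scaleR_conv_of_real)
  ultimately show ?thesis unfolding has_contour_integral_linepath by simp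
qed

text \<open>
  Let \<open>c = -(m+1) Re \<gamma> > 0\<close>. For small \<open>r = |z|\<close> the factor \<open>1 - |z|\<^sup>(\<^sup>m\<^sup>+\<^sup>1\<^sup>)\<^sup>\<gamma>\<close> has size about \<open>r\<^sup>-\<^sup>c\<close>, so \<open>h' = O(r\<^sup>c\<^sup>-\<^sup>1)\<close>,
  and Cauchy's inequality bounds the coefficient of order \<open>n\<close> by a multiple of \<open>r\<^sup>c\<^sup>-\<^sup>n\<close>, which tends to zero.
\<close>

lemma early_coefficients_vanish:
  fixes h :: "complex \<Rightarrow> complex" and \<gamma> :: complex and m M0 :: real
  assumes hol: "h holomorphic_on ball 0 1" and nz: "\<And>z. cmod z < 1 \<Longrightarrow> h z \<noteq> 0" and m: "0 < m"
    and bd: "\<And>z. z \<noteq> 0 \<Longrightarrow> cmod z < 1 \<Longrightarrow>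
      cmod ((1 - exp (of_real ((m + 1) * ln (cmod z)) * \<gamma>)) * (z * deriv h z / h z)) \<le> M0"
    and n: "1 \<le> n" "real n < - (m + 1) * Re \<gamma>"
  shows "(deriv ^^ n) h 0 = 0"
proof -
  define c where "c = - (m + 1) * Re \<gamma>"
  have c: "0 < c" "real n < c" using n by (auto simp: c_def)
  obtain j where j: "n = Suc j" using n by (cases n) auto
  have "continuous_on (cball 0 (1/2)) h"
    by (intro holomorphic_on_imp_continuous_on holomorphic_on_subset[OF hol]) auto
  then have "bounded (h ` cball 0 (1/2))" by (intro compact_imp_bounded compact_continuous_image) auto
  then obtain B where B: "\<forall>z\<in>cball 0 (1/2). cmod (h z) \<le> B" by (auto simp: bounded_iff)
  have M0: "0 \<le> M0" by (rule order_trans[OF norm_ge_zero bd[of "1/2"]]) simp_all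
  \<comment> \<open>For \<open>r \<le> \<rho>\<close> the power \<open>r\<^sup>-\<^sup>c\<close> is at least \<open>2\<close>.\<close>
  define \<rho> where "\<rho> = min (1/2) (2 powr (- 1 / c))"
  have \<rho>: "0 < \<rho>" "\<rho> \<le> 1/2" by (auto simp: \<rho>_def)
  define K where "K = fact j * (2 * M0 * B)"
  have est: "cmod ((deriv ^^ n) h 0) \<le> K * r powr (c - real n)" if r: "0 < r" "r < \<rho>" for r
  proof -
    have r2: "r \<le> 1/2" using r \<rho> by simp
    have "(2 powr (- 1 / c)) powr (- c) \<le> r powr (- c)"
      using r c by (intro powr_mono2') (auto simp: \<rho>_def)
    then have big: "2 \<le> r powr (- c)" using c by (simp add: powr_powr)
    have dh: "cmod (deriv h z) \<le> 2 * M0 * B * r powr (c - 1)" if z: "cmod (0 - z) = r" for z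
    proof -
      have zr: "cmod z = r" "z \<noteq> 0" "cmod z < 1" using z r r2 by auto
      define E where "E = exp (of_real ((m + 1) * ln (cmod z)) * \<gamma>)"
      have "cmod E = exp ((m + 1) * ln r * Re \<gamma>)" by (simp add: E_def zr)
      also have "\<dots> = r powr (- c)" using r by (simp add: powr_def c_def algebra_simps)
      finally have "r powr (- c) - 1 \<le> cmod (1 - E)"
        using norm_triangle_ineq3[of 1 E] by (simp add: abs_le_iff)
      then have "r powr (- c) / 2 \<le> cmod (1 - E)" using big by linarith
      then have "r powr (- c) / 2 * cmod (z * deriv h z / h z) \<le> cmod (1 - E) * cmod (z * deriv h z / h z)"
        by (intro mult_right_mono) auto
      also have "\<dots> \<le> M0" unfolding E_def norm_mult[symmetric] by (rule bd[OF zr(2,3)])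
      finally have "r powr (- c) / 2 * (r * cmod (deriv h z) / cmod (h z)) \<le> M0" by (simp add: norm_mult norm_divide zr)
      moreover have hz: "0 < cmod (h z)" "cmod (h z) \<le> B" using nz[OF zr(3)] B zr r2 by auto
      ultimately have "r powr (- c) * r * cmod (deriv h z) \<le> 2 * M0 * cmod (h z)" by (simp add: field_simps)
      also have "\<dots> \<le> 2 * M0 * B" using hz M0 by (intro mult_left_mono) auto
      finally have "r powr (c - 1) * (r powr (- c) * r * cmod (deriv h z)) \<le> r powr (c - 1) * (2 * M0 * B)"
        by (intro mult_left_mono) auto
      moreover have "r powr (c - 1) * (r powr (- c) * r) = 1"
        using r by (simp add: powr_add[symmetric] powr_minus powr_diff field_simps)
      then have "r powr (c - 1) * (r powr (- c) * r * cmod (deriv h z)) = cmod (deriv h z)"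
        by (metis mult.assoc mult_1)
      ultimately have "cmod (deriv h z) \<le> r powr (c - 1) * (2 * M0 * B)" by (simp only:)
      then show ?thesis by (simp add: mult_ac)
    qed
    have sub: "cball (0::complex) r \<subseteq> ball 0 1" using r2 by auto
    have hol': "deriv h holomorphic_on cball 0 r" by (rule holomorphic_on_subset[OF holomorphic_deriv[OF hol open_ball] sub])
    have "norm ((deriv ^^ j) (deriv h) 0) \<le> fact j * (2 * M0 * B * r powr (c - 1)) / r ^ j"
      using hol' r dh
      by (intro Cauchy_inequality holomorphic_on_imp_continuous_on) (auto intro: holomorphic_on_subset)
    also have "\<dots> = K * (r powr (c - 1) / r ^ j)" by (simp add: K_def)
    also have "r powr (c - 1) / r ^ j = r powr (c - real n)"
      using r by (simp add: powr_realpow[symmetric] powr_diff[symmetric] j algebra_simps)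
    finally show ?thesis by (simp add: j funpow_Suc_right del: funpow.simps)
  qed
  have "((\<lambda>r. K * r powr (c - real n)) \<longlongrightarrow> K * 0 powr (c - real n)) (at_right 0)"
    using c by (intro tendsto_mult tendsto_const tendsto_powr' tendsto_ident_at) (auto simp: eventually_at_filter intro!: always_eventually)
  then have lim: "((\<lambda>r. K * r powr (c - real n)) \<longlongrightarrow> 0) (at_right 0)" by simp
  have ev: "\<forall>\<^sub>F r in at_right 0. cmod ((deriv ^^ n) h 0) \<le> K * r powr (c - real n)"
    using eventually_at_right_real[OF \<rho>(1)] by eventually_elim (use est in auto)
  have "cmod ((deriv ^^ n) h 0) \<le> 0"
    by (rule tendsto_lowerbound[OF lim ev]) simp
  then show ?thesis by simp
qed

lemma normalized_logarithm:
  assumes "u holomorphic_on ball 0 1" "\<And>z. cmod z < 1 \<Longrightarrow> u z \<noteq> 0" "u 0 = 1"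
  obtains l where "l holomorphic_on ball 0 1" "l 0 = 0" "\<And>z. cmod z < 1 \<Longrightarrow> u z = exp (l z)"
    "\<And>z. cmod z < 1 \<Longrightarrow> deriv l z = deriv u z / u z"
proof -
  obtain g where g: "g holomorphic_on ball 0 1" "\<And>z. z \<in> ball 0 1 \<Longrightarrow> u z = exp (g z)"
    using contractible_imp_holomorphic_log[OF assms(1) convex_imp_contractible[OF convex_ball]] assms(2) by auto
  define l where "l = (\<lambda>z. g z - g 0)"
  have l: "l holomorphic_on ball 0 1" unfolding l_def by (intro holomorphic_intros g)
  have ul: "u z = exp (l z)" if "cmod z < 1" for z
    using g(2)[of z] g(2)[of 0] assms(3) that by (simp add: l_def exp_diff)
  have "deriv l z = deriv u z / u z" if z: "cmod z < 1" for z
  proof -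
    have "(l has_field_derivative deriv l z) (at z)" using holomorphic_derivI[OF l open_ball, of z] z by simp
    then have "((\<lambda>z. exp (l z)) has_field_derivative (exp (l z) * deriv l z)) (at z)"
      by (auto intro!: derivative_eq_intros)
    then have "(u has_field_derivative (exp (l z) * deriv l z)) (at z)"
      by (rule has_field_derivative_transform_within_open[of _ _ _ "ball 0 1"]) (use z ul in auto)
    then have "deriv u z = exp (l z) * deriv l z" by (rule DERIV_imp_deriv)
    then show ?thesis using ul[OF z] by simp
  qed
  then show thesis using that[of l] l ul by (simp add: l_def)
qed

text \<open>
  Dividing numerator and denominator by \<open>z\<close> removes the singularity at the origin.
\<close>

lemma quot_A_properties:
  assumes g: "g \<in> class_A" and \<phi>: "\<phi> \<in> class_A"
    and gnz: "\<And>z. z \<in> unit_disk - {0} \<Longrightarrow> g z \<noteq> 0" and \<phi>nz: "\<And>z. z \<in> unit_disk - {0} \<Longrightarrow> \<phi> z \<noteq> 0"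
  shows "quot_A g \<phi> holomorphic_on ball 0 1" "\<And>z. cmod z < 1 \<Longrightarrow> quot_A g \<phi> z \<noteq> 0" "quot_A g \<phi> 0 = 1"
    "\<And>z. cmod z < 1 \<Longrightarrow> z * deriv (quot_A g \<phi>) z / quot_A g \<phi> z = zlog_deriv g z - zlog_deriv \<phi> z"
proof -
  have fac: "(\<lambda>z. if z = 0 then 1 else f z / z) holomorphic_on ball 0 1" if "f \<in> class_A" for f
  proof -
    have "(\<lambda>z. if z = 0 then deriv f 0 else (f z - f 0) / (z - 0)) holomorphic_on ball 0 1"
      using that by (intro pole_lemma) (auto simp: class_A_def unit_disk_def)
    moreover have "(\<lambda>z. if z = 0 then deriv f 0 else (f z - f 0) / (z - 0)) = (\<lambda>z. if z = 0 then 1 else f z / z)"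
      using that by (auto simp: class_A_def)
    ultimately show ?thesis by simp
  qed
  have nz: "g z \<noteq> 0" "\<phi> z \<noteq> 0" if "cmod z < 1" "z \<noteq> 0" for z
    using gnz[of z] \<phi>nz[of z] that by (auto simp: unit_disk_def)
  have "(\<lambda>z. (if z = 0 then 1 else g z / z) / (if z = 0 then 1 else \<phi> z / z)) holomorphic_on ball 0 1"
    using nz by (intro holomorphic_on_divide fac g \<phi>) auto
  then show hol: "quot_A g \<phi> holomorphic_on ball 0 1"
    by (rule holomorphic_transform) (auto simp: quot_A_def)
  show "quot_A g \<phi> z \<noteq> 0" if "cmod z < 1" for z using nz that by (simp add: quot_A_def)
  show "quot_A g \<phi> 0 = 1" by (simp add: quot_A_def)
  show "z * deriv (quot_A g \<phi>) z / quot_A g \<phi> z = zlog_deriv g z - zlog_deriv \<phi> z" if z: "cmod z < 1" for z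
  proof (cases "z = 0")
    case False
    have d: "(g has_field_derivative deriv g z) (at z)" "(\<phi> has_field_derivative deriv \<phi> z) (at z)"
      using g \<phi> z by (auto simp: class_A_def unit_disk_def intro!: holomorphic_derivI[OF _ open_ball])
    have "((\<lambda>z. g z / \<phi> z) has_field_derivative ((deriv g z * \<phi> z - g z * deriv \<phi> z) / (\<phi> z * \<phi> z))) (at z)"
      using d nz[OF z False] by (intro DERIV_divide) auto
    then have "(quot_A g \<phi> has_field_derivative ((deriv g z * \<phi> z - g z * deriv \<phi> z) / (\<phi> z * \<phi> z))) (at z)"
      by (rule has_field_derivative_transform_within_open[of _ _ _ "- {0}"]) (use False in \<open>auto simp: quot_A_def\<close>)
    then have dq: "deriv (quot_A g \<phi>) z = (deriv g z * \<phi> z - g z * deriv \<phi> z) / (\<phi> z * \<phi> z)" by (rule DERIV_imp_deriv)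
    show ?thesis unfolding dq using nz[OF z False] False by (simp add: zlog_deriv_def quot_A_def field_simps)
  qed (simp add: zlog_deriv_def)
qed

text \<open>
  Both branches in the definition of the bracket evaluate to \<open>z\<^sup>\<gamma> h2(z)\<close>. In the second one the
  integral converges because \<open>h2 - 1 = O(|u|\<^sup>N)\<close> with \<open>N + Re \<gamma> > 0\<close>.
\<close>

lemma h2_germ_eq:
  fixes h h2 :: "complex \<Rightarrow> complex"
  assumes \<gamma>: "\<gamma> \<noteq> 0" and hol: "h2 holomorphic_on ball 0 1"
    and ode: "\<And>u. cmod u < 1 \<Longrightarrow> u * deriv h2 u = \<gamma> * (h u - h2 u)"
    and M: "0 \<le> M" and near1: "\<And>u. cmod u \<le> 1 / 2 \<Longrightarrow> cmod (h2 u - 1) \<le> M * cmod u ^ N"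
    and N: "1 \<le> N" "- Re \<gamma> < real N"
    and z: "z \<noteq> 0" "cmod z \<le> 1 / 2"
    and germ: "\<And>u. cmod u \<le> cmod z \<Longrightarrow> h_germ \<alpha> \<beta> f g \<phi> u = h u"
  shows "h2_germ \<alpha> \<beta> \<gamma> f g \<phi> z = h2 z"
proof -
  have z1: "cmod z < 1" using z by simp
  have path: "h_germ \<alpha> \<beta> f g \<phi> u = h u" if "u \<in> path_image (linepath 0 z)" for u
    using that by (intro germ) (auto simp: closed_segment_def norm_mult mult_left_le_one_le)
  have int: "\<gamma> * contour_integral (linepath 0 z) (\<lambda>u. u powr (\<gamma> - 1) * (h_germ \<alpha> \<beta> f g \<phi> u - s)) = z powr \<gamma> * (h2 z - s)"
    if "((\<lambda>u. \<gamma> * (u powr (\<gamma> - 1) * (h u - s))) has_contour_integral (z powr \<gamma> * (h2 z - s))) (linepath 0 z)" for s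
  proof -
    have "((\<lambda>u. (1 / \<gamma>) * (\<gamma> * (u powr (\<gamma> - 1) * (h u - s)))) has_contour_integral ((1 / \<gamma>) * (z powr \<gamma> * (h2 z - s)))) (linepath 0 z)"
      by (rule has_contour_integral_lmul[OF that])
    then have "((\<lambda>u. u powr (\<gamma> - 1) * (h_germ \<alpha> \<beta> f g \<phi> u - s)) has_contour_integral ((1 / \<gamma>) * (z powr \<gamma> * (h2 z - s)))) (linepath 0 z)"
      by (rule has_contour_integral_eq) (use \<gamma> path in simp)
    then show ?thesis using \<gamma> by (simp add: contour_integral_unique)
  qed
  have "bracket \<alpha> \<beta> \<gamma> f g \<phi> z = z powr \<gamma> * h2 z"
  proof (cases "0 < Re \<gamma>")
    case True
    have "cmod (h2 u - 0) \<le> (1 + M) * cmod u powr (Re \<gamma> - Re \<gamma>)" if "u \<noteq> 0" "cmod u \<le> cmod z" for u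
    proof -
      have u2: "cmod u \<le> 1 / 2" using that z by simp
      have "cmod (h2 u) \<le> 1 + cmod (h2 u - 1)" using norm_triangle_sub[of "h2 u" 1] by simp
      also have "cmod (h2 u - 1) \<le> M * cmod u ^ N" by (rule near1[OF u2])
      also have "M * cmod u ^ N \<le> M * 1" using M u2 by (intro mult_left_mono power_le_one) auto
      finally show ?thesis using that by simp
    qed
    from int[OF power_weighted_contour_integral[OF hol ode z(1) z1 True this]] True
    show ?thesis by (simp add: bracket_def)
  next
    case False
    have "cmod (h2 u - 1) \<le> M * cmod u powr ((Re \<gamma> + real N) - Re \<gamma>)" if "u \<noteq> 0" "cmod u \<le> cmod z" for u
      using near1[of u] that z by (simp add: powr_realpow)
    moreover have "0 < Re \<gamma> + real N" using N by simp
    ultimately have "((\<lambda>u. \<gamma> * (u powr (\<gamma> - 1) * (h u - 1))) has_contour_integral (z powr \<gamma> * (h2 z - 1))) (linepath 0 z)"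
      by (intro power_weighted_contour_integral[OF hol ode z(1) z1])
    from int[OF this] False show ?thesis by (simp add: bracket_def algebra_simps)
  qed
  then show ?thesis using z by (simp add: h2_germ_def)
qed

theorem theorem4p1:
  fixes f g \<phi> :: "complex \<Rightarrow> complex" and m k :: real and \<alpha> \<beta> \<gamma> :: complex
  assumes "f \<in> class_A" and "g \<in> class_A" and "\<phi> \<in> class_A"
    and "\<And>z. z \<in> unit_disk - {0} \<Longrightarrow> g z \<noteq> 0"
    and "\<And>z. z \<in> unit_disk - {0} \<Longrightarrow> \<phi> z \<noteq> 0"
    and "\<And>z. z \<in> unit_disk \<Longrightarrow> deriv f z \<noteq> 0"
    and "m > 0" and "\<gamma> \<noteq> 0" and "0 \<le> k" and "k < 1"
    and "\<And>z. z \<in> unit_disk \<Longrightarrow>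
      cmod ((1 - complex_of_real (cmod z) powr (of_real (m + 1) * \<gamma>)) / \<gamma> *
              (\<alpha> * (z * deriv (deriv f) z / deriv f z)
                + \<beta> * (zlog_deriv g z - zlog_deriv \<phi> z))
            - of_real ((m - 1) / 2))
        \<le> k * ((m + 1) / 2)"
  shows "\<exists>F. is_F_op \<alpha> \<beta> \<gamma> f g \<phi> F \<and> has_quasiconformal_extension F"
proof -
  note m = assms(7) and \<gamma> = assms(8) and k = assms(9,10)
  have f: "f holomorphic_on ball 0 1" "deriv f 0 = 1" using assms(1) by (auto simp: class_A_def unit_disk_def)
  obtain lf where lf: "lf holomorphic_on ball 0 1" "lf 0 = 0" "\<And>z. cmod z < 1 \<Longrightarrow> deriv f z = exp (lf z)"
    "\<And>z. cmod z < 1 \<Longrightarrow> deriv lf z = deriv (deriv f) z / deriv f z"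
    using normalized_logarithm[OF holomorphic_deriv[OF f(1) open_ball] _ f(2)] assms(6)
    by (auto simp: unit_disk_def)
  have Q: "quot_A g \<phi> holomorphic_on ball 0 1" "\<And>z. cmod z < 1 \<Longrightarrow> quot_A g \<phi> z \<noteq> 0" "quot_A g \<phi> 0 = 1"
    "\<And>z. cmod z < 1 \<Longrightarrow> z * deriv (quot_A g \<phi>) z / quot_A g \<phi> z = zlog_deriv g z - zlog_deriv \<phi> z"
    using quot_A_properties[of g \<phi>] assms(2-5) by blast+
  obtain lq where lq: "lq holomorphic_on ball 0 1" "lq 0 = 0" "\<And>z. cmod z < 1 \<Longrightarrow> quot_A g \<phi> z = exp (lq z)"
    "\<And>z. cmod z < 1 \<Longrightarrow> deriv lq z = deriv (quot_A g \<phi>) z / quot_A g \<phi> z"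
    using normalized_logarithm[OF Q(1-3)] by blast
  define h where "h = (\<lambda>z. exp (\<alpha> * lf z + \<beta> * lq z))"
  have hol_h: "h holomorphic_on ball 0 1" unfolding h_def by (intro holomorphic_intros lf lq)
  have h_nz: "h z \<noteq> 0" for z by (simp add: h_def)
  have h_0: "h 0 = 1" by (simp add: h_def lf lq)
  have G: "z * deriv h z / h z = \<alpha> * (z * deriv (deriv f) z / deriv f z) + \<beta> * (zlog_deriv g z - zlog_deriv \<phi> z)"
    if z: "cmod z < 1" for z
  proof -
    have "(lf has_field_derivative deriv lf z) (at z)" "(lq has_field_derivative deriv lq z) (at z)"
      using holomorphic_derivI[OF lf(1) open_ball, of z] holomorphic_derivI[OF lq(1) open_ball, of z] z by auto
    then have "(h has_field_derivative (h z * (\<alpha> * deriv lf z + \<beta> * deriv lq z))) (at z)"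
      unfolding h_def by (auto intro!: derivative_eq_intros)
    then have "deriv h z = h z * (\<alpha> * deriv lf z + \<beta> * deriv lq z)" by (rule DERIV_imp_deriv)
    then have "z * deriv h z / h z = \<alpha> * (z * deriv lf z) + \<beta> * (z * deriv lq z)"
      using h_nz[of z] by (simp add: field_simps)
    then show ?thesis using Q(4)[OF z] by (simp add: lf(4)[OF z] lq(4)[OF z])
  qed
  have cond: "cmod ((1 - exp (of_real ((m + 1) * ln (cmod z)) * \<gamma>)) / \<gamma> * (z * deriv h z / h z) - of_real ((m - 1) / 2))
    \<le> k * ((m + 1) / 2)" if z: "cmod z < 1" "z \<noteq> 0" for z
  proof -
    have "complex_of_real (cmod z) powr (of_real (m + 1) * \<gamma>) = exp (of_real ((m + 1) * ln (cmod z)) * \<gamma>)"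
      using z Ln_of_real[of "cmod z"] by (simp add: powr_def mult_ac)
    then show ?thesis using assms(11)[of z] z unfolding G[OF z(1)] by (simp add: unit_disk_def)
  qed
  have mk: "\<bar>m - 1\<bar> \<le> k * (m + 1)"
  proof -
    have "cmod (of_real ((m - 1) / 2)) \<le> k * ((m + 1) / 2)"
      using assms(11)[of 0] by (simp add: unit_disk_def zlog_deriv_def)
    then show ?thesis unfolding norm_of_real by simp
  qed
  define c where "c = - (m + 1) * Re \<gamma>"
  have vanish: "(deriv ^^ n) h 0 = 0" if n: "1 \<le> n" "real n < c" for n
  proof (rule early_coefficients_vanish[OF hol_h h_nz m _ n(1) n(2)[unfolded c_def]])
    fix z :: complex assume z: "z \<noteq> 0" "cmod z < 1"
    define X where "X = (1 - exp (of_real ((m + 1) * ln (cmod z)) * \<gamma>)) * (z * deriv h z / h z)"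
    have "cmod (X / \<gamma>) \<le> cmod (X / \<gamma> - of_real ((m - 1) / 2)) + cmod (of_real ((m - 1) / 2) :: complex)"
      by (metis norm_triangle_sub add.commute)
    also have "\<dots> \<le> k * ((m + 1) / 2) + \<bar>m - 1\<bar> / 2"
      using cond[OF z(2,1)] unfolding norm_of_real by (simp add: X_def mult.commute)
    finally have "cmod X / cmod \<gamma> \<le> k * ((m + 1) / 2) + \<bar>m - 1\<bar> / 2" by (simp add: norm_divide)
    then have "cmod X \<le> (k * ((m + 1) / 2) + \<bar>m - 1\<bar> / 2) * cmod \<gamma>" using \<gamma> by (simp add: pos_divide_le_eq)
    then show "cmod ((1 - exp (of_real ((m + 1) * ln (cmod z)) * \<gamma>)) * (z * deriv h z / h z))
      \<le> (k * ((m + 1) / 2) + \<bar>m - 1\<bar> / 2) * cmod \<gamma>" unfolding X_def .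
  qed
  have c_gt: "- Re \<gamma> < c" if "Re \<gamma> < 0" using that m mult_pos_neg[of m "Re \<gamma>"] by (simp add: c_def algebra_simps)
  obtain h2 N M where h2: "h2 holomorphic_on ball 0 1" "h2 0 = 1"
    "\<And>z. cmod z < 1 \<Longrightarrow> z * deriv h2 z = \<gamma> * (h z - h2 z)"
    and N: "1 \<le> N" "c \<le> real N" and M: "0 \<le> M"
    "\<And>z. cmod z \<le> 1 / 2 \<Longrightarrow> cmod (h2 z - h z) \<le> M * cmod z ^ N"
    "\<And>z. cmod z \<le> 1 / 2 \<Longrightarrow> cmod (h2 z - 1) \<le> M * cmod z ^ N"
    using power_averaging_ode_solution[OF hol_h h_0 \<gamma> c_gt vanish] by blast
  have growth: "cmod ((h2 z - h z) * exp (- (of_real ((m + 1) * t) * \<gamma>))) \<le> M * (cmod z * exp t)"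
    if t: "0 \<le> t" and z: "cmod z \<le> exp (- t) / 2" for z t
  proof -
    have zt: "cmod z \<le> exp (- t)" using z exp_gt_zero[of "- t"] by linarith
    have "exp (- t) \<le> 1" using t by simp
    then have z2: "cmod z \<le> 1 / 2" using z by linarith
    obtain j where j: "N = Suc j" using N by (cases N) auto
    have "cmod z ^ j \<le> exp (- t) ^ j" using zt by (intro power_mono) auto
    also have "\<dots> = exp (- (real j * t))" by (simp add: exp_of_nat_mult[symmetric])
    finally have zj: "cmod z ^ j \<le> exp (- (real j * t))" .
    have "Re (- (of_real ((m + 1) * t) * \<gamma>)) = c * t" by (simp add: c_def algebra_simps)
    then have "cmod ((h2 z - h z) * exp (- (of_real ((m + 1) * t) * \<gamma>))) = cmod (h2 z - h z) * exp (c * t)"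
      by (simp only: norm_mult norm_exp_eq_Re)
    also have "\<dots> \<le> M * cmod z ^ N * exp (c * t)" using M(2)[OF z2] by (intro mult_right_mono) auto
    also have "\<dots> = M * (cmod z * (cmod z ^ j * exp (c * t)))" by (simp add: j mult_ac)
    also have "\<dots> \<le> M * (cmod z * exp t)"
    proof (intro mult_left_mono)
      have "cmod z ^ j * exp (c * t) \<le> exp (- (real j * t)) * exp (c * t)" using zj by (intro mult_right_mono) auto
      also have "\<dots> = exp ((c - real j) * t)" by (simp add: exp_add[symmetric] algebra_simps)
      also have "\<dots> \<le> exp (1 * t)"
        unfolding exp_le_cancel_iff using N j t by (intro mult_right_mono) auto
      finally show "cmod z ^ j * exp (c * t) \<le> exp t" by simp
    qed (use M in auto)
    finally show ?thesis .
  qed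
  interpret loewner_data h h2 \<gamma> m k M
    by unfold_locales (use m \<gamma> k hol_h h_nz h_0 h2 mk cond growth in auto)
  have lim: "isCont lf 0" "isCont lq 0" "isCont h2 0"
    using lf(1) lq(1) h2(1) by (auto intro!: holomorphic_on_imp_continuous_on[THEN continuous_on_interior])
  have "\<forall>\<^sub>F u in nhds 0. dist (lf u) (lf 0) < 1" "\<forall>\<^sub>F u in nhds 0. dist (lq u) (lq 0) < 1"
    "\<forall>\<^sub>F u in nhds 0. dist (h2 u) (h2 0) < 1"
    using lim by (auto simp: isCont_def tendsto_at_iff_tendsto_nhds intro: tendstoD)
  moreover have "\<forall>\<^sub>F u in nhds (0::complex). u \<in> ball 0 (1/2)" by (intro eventually_nhds_in_open) auto
  ultimately have "\<forall>\<^sub>F u in nhds 0. cmod (lf u) < 1 \<and> cmod (lq u) < 1 \<and> cmod (h2 u - 1) < 1 \<and> cmod u < 1/2"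
    by eventually_elim (auto simp: lf(2) lq(2) h2(2) dist_norm)
  then obtain d where d: "0 < d" "\<And>u. cmod u < d \<Longrightarrow> cmod (lf u) < 1 \<and> cmod (lq u) < 1 \<and> cmod (h2 u - 1) < 1 \<and> cmod u < 1/2"
    unfolding eventually_nhds_metric by auto
  have germ: "h_germ \<alpha> \<beta> f g \<phi> u = h u" if u: "cmod u < d" for u
  proof -
    have u1: "cmod u < 1" using d(2)[OF u] by linarith
    \<comment> \<open>So close to \<open>0\<close> the normalized logarithms have small imaginary part and agree with \<open>Ln\<close>.\<close>
    have Ln_exp': "Ln (exp w) = w" if "cmod w < 1" for w
      using that abs_Im_le_cmod[of w] pi_gt3 by (intro Ln_exp) auto
    show ?thesis using d(2)[OF u] by (simp add: h_germ_def h_def powr_def lf(3)[OF u1] lq(3)[OF u1] Ln_exp' exp_add)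
  qed
  have N': "- Re \<gamma> < real N"
    using N c_gt by (cases "Re \<gamma> < 0") auto
  have "\<forall>\<^sub>F z in nhds 0. P z 0 = z * h2_germ \<alpha> \<beta> \<gamma> f g \<phi> z powr (1 / \<gamma>)"
  proof -
    have "\<forall>\<^sub>F z in nhds (0::complex). z \<in> ball 0 d" using d by (intro eventually_nhds_in_open) auto
    with P0_germ show ?thesis
    proof eventually_elim
      case (elim z)
      show ?case
      proof (cases "z = 0")
        case False
        have zd: "cmod z < d" using elim by simp
        have "h2_germ \<alpha> \<beta> \<gamma> f g \<phi> z = h2 z"
          by (rule h2_germ_eq[OF \<gamma> h2(1,3) M(1) M(3) N(1) N' False]) (use d(2)[OF zd] zd germ in auto)
        moreover have "h2 z \<noteq> 0" using d(2)[OF zd] by auto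
        ultimately show ?thesis using elim by (simp add: powr_def)
      qed (use elim in simp)
    qed
  qed
  then have "is_F_op \<alpha> \<beta> \<gamma> f g \<phi> (\<lambda>z. P z 0)"
    unfolding is_F_op_def unit_disk_def using hol_P0 by simp
  then show ?thesis using quasiconformal_extension by blast
qed

end
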